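(* Let $A$ and $B$ be finitely generated torsion-free nilpotent groups, let $C_A$ be a proper subgroup of $A$ and $C_B$ a proper subgroup of $B$, let $\phi:C_A\to C_B$ be an isomorphism, and suppose that $C_A$ has finite index in $A$ or $C_B$ has finite index in $B$. Let $G=\{A*B;\ C_A=C_B\}$ be the generalized free product of $A$ and $B$ amalgamating $C_A$ with $C_B$ via $\phi$. Then $G$ is an extension of a free group by a torsion-free nilpotent group. Furthermore, $G$ is residually solvable.
   Context: The generalized free product (amalgamated product) $\{A*B;\ C_A=C_B\}$ is the quotient of the free product $A*B$ by the normal closure of the elements $c\,(\phi(c))^{-1}$, $c\in C_A$. A group $G$ is an extension of $N$ by $Q$ if there is a short exact sequence $1\to N\to G\to Q\to 1$. A group $G$ is residually solvable if for every non-identity $g\in G$ there is a homomorphism from $G$ onto a solvable group under which the image of $g$ is not the identity. *)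

theory Defs
  imports "HOL-Algebra.Exact_Sequence"
begin

inductive_set word_cong :: "'s set \<Rightarrow> ('s list \<times> 's list) set \<Rightarrow> ('s list \<times> 's list) set"
  for S :: "'s set" and R :: "('s list \<times> 's list) set"
  where
    base: "(u, v) \<in> R \<Longrightarrow> u \<in> lists S \<Longrightarrow> v \<in> lists S \<Longrightarrow> (u, v) \<in> word_cong S R"
  | refl: "u \<in> lists S \<Longrightarrow> (u, u) \<in> word_cong S R"
  | sym: "(u, v) \<in> word_cong S R \<Longrightarrow> (v, u) \<in> word_cong S R"
  | trans: "(u, v) \<in> word_cong S R \<Longrightarrow> (v, w) \<in> word_cong S R \<Longrightarrow> (u, w) \<in> word_cong S R"
  | append: "(u, u') \<in> word_cong S R \<Longrightarrow> (v, v') \<in> word_cong S R \<Longrightarrow>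
      (u @ v, u' @ v') \<in> word_cong S R"

text \<open>The monoid with generating set \<open>S\<close> and defining relations \<open>u = v\<close> for \<open>(u, v) \<in> R\<close>:
  words over \<open>S\<close> modulo the congruence generated by \<open>R\<close>.\<close>

definition presented_monoid ::
    "'s set \<Rightarrow> ('s list \<times> 's list) set \<Rightarrow> 's list set monoid" where
  "presented_monoid S R =
     \<lparr>carrier = lists S // word_cong S R,
      mult = (\<lambda>P Q. \<Union>u\<in>P. \<Union>v\<in>Q. word_cong S R `` {u @ v}),
      one = word_cong S R `` {[]}\<rparr>"

text \<open>The letter \<open>(x, True)\<close> stands for the generator \<open>x\<close>, the letter \<open>(x, False)\<close> for its
  inverse.\<close>

definition free_group_relations :: "'x set \<Rightarrow> (('x \<times> bool) list \<times> ('x \<times> bool) list) set" where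
  "free_group_relations X = {([(x, b), (x, \<not> b)], []) | x b. x \<in> X}"

definition free_group_on :: "'x set \<Rightarrow> ('x \<times> bool) list set monoid" where
  "free_group_on X = presented_monoid (X \<times> UNIV) (free_group_relations X)"

text \<open>A basis of a free group may be taken inside the group, so it is no restriction that the
  elements of \<open>X\<close> have the same type as those of the group.\<close>

definition is_free_group :: "('a, 'm) monoid_scheme \<Rightarrow> bool" where
  "is_free_group F \<longleftrightarrow> group F \<and> (\<exists>X :: 'a set. free_group_on X \<cong> F)"

text \<open>Words in the elements of the two factors, where adjacent letters from the same factor may
  be multiplied and the identity of either factor may be deleted.\<close>

definition free_product_relations ::
    "('a, 'm) monoid_scheme \<Rightarrow> ('b, 'n) monoid_scheme \<Rightarrow>
     (('a + 'b) list \<times> ('a + 'b) list) set" where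
  "free_product_relations A B =
     {([Inl x, Inl y], [Inl (x \<otimes>\<^bsub>A\<^esub> y)]) | x y. x \<in> carrier A \<and> y \<in> carrier A}
     \<union> {([Inl \<one>\<^bsub>A\<^esub>], [])}
     \<union> {([Inr x, Inr y], [Inr (x \<otimes>\<^bsub>B\<^esub> y)]) | x y. x \<in> carrier B \<and> y \<in> carrier B}
     \<union> {([Inr \<one>\<^bsub>B\<^esub>], [])}"

definition free_product ::
    "('a, 'm) monoid_scheme \<Rightarrow> ('b, 'n) monoid_scheme \<Rightarrow> ('a + 'b) list set monoid" where
  "free_product A B =
     presented_monoid (carrier A <+> carrier B) (free_product_relations A B)"

definition free_product_inl ::
    "('a, 'm) monoid_scheme \<Rightarrow> ('b, 'n) monoid_scheme \<Rightarrow> 'a \<Rightarrow> ('a + 'b) list set" where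
  "free_product_inl A B a =
     word_cong (carrier A <+> carrier B) (free_product_relations A B) `` {[Inl a]}"

definition free_product_inr ::
    "('a, 'm) monoid_scheme \<Rightarrow> ('b, 'n) monoid_scheme \<Rightarrow> 'b \<Rightarrow> ('a + 'b) list set" where
  "free_product_inr A B b =
     word_cong (carrier A <+> carrier B) (free_product_relations A B) `` {[Inr b]}"

definition normal_closure :: "('a, 'm) monoid_scheme \<Rightarrow> 'a set \<Rightarrow> 'a set" where
  "normal_closure G S = \<Inter> {N. N \<lhd> G \<and> S \<subseteq> N}"

text \<open>Only \<open>C \<subseteq> carrier A\<close> and \<open>\<phi>\<close> are arguments; the amalgamated subgroup of \<open>B\<close> is \<open>\<phi> ` C\<close>.\<close>

definition amalgamated_product ::
    "('a, 'm) monoid_scheme \<Rightarrow> ('b, 'n) monoid_scheme \<Rightarrow> 'a set \<Rightarrow> ('a \<Rightarrow> 'b) \<Rightarrow>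
     ('a + 'b) list set set monoid" where
  "amalgamated_product A B C \<phi> =
     free_product A B Mod
       normal_closure (free_product A B)
         {free_product_inl A B c \<otimes>\<^bsub>free_product A B\<^esub>
            inv\<^bsub>free_product A B\<^esub> (free_product_inr A B (\<phi> c)) | c. c \<in> C}"

definition finitely_generated_group :: "('a, 'm) monoid_scheme \<Rightarrow> bool" where
  "finitely_generated_group G \<longleftrightarrow>
     group G \<and> (\<exists>S. finite S \<and> S \<subseteq> carrier G \<and> generate G S = carrier G)"

definition torsion_free_group :: "('a, 'm) monoid_scheme \<Rightarrow> bool" where
  "torsion_free_group G \<longleftrightarrow>
     group G \<and> (\<forall>x \<in> carrier G. \<forall>n::nat. 0 < n \<longrightarrow> x [^]\<^bsub>G\<^esub> n = \<one>\<^bsub>G\<^esub> \<longrightarrow> x = \<one>\<^bsub>G\<^esub>)"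

definition commutator_subgroup :: "('a, 'm) monoid_scheme \<Rightarrow> 'a set \<Rightarrow> 'a set \<Rightarrow> 'a set" where
  "commutator_subgroup G H K =
     generate G {h \<otimes>\<^bsub>G\<^esub> k \<otimes>\<^bsub>G\<^esub> inv\<^bsub>G\<^esub> h \<otimes>\<^bsub>G\<^esub> inv\<^bsub>G\<^esub> k | h k. h \<in> H \<and> k \<in> K}"

primrec lower_central_series :: "('a, 'm) monoid_scheme \<Rightarrow> nat \<Rightarrow> 'a set" where
  "lower_central_series G 0 = carrier G"
| "lower_central_series G (Suc n) =
     commutator_subgroup G (lower_central_series G n) (carrier G)"

definition nilpotent_group :: "('a, 'm) monoid_scheme \<Rightarrow> bool" where
  "nilpotent_group G \<longleftrightarrow> group G \<and> (\<exists>n. lower_central_series G n = {\<one>\<^bsub>G\<^esub>})"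

text \<open>The arguments of \<^const>\<open>short_exact_sequence\<close> run from right to left:
  \<open>1 \<rightarrow> N \<rightarrow> G \<rightarrow> Q \<rightarrow> 1\<close> with maps \<open>i : N \<rightarrow> G\<close> and \<open>p : G \<rightarrow> Q\<close>. That constant forces the three
  groups to share one element type. For fixed \<open>G\<close> this loses no extension up to isomorphism, since
  \<open>N\<close> embeds in \<open>G\<close> and \<open>Q\<close> can be realised on a set of coset representatives.\<close>

definition is_extension :: "'a monoid \<Rightarrow> 'a monoid \<Rightarrow> 'a monoid \<Rightarrow> bool" where
  "is_extension G N Q \<longleftrightarrow> (\<exists>p i. short_exact_sequence Q G N p i)"

text \<open>Every homomorphic image of \<open>G\<close> is isomorphic to a quotient \<open>G Mod N\<close>, so the type chosen
  for \<open>H\<close> loses nothing.\<close>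

definition residually_solvable :: "('a, 'm) monoid_scheme \<Rightarrow> bool" where
  "residually_solvable G \<longleftrightarrow>
     group G \<and>
     (\<forall>g \<in> carrier G. g \<noteq> \<one>\<^bsub>G\<^esub> \<longrightarrow>
        (\<exists>(H :: 'a set monoid) f. group H \<and> solvable H \<and> f \<in> epi G H \<and> f g \<noteq> \<one>\<^bsub>H\<^esub>))"

end

(* Say that C_A has finite index in A. The finitely generated torsion-free nilpotent group B embeds in a
   divisible torsion-free nilpotent group U, namely a group of unipotent operators on real polynomial
   functions on B. The map C_A -> B -> U extends to A, because in the nilpotent group A x U the elements
   with a positive power in the graph of C_A -> U form a subgroup, which is the graph of the extension.
   The resulting homomorphism from the amalgam G to U is injective on both factors. Its image is
   torsion-free nilpotent. Its kernel K meets every conjugate of a factor trivially, so K is the fundamental group of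
   the graph whose vertices are the cosets of A and B in the image and whose edges are the cosets of
   C_A; a spanning tree yields a free basis and a cocycle on G yields the inverse map.
   Free groups are residually nilpotent (a reduced word is detected by products of transvections), hence
   the derived series of G, which eventually lies in that of K, has trivial intersection. *)

theory Submission
  imports Defs Complex_Main "HOL-Algebra.Bij" "HOL-Library.Function_Algebras"
begin

section \<open>Presented monoids and groups\<close>

text \<open>The argument runs on powers. A subgroup of finite index contains a positive power of
  every element, so extending a map from \<open>C\<close> to \<open>A\<close> means extracting roots
  in \<open>U\<close>: divisibility makes them exist, torsion-freeness of \<open>U\<close> makes
  them unique, and torsion-freeness of \<open>A\<close> keeps the extension injective. Embedding
  \<open>B\<close> reduces to separating its elements from the identity by polynomials, found by
  induction along a series with cyclic factors. For an infinite factor the obstacle is that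
  conjugation by the new generator need not lower the degree of a polynomial; weighting differences
  by depth in the lower central series cures this. For a finite factor the embedding of the smaller
  group is extended by the same extraction of roots, and its coefficients are the polynomials. The
  amalgam enters only through an induction principle and its universal property. Normal forms never
  occur: the universal property, applied to a permutation group, yields a cocycle that inverts the
  map from the free group to the kernel.\<close>

lemma word_cong_lists: "(u, v) \<in> word_cong S R \<Longrightarrow> u \<in> lists S \<and> v \<in> lists S"
  by (induction rule: word_cong.induct) auto

declare in_listsI [rule del] in_listsD [rule del]

definition word_class :: "'s set \<Rightarrow> ('s list \<times> 's list) set \<Rightarrow> 's list \<Rightarrow> 's list set" where
  "word_class S R w = word_cong S R `` {w}"

lemma equiv_word_cong: "equiv (lists S) (word_cong S R)"
  by (intro equivI refl_onI symI transI)
     (auto dest: word_cong_lists intro: word_cong.refl word_cong.sym word_cong.trans)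

lemma word_class_eq_iff:
  "u \<in> lists S \<Longrightarrow> v \<in> lists S \<Longrightarrow>
    word_class S R u = word_class S R v \<longleftrightarrow> (u, v) \<in> word_cong S R"
  unfolding word_class_def using eq_equiv_class_iff[OF equiv_word_cong] .

lemma presented_carrier: "carrier (presented_monoid S R) = (\<lambda>w. word_class S R w) ` lists S"
  by (auto simp: presented_monoid_def quotient_def word_class_def)

lemma presented_one: "\<one>\<^bsub>presented_monoid S R\<^esub> = word_class S R []"
  by (simp add: presented_monoid_def word_class_def)

lemma presented_mult:
  assumes "u \<in> lists S" "v \<in> lists S"
  shows "word_class S R u \<otimes>\<^bsub>presented_monoid S R\<^esub> word_class S R v = word_class S R (u @ v)"
proof -
  have "word_class S R u \<otimes>\<^bsub>presented_monoid S R\<^esub> word_class S R v =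
    (\<Union>u'\<in>word_class S R u. \<Union>v'\<in>word_class S R v. word_class S R (u' @ v'))"
    by (simp add: presented_monoid_def word_class_def)
  also have "\<dots> = (\<Union>u'\<in>word_class S R u. \<Union>v'\<in>word_class S R v. word_class S R (u @ v))"
  proof (rule SUP_cong[OF HOL.refl], rule SUP_cong[OF HOL.refl])
    fix u' v' assume "u' \<in> word_class S R u" "v' \<in> word_class S R v"
    then have "(u @ v, u' @ v') \<in> word_cong S R"
      by (auto simp: word_class_def intro: word_cong.append)
    then show "word_class S R (u' @ v') = word_class S R (u @ v)"
      by (metis word_class_eq_iff word_cong_lists)
  qed
  also have "u \<in> word_class S R u" "v \<in> word_class S R v"
    using assms by (auto simp: word_class_def intro: word_cong.refl)
  then have "(\<Union>u'\<in>word_class S R u. \<Union>v'\<in>word_class S R v. word_class S R (u @ v)) = word_class S R (u @ v)"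
    by blast
  finally show ?thesis .
qed

lemma presented_is_monoid: "monoid (presented_monoid S R)"
  by (rule monoidI)
     (auto simp: presented_carrier presented_one presented_mult)

text \<open>Left inverses of letters, concatenated in reverse order, are left inverses of words, and
  a monoid with left inverses is a group.\<close>

lemma presented_groupI:
  assumes "\<And>s. s \<in> S \<Longrightarrow> \<exists>u \<in> lists S. (u @ [s], []) \<in> word_cong S R"
  shows "group (presented_monoid S R)"
proof (rule monoid.group_l_invI[OF presented_is_monoid])
  have "\<exists>u \<in> lists S. (u @ w, []) \<in> word_cong S R" if "w \<in> lists S" for w
    using that
  proof induction
    case Nil
    then show ?case by (auto intro: word_cong.refl)
  next
    case (Cons s w)
    obtain u v where u: "u \<in> lists S" "(u @ w, []) \<in> word_cong S R"
      and v: "v \<in> lists S" "(v @ [s], []) \<in> word_cong S R"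
      using Cons assms by blast
    have "((u @ (v @ [s])) @ w, (u @ []) @ w) \<in> word_cong S R"
      using u v Cons by (intro word_cong.append) (auto intro: word_cong.refl)
    then show ?case
      using u v by (intro bexI[of _ "u @ v"]) (auto intro: word_cong.trans)
  qed
  then show "\<exists>y\<in>carrier (presented_monoid S R). y \<otimes>\<^bsub>presented_monoid S R\<^esub> x = \<one>\<^bsub>presented_monoid S R\<^esub>"
    if "x \<in> carrier (presented_monoid S R)" for x
    using that by (fastforce simp: presented_carrier presented_one presented_mult word_class_eq_iff)
qed

primrec word_eval :: "('h, 'k) monoid_scheme \<Rightarrow> ('s \<Rightarrow> 'h) \<Rightarrow> 's list \<Rightarrow> 'h" where
  "word_eval H f [] = \<one>\<^bsub>H\<^esub>"
| "word_eval H f (s # w) = f s \<otimes>\<^bsub>H\<^esub> word_eval H f w"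

lemma (in monoid) word_eval_closed:
  "f \<in> S \<rightarrow> carrier G \<Longrightarrow> w \<in> lists S \<Longrightarrow> word_eval G f w \<in> carrier G"
  by (induction w) auto

lemma (in monoid) word_eval_append:
  "f \<in> S \<rightarrow> carrier G \<Longrightarrow> u \<in> lists S \<Longrightarrow> v \<in> lists S \<Longrightarrow>
    word_eval G f (u @ v) = word_eval G f u \<otimes> word_eval G f v"
  by (induction u) (auto simp: word_eval_closed m_assoc Pi_iff)

lemma (in monoid) presented_universal:
  assumes f: "f \<in> S \<rightarrow> carrier G"
    and R: "\<And>u v. (u, v) \<in> R \<Longrightarrow> u \<in> lists S \<Longrightarrow> v \<in> lists S \<Longrightarrow> word_eval G f u = word_eval G f v"
  obtains h where "h \<in> hom (presented_monoid S R) G"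
    "\<And>w. w \<in> lists S \<Longrightarrow> h (word_class S R w) = word_eval G f w"
proof -
  have cong: "word_eval G f u = word_eval G f v" if "(u, v) \<in> word_cong S R" for u v
    using that
  proof induction
    case (append u u' v v')
    then show ?case using word_eval_append[OF f] by (metis word_cong_lists)
  qed (auto intro: R)
  \<comment> \<open>A class is evaluated at an arbitrary representative; \<open>cong\<close> makes
    the choice harmless.\<close>
  define h where "h P = word_eval G f (SOME w. w \<in> P)" for P
  have h: "h (word_class S R w) = word_eval G f w" if "w \<in> lists S" for w
  proof -
    have "w \<in> word_class S R w" using that by (simp add: word_class_def word_cong.refl)
    then have "(SOME v. v \<in> word_class S R w) \<in> word_class S R w"
      by (rule someI)
    then show ?thesis unfolding h_def using cong by (metis Image_singleton_iff word_class_def)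
  qed
  have "h \<in> hom (presented_monoid S R) G"
    by (rule homI) (auto simp: presented_carrier presented_mult h word_eval_closed[OF f] word_eval_append[OF f])
  with h show thesis using that by blast
qed

lemma presented_induct:
  assumes "g \<in> carrier (presented_monoid S R)" and "P \<one>\<^bsub>presented_monoid S R\<^esub>"
    and "\<And>s g. s \<in> S \<Longrightarrow> g \<in> carrier (presented_monoid S R) \<Longrightarrow> P g \<Longrightarrow>
          P (word_class S R [s] \<otimes>\<^bsub>presented_monoid S R\<^esub> g)"
  shows "P g"
proof -
  obtain w where w: "w \<in> lists S" "g = word_class S R w"
    using assms(1) by (auto simp: presented_carrier)
  have "P (word_class S R w)"
    using w(1)
  proof induction
    case Nil
    then show ?case using assms(2) by (simp add: presented_one)
  next
    case (Cons s w)
    then have "P (word_class S R [s] \<otimes>\<^bsub>presented_monoid S R\<^esub> word_class S R w)"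
      by (intro assms(3)) (auto simp: presented_carrier)
    then show ?case using Cons by (simp add: presented_mult)
  qed
  then show ?thesis using w by simp
qed

subsection \<open>Free groups\<close>

definition free_gen :: "'x set \<Rightarrow> 'x \<Rightarrow> ('x \<times> bool) list set" where
  "free_gen X x = word_class (X \<times> UNIV) (free_group_relations X) [(x, True)]"

lemma free_rel:
  assumes "x \<in> X"
  shows "([(x, b), (x, \<not> b)], []) \<in> word_cong (X \<times> UNIV) (free_group_relations X)"
  using assms by (intro word_cong.base) (auto simp: free_group_relations_def)

lemma group_free_group_on: "group (free_group_on X)"
  unfolding free_group_on_def
proof (rule presented_groupI)
  fix s :: "'a \<times> bool"
  assume "s \<in> X \<times> UNIV"
  then show "\<exists>u\<in>lists (X \<times> UNIV). (u @ [s], []) \<in> word_cong (X \<times> UNIV) (free_group_relations X)"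
    using free_rel[of "fst s" X "\<not> snd s"] by (intro bexI[of _ "[(fst s, \<not> snd s)]"]) auto
qed

lemma free_gen_closed: "x \<in> X \<Longrightarrow> free_gen X x \<in> carrier (free_group_on X)"
  by (auto simp: free_gen_def free_group_on_def presented_carrier)

lemma inv_free_gen:
  assumes "x \<in> X"
  shows "inv\<^bsub>free_group_on X\<^esub> free_gen X x =
    word_class (X \<times> UNIV) (free_group_relations X) [(x, False)]"
  using free_rel[OF assms, of False] assms
  by (intro group.inv_equality[OF group_free_group_on])
     (auto simp: free_gen_def free_group_on_def presented_carrier presented_mult presented_one word_class_eq_iff)

lemma free_group_induct:
  assumes "g \<in> carrier (free_group_on X)" and "P \<one>\<^bsub>free_group_on X\<^esub>"
    and "\<And>x g. x \<in> X \<Longrightarrow> g \<in> carrier (free_group_on X) \<Longrightarrow> P g \<Longrightarrow> P (free_gen X x \<otimes>\<^bsub>free_group_on X\<^esub> g)"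
    and "\<And>x g. x \<in> X \<Longrightarrow> g \<in> carrier (free_group_on X) \<Longrightarrow> P g \<Longrightarrow>
      P (inv\<^bsub>free_group_on X\<^esub> free_gen X x \<otimes>\<^bsub>free_group_on X\<^esub> g)"
  shows "P g"
proof (rule presented_induct[of g "X \<times> UNIV" "free_group_relations X"])
  fix s g
  assume *: "s \<in> X \<times> (UNIV :: bool set)" "g \<in> carrier (presented_monoid (X \<times> UNIV) (free_group_relations X))" "P g"
  then show "P (word_class (X \<times> UNIV) (free_group_relations X) [s]
      \<otimes>\<^bsub>presented_monoid (X \<times> UNIV) (free_group_relations X)\<^esub> g)"
    using assms(3,4)[of "fst s" g] inv_free_gen[of "fst s" X]
    by (cases s; cases "snd s") (auto simp: free_gen_def free_group_on_def)
qed (use assms in \<open>auto simp: free_group_on_def\<close>)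

lemma (in group) free_universal:
  assumes f: "f \<in> X \<rightarrow> carrier G"
  obtains h where "h \<in> hom (free_group_on X) G" "\<And>x. x \<in> X \<Longrightarrow> h (free_gen X x) = f x"
proof -
  define F where "F s = (if snd s then f (fst s) else inv (f (fst s)))" for s
  have F: "F \<in> X \<times> UNIV \<rightarrow> carrier G" using f by (force simp: F_def Pi_iff)
  obtain h where h: "h \<in> hom (presented_monoid (X \<times> UNIV) (free_group_relations X)) G"
    "\<And>w. w \<in> lists (X \<times> UNIV) \<Longrightarrow> h (word_class (X \<times> UNIV) (free_group_relations X) w) = word_eval G F w"
    using f by (rule_tac presented_universal[OF F, of "free_group_relations X"])
       (auto simp: free_group_relations_def F_def Pi_iff)
  show thesis
  proof
    show "h \<in> hom (free_group_on X) G" using h(1) by (simp add: free_group_on_def)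
    show "h (free_gen X x) = f x" if "x \<in> X" for x
      using that h(2)[of "[(x, True)]"] f by (auto simp: free_gen_def F_def Pi_iff)
  qed
qed

lemma group_hom_iff: "group_hom G H h \<longleftrightarrow> group G \<and> group H \<and> h \<in> hom G H"
  by (simp add: group_hom_def group_hom_axioms_def)

lemma free_hom_eq:
  assumes "group H" "h \<in> hom (free_group_on X) H" "k \<in> hom (free_group_on X) H"
    and "\<And>x. x \<in> X \<Longrightarrow> h (free_gen X x) = k (free_gen X x)"
    and "g \<in> carrier (free_group_on X)"
  shows "h g = k g"
proof -
  interpret h: group_hom "free_group_on X" H h
    using assms group_free_group_on by (auto simp: group_hom_iff)
  interpret k: group_hom "free_group_on X" H k
    using assms group_free_group_on by (auto simp: group_hom_iff)
  show ?thesis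
    using assms(5) by (rule free_group_induct) (auto simp: free_gen_closed assms(4))
qed

subsection \<open>Amalgamated products\<close>

abbreviation "fp_class A B \<equiv> word_class (carrier A <+> carrier B) (free_product_relations A B)"
abbreviation "fp_cong A B \<equiv> word_cong (carrier A <+> carrier B) (free_product_relations A B)"

lemma free_product_inl_class:
  "free_product_inl A B a = fp_class A B [Inl a]"
  by (simp add: free_product_inl_def word_class_def)

lemma free_product_inr_class:
  "free_product_inr A B b = fp_class A B [Inr b]"
  by (simp add: free_product_inr_def word_class_def)

lemma free_product_rel:
  assumes "group A" "group B"
  shows "x \<in> carrier A \<Longrightarrow> y \<in> carrier A \<Longrightarrow>
      ([Inl x, Inl y], [Inl (x \<otimes>\<^bsub>A\<^esub> y)]) \<in> fp_cong A B"
    and "([Inl \<one>\<^bsub>A\<^esub>], []) \<in> fp_cong A B"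
    and "z \<in> carrier B \<Longrightarrow> w \<in> carrier B \<Longrightarrow>
      ([Inr z, Inr w], [Inr (z \<otimes>\<^bsub>B\<^esub> w)]) \<in> fp_cong A B"
    and "([Inr \<one>\<^bsub>B\<^esub>], []) \<in> fp_cong A B"
  by (rule word_cong.base;
      force simp: free_product_relations_def assms group.is_monoid monoid.m_closed)+

lemma free_product_inl_hom:
  assumes "group A" "group B"
  shows "free_product_inl A B \<in> hom A (free_product A B)"
proof (rule homI)
  interpret A: group A by fact
  show "free_product_inl A B x \<in> carrier (free_product A B)" if "x \<in> carrier A" for x
    using that by (auto simp: free_product_inl_class free_product_def presented_carrier)
  show "free_product_inl A B (x \<otimes>\<^bsub>A\<^esub> y) = free_product_inl A B x \<otimes>\<^bsub>free_product A B\<^esub> free_product_inl A B y"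
    if "x \<in> carrier A" "y \<in> carrier A" for x y
    using that word_cong.sym[OF free_product_rel(1)[OF assms that]]
    by (simp add: free_product_inl_class free_product_def presented_mult word_class_eq_iff InlI InrI)
qed

lemma free_product_inr_hom:
  assumes "group A" "group B"
  shows "free_product_inr A B \<in> hom B (free_product A B)"
proof (rule homI)
  interpret B: group B by fact
  show "free_product_inr A B x \<in> carrier (free_product A B)" if "x \<in> carrier B" for x
    using that by (auto simp: free_product_inr_class free_product_def presented_carrier)
  show "free_product_inr A B (x \<otimes>\<^bsub>B\<^esub> y) = free_product_inr A B x \<otimes>\<^bsub>free_product A B\<^esub> free_product_inr A B y"
    if "x \<in> carrier B" "y \<in> carrier B" for x y
    using that word_cong.sym[OF free_product_rel(3)[OF assms that]]
    by (simp add: free_product_inr_class free_product_def presented_mult word_class_eq_iff InlI InrI)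
qed

lemma group_free_product:
  assumes "group A" "group B"
  shows "group (free_product A B)"
  unfolding free_product_def
proof (rule presented_groupI)
  interpret A: group A by fact
  interpret B: group B by fact
  let ?R = "fp_cong A B"
  fix s assume s: "s \<in> carrier A <+> carrier B"
  then show "\<exists>u\<in>lists (carrier A <+> carrier B). (u @ [s], []) \<in> ?R"
  proof
    fix a assume a: "a \<in> carrier A" "s = Inl a"
    have "([Inl (inv\<^bsub>A\<^esub> a), Inl a], []) \<in> ?R"
      using word_cong.trans[OF free_product_rel(1)[OF assms A.inv_closed[OF a(1)] a(1), unfolded A.l_inv[OF a(1)]]
          free_product_rel(2)[OF assms]] .
    then show ?thesis
      using a by (intro bexI[of _ "[Inl (inv\<^bsub>A\<^esub> a)]"]) auto
  next
    fix a assume a: "a \<in> carrier B" "s = Inr a"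
    have "([Inr (inv\<^bsub>B\<^esub> a), Inr a], []) \<in> ?R"
      using word_cong.trans[OF free_product_rel(3)[OF assms B.inv_closed[OF a(1)] a(1), unfolded B.l_inv[OF a(1)]]
          free_product_rel(4)[OF assms]] .
    then show ?thesis
      using a by (intro bexI[of _ "[Inr (inv\<^bsub>B\<^esub> a)]"]) auto
  qed
qed

lemma (in group) free_product_universal:
  assumes "group A" "group B" and f: "f \<in> hom A G" and k: "k \<in> hom B G"
  obtains h where "h \<in> hom (free_product A B) G"
    "\<And>a. a \<in> carrier A \<Longrightarrow> h (free_product_inl A B a) = f a"
    "\<And>b. b \<in> carrier B \<Longrightarrow> h (free_product_inr A B b) = k b"
proof -
  interpret f: group_hom A G f using assms by (auto simp: group_hom_iff)
  interpret k: group_hom B G k using assms by (auto simp: group_hom_iff)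
  have F: "case_sum f k \<in> carrier A <+> carrier B \<rightarrow> carrier G" by auto
  obtain h where "h \<in> hom (presented_monoid (carrier A <+> carrier B) (free_product_relations A B)) G"
    "\<And>w. w \<in> lists (carrier A <+> carrier B) \<Longrightarrow>
      h (fp_class A B w) = word_eval G (case_sum f k) w"
    by (rule presented_universal[OF F, of "free_product_relations A B"])
       (auto simp: free_product_relations_def)
  then show thesis
    by (intro that[of h])
       (simp_all add: free_product_def free_product_inl_class free_product_inr_class InlI InrI)
qed

lemma free_product_induct:
  assumes "g \<in> carrier (free_product A B)" and "P \<one>\<^bsub>free_product A B\<^esub>"
    and "\<And>a g. a \<in> carrier A \<Longrightarrow> g \<in> carrier (free_product A B) \<Longrightarrow> P g \<Longrightarrow>
      P (free_product_inl A B a \<otimes>\<^bsub>free_product A B\<^esub> g)"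
    and "\<And>b g. b \<in> carrier B \<Longrightarrow> g \<in> carrier (free_product A B) \<Longrightarrow> P g \<Longrightarrow>
      P (free_product_inr A B b \<otimes>\<^bsub>free_product A B\<^esub> g)"
  shows "P g"
  by (rule presented_induct[of g "carrier A <+> carrier B" "free_product_relations A B"])
     (use assms in \<open>auto simp: free_product_def free_product_inl_class free_product_inr_class\<close>)

lemma (in group) normal_normal_closure: "S \<subseteq> carrier G \<Longrightarrow> normal_closure G S \<lhd> G"
proof -
  assume S: "S \<subseteq> carrier G"
  have N: "subgroup N G" if "N \<in> {N. N \<lhd> G \<and> S \<subseteq> N}" for N
    using that by (auto intro: normal_imp_subgroup)
  have "carrier G \<in> {N. N \<lhd> G \<and> S \<subseteq> N}" using S normal_self by simp
  then have "subgroup (normal_closure G S) G"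
    unfolding normal_closure_def using N by (intro subgroups_Inter) auto
  then show ?thesis
    by (rule normal_invI) (auto simp: normal_closure_def intro: normal_invE(2))
qed

lemma (in group_hom) normal_closure_kernel: "S \<subseteq> kernel G H h \<Longrightarrow> normal_closure G S \<subseteq> kernel G H h"
  using normal_kernel by (auto simp: normal_closure_def)

definition amalgam_relators ::
    "('a, 'm) monoid_scheme \<Rightarrow> ('b, 'n) monoid_scheme \<Rightarrow> 'a set \<Rightarrow> ('a \<Rightarrow> 'b) \<Rightarrow> ('a + 'b) list set set" where
  "amalgam_relators A B C \<phi> = normal_closure (free_product A B)
         {free_product_inl A B c \<otimes>\<^bsub>free_product A B\<^esub>
            inv\<^bsub>free_product A B\<^esub> (free_product_inr A B (\<phi> c)) | c. c \<in> C}"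

definition amalgam_inl where
  "amalgam_inl A B C \<phi> a = amalgam_relators A B C \<phi> #>\<^bsub>free_product A B\<^esub> free_product_inl A B a"

definition amalgam_inr where
  "amalgam_inr A B C \<phi> b = amalgam_relators A B C \<phi> #>\<^bsub>free_product A B\<^esub> free_product_inr A B b"

lemma amalgamated_product_eq:
  "amalgamated_product A B C \<phi> = free_product A B Mod amalgam_relators A B C \<phi>"
  by (simp add: amalgamated_product_def amalgam_relators_def)

locale amalgam_data =
  fixes A :: "('a, 'm) monoid_scheme" and B :: "('b, 'n) monoid_scheme"
    and C :: "'a set" and \<phi> :: "'a \<Rightarrow> 'b"
  assumes A: "group A" and B: "group B" and C: "C \<subseteq> carrier A" and \<phi>: "\<phi> \<in> C \<rightarrow> carrier B"
begin

abbreviation "FP \<equiv> free_product A B"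
abbreviation "N \<equiv> amalgam_relators A B C \<phi>"
abbreviation "AP \<equiv> amalgamated_product A B C \<phi>"
abbreviation "iA \<equiv> amalgam_inl A B C \<phi>"
abbreviation "iB \<equiv> amalgam_inr A B C \<phi>"

sublocale FP: group FP by (rule group_free_product[OF A B])

lemma inl_closed: "a \<in> carrier A \<Longrightarrow> free_product_inl A B a \<in> carrier FP"
  using free_product_inl_hom[OF A B] by (rule hom_in_carrier)

lemma inr_closed: "b \<in> carrier B \<Longrightarrow> free_product_inr A B b \<in> carrier FP"
  using free_product_inr_hom[OF A B] by (rule hom_in_carrier)

sublocale N: normal N FP
  unfolding amalgam_relators_def
  by (rule FP.normal_normal_closure) (use C \<phi> in \<open>auto simp: inl_closed inr_closed subset_iff Pi_iff\<close>)

sublocale AP: group AP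
  unfolding amalgamated_product_eq by (rule N.factorgroup_is_group)

lemma iA_hom: "iA \<in> hom A AP"
  using hom_compose[OF free_product_inl_hom[OF A B] N.r_coset_hom_Mod]
  by (simp add: amalgam_inl_def[abs_def] amalgamated_product_eq o_def)

lemma iB_hom: "iB \<in> hom B AP"
  using hom_compose[OF free_product_inr_hom[OF A B] N.r_coset_hom_Mod]
  by (simp add: amalgam_inr_def[abs_def] amalgamated_product_eq o_def)

lemma iA_iB_agree:
  assumes "c \<in> C"
  shows "iA c = iB (\<phi> c)"
proof -
  have "free_product_inl A B c \<otimes>\<^bsub>FP\<^esub> inv\<^bsub>FP\<^esub> (free_product_inr A B (\<phi> c)) \<in> N"
    using assms by (auto simp: amalgam_relators_def normal_closure_def)
  moreover have "free_product_inl A B c \<in> carrier FP" "free_product_inr A B (\<phi> c) \<in> carrier FP"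
    using assms C \<phi> inl_closed inr_closed by auto
  ultimately show ?thesis
    unfolding amalgam_inl_def amalgam_inr_def
    by (metis FP.is_group FP.repr_independence N.is_subgroup N.rcos_module_rev)
qed

text \<open>Together with \<open>iA_iB_agree\<close> and \<open>amalgam_universal\<close> this is
  the interface of the amalgam: elements are products of factor elements, and no uniqueness of such
  products is claimed.\<close>

lemma amalgam_induct:
  assumes "g \<in> carrier AP" and "P \<one>\<^bsub>AP\<^esub>"
    and iA: "\<And>a g. a \<in> carrier A \<Longrightarrow> g \<in> carrier AP \<Longrightarrow> P g \<Longrightarrow> P (iA a \<otimes>\<^bsub>AP\<^esub> g)"
    and iB: "\<And>b g. b \<in> carrier B \<Longrightarrow> g \<in> carrier AP \<Longrightarrow> P g \<Longrightarrow> P (iB b \<otimes>\<^bsub>AP\<^esub> g)"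
  shows "P g"
proof -
  obtain x where x: "x \<in> carrier FP" "g = N #>\<^bsub>FP\<^esub> x"
    using assms(1) by (auto simp: amalgamated_product_eq carrier_FactGroup)
  have "P (N #>\<^bsub>FP\<^esub> x)"
    using x(1)
  proof (rule free_product_induct)
    show "P (N #>\<^bsub>FP\<^esub> \<one>\<^bsub>FP\<^esub>)"
      using assms(2) by (simp add: amalgamated_product_eq N.subset)
  next
    fix a y assume "a \<in> carrier A" "y \<in> carrier FP" "P (N #>\<^bsub>FP\<^esub> y)"
    then show "P (N #>\<^bsub>FP\<^esub> (free_product_inl A B a \<otimes>\<^bsub>FP\<^esub> y))"
      using iA[of a "N #>\<^bsub>FP\<^esub> y"]
      by (auto simp: amalgamated_product_eq amalgam_inl_def N.rcos_sum inl_closed carrier_FactGroup)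
  next
    fix a y assume "a \<in> carrier B" "y \<in> carrier FP" "P (N #>\<^bsub>FP\<^esub> y)"
    then show "P (N #>\<^bsub>FP\<^esub> (free_product_inr A B a \<otimes>\<^bsub>FP\<^esub> y))"
      using iB[of a "N #>\<^bsub>FP\<^esub> y"]
      by (auto simp: amalgamated_product_eq amalgam_inr_def N.rcos_sum inr_closed carrier_FactGroup)
  qed
  then show ?thesis using x by simp
qed

lemma amalgam_universal:
  assumes "group H" and f: "f \<in> hom A H" and k: "k \<in> hom B H"
    and agree: "\<And>c. c \<in> C \<Longrightarrow> f c = k (\<phi> c)"
  obtains h where "h \<in> hom AP H"
    "\<And>a. a \<in> carrier A \<Longrightarrow> h (iA a) = f a" "\<And>b. b \<in> carrier B \<Longrightarrow> h (iB b) = k b"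
proof -
  interpret H: group H by fact
  obtain h where h: "h \<in> hom FP H"
    "\<And>a. a \<in> carrier A \<Longrightarrow> h (free_product_inl A B a) = f a"
    "\<And>b. b \<in> carrier B \<Longrightarrow> h (free_product_inr A B b) = k b"
    using H.free_product_universal[OF A B f k] by blast
  interpret h: group_hom FP H h by unfold_locales (rule h)
  have "N \<subseteq> kernel FP H h"
    unfolding amalgam_relators_def
  proof (rule h.normal_closure_kernel, safe)
    fix c assume c: "c \<in> C"
    then have "c \<in> carrier A" "\<phi> c \<in> carrier B" using C \<phi> by auto
    then show "free_product_inl A B c \<otimes>\<^bsub>FP\<^esub> inv\<^bsub>FP\<^esub> (free_product_inr A B (\<phi> c)) \<in> kernel FP H h"
      using hom_in_carrier[OF k] by (auto simp: kernel_def inl_closed inr_closed h agree[OF c])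
  qed
  then obtain h' where h': "h' \<in> hom (FP Mod N) H" "\<And>x. x \<in> carrier FP \<Longrightarrow> h' (N #>\<^bsub>FP\<^esub> x) = h x"
    using h.FactGroup_universal_kernel[OF N.normal_axioms] by blast
  show thesis
    by (rule that[of h'])
       (auto simp: h' h inl_closed inr_closed amalgamated_product_eq amalgam_inl_def amalgam_inr_def)
qed

end

section \<open>Nilpotent groups\<close>

abbreviation "lcs \<equiv> lower_central_series"

declare lower_central_series.simps(2) [simp del]

abbreviation gcomm (\<open>gcomm\<index>\<close>) where
  "gcomm\<^bsub>G\<^esub> x y \<equiv> x \<otimes>\<^bsub>G\<^esub> y \<otimes>\<^bsub>G\<^esub> inv\<^bsub>G\<^esub> x \<otimes>\<^bsub>G\<^esub> inv\<^bsub>G\<^esub> y"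

context group
begin

lemma cancel_left [simp]:
  "x \<in> carrier G \<Longrightarrow> y \<in> carrier G \<Longrightarrow> inv x \<otimes> (x \<otimes> y) = y"
  "x \<in> carrier G \<Longrightarrow> y \<in> carrier G \<Longrightarrow> x \<otimes> (inv x \<otimes> y) = y"
  by (simp_all flip: m_assoc)

lemmas word_simps = m_assoc inv_mult_group

lemma inv_gcomm: "x \<in> carrier G \<Longrightarrow> y \<in> carrier G \<Longrightarrow> inv (gcomm x y) = gcomm y x"
  by (simp add: word_simps)

lemma (in normal) rcos_eq_iff:
  assumes "x \<in> carrier G" "y \<in> carrier G"
  shows "H #> x = H #> y \<longleftrightarrow> x \<otimes> inv y \<in> H"
  using assms by (metis is_group is_subgroup rcos_module_rev rcos_self repr_independence rcos_module_imp)

lemma (in normal) group_hom_Mod: "group_hom G (G Mod H) (\<lambda>x. H #> x)"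
  using r_coset_hom_Mod factorgroup_is_group by (simp add: group_hom_iff is_group)

text \<open>The preimage of the centralizer of the coset of \<open>g\<close> in
  \<open>G Mod H\<close>. Closure rests on \<open>[x^-1, g] = x^-1 [x, g]^-1 x\<close> and
  \<open>[x y, g] = x [y, g] x^-1 [x, g]\<close>.\<close>

lemma (in normal) subgroup_centralizer_mod:
  assumes g: "g \<in> carrier G"
  shows "subgroup {x \<in> carrier G. gcomm x g \<in> H} G"
proof (rule subgroupI)
  show "{x \<in> carrier G. gcomm x g \<in> H} \<noteq> {}" using g by (auto intro!: exI[of _ \<one>])
next
  fix x assume x: "x \<in> {x \<in> carrier G. gcomm x g \<in> H}"
  then have "inv x \<otimes> inv (gcomm x g) \<otimes> x \<in> H" by (intro inv_op_closed1) auto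
  then show "inv x \<in> {x \<in> carrier G. gcomm x g \<in> H}" using x g by (simp add: word_simps)
next
  fix x y assume xy: "x \<in> {x \<in> carrier G. gcomm x g \<in> H}" "y \<in> {x \<in> carrier G. gcomm x g \<in> H}"
  then have "x \<otimes> gcomm y g \<otimes> inv x \<otimes> gcomm x g \<in> H"
    using inv_op_closed2[of x "gcomm y g"] by (auto intro: subgroup.m_closed[OF is_subgroup])
  then show "x \<otimes> y \<in> {x \<in> carrier G. gcomm x g \<in> H}" using xy g by (simp add: word_simps)
qed auto

text \<open>Centralizers modulo \<open>H\<close> are subgroups: apply this in the first argument,
  then in the second, the arguments being exchanged by inverting the commutator.\<close>

lemma (in normal) gcomm_generate:
  assumes S: "S \<subseteq> carrier G" and T: "T \<subseteq> carrier G"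
    and comm: "\<And>x s. x \<in> T \<Longrightarrow> s \<in> S \<Longrightarrow> gcomm x s \<in> H"
    and x: "x \<in> generate G T" and g: "g \<in> generate G S"
  shows "gcomm x g \<in> H"
proof -
  have carr: "x \<in> carrier G" "g \<in> carrier G" using x g S T generate_in_carrier by auto
  have 1: "gcomm x s \<in> H" if "s \<in> S" for s
    using generate_subgroup_incl[OF _ subgroup_centralizer_mod[of s], of T] that S T comm x by blast
  have swap: "gcomm y x \<in> H \<longleftrightarrow> gcomm x y \<in> H" if "y \<in> carrier G" for y
    using inv_gcomm that carr by (metis m_inv_closed)
  have "S \<subseteq> {y \<in> carrier G. gcomm y x \<in> H}" using S 1 swap by auto
  then show ?thesis
    using generate_subgroup_incl[OF _ subgroup_centralizer_mod[OF carr(1)]] g swap by blast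
qed

lemma lcs_normal: "lcs G n \<lhd> G"
proof (induction n)
  case 0
  then show ?case by (simp add: normal_self)
next
  case (Suc n)
  then interpret L: normal "lcs G n" G .
  have "generate G {gcomm h k | h k. h \<in> lcs G n \<and> k \<in> carrier G} \<lhd> G"
  proof (rule normal_generateI)
    fix x g assume "x \<in> {gcomm h k | h k. h \<in> lcs G n \<and> k \<in> carrier G}"
      and g: "g \<in> carrier G"
    then obtain h k where *: "h \<in> lcs G n" "k \<in> carrier G" "x = gcomm h k" by auto
    then have "g \<otimes> x \<otimes> inv g = gcomm (g \<otimes> h \<otimes> inv g) (g \<otimes> k \<otimes> inv g)"
      using g by (simp add: word_simps)
    then show "g \<otimes> x \<otimes> inv g \<in> {gcomm h k | h k. h \<in> lcs G n \<and> k \<in> carrier G}"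
      using * g L.inv_op_closed2 by blast
  qed auto
  then show ?case by (simp add: commutator_subgroup_def lower_central_series.simps(2))
qed

lemma lcs_subgroup: "subgroup (lcs G n) G"
  using lcs_normal normal_imp_subgroup by blast

lemma lcs_carrier: "lcs G n \<subseteq> carrier G"
  using lcs_subgroup subgroup.subset by blast

lemma gcomm_lcs:
  "x \<in> lcs G n \<Longrightarrow> g \<in> carrier G \<Longrightarrow> gcomm x g \<in> lcs G (Suc n)"
  by (auto simp: commutator_subgroup_def lower_central_series.simps(2) intro!: generate.incl)

lemma lcs_Suc_subset: "lcs G (Suc n) \<subseteq> lcs G n"
proof -
  interpret L: normal "lcs G n" G by (rule lcs_normal)
  have "gcomm h k \<in> lcs G n" if "h \<in> lcs G n" "k \<in> carrier G" for h k
  proof -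
    have "h \<otimes> (k \<otimes> inv h \<otimes> inv k) \<in> lcs G n"
      using that by (intro L.m_closed L.inv_op_closed2) auto
    then show ?thesis using that by (simp add: word_simps)
  qed
  then show ?thesis
    unfolding lower_central_series.simps commutator_subgroup_def
    by (intro generate_subgroup_incl[OF _ lcs_subgroup]) auto
qed

lemma lcs_antimono: "m \<le> n \<Longrightarrow> lcs G n \<subseteq> lcs G m"
  by (rule lift_Suc_antimono_le[of "lcs G"]) (use lcs_Suc_subset in auto)

end

lemma (in group_hom) lcs_image:
  "x \<in> lcs G n \<Longrightarrow> h x \<in> lcs H n"
proof (induction n arbitrary: x)
  case 0
  then show ?case by simp
next
  case (Suc n)
  have "h ` lcs G (Suc n) =
      generate H (h ` {gcomm\<^bsub>G\<^esub> a k | a k. a \<in> lcs G n \<and> k \<in> carrier G})"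
    unfolding lower_central_series.simps commutator_subgroup_def
    using subsetD[OF G.lcs_carrier] by (intro generate_img[symmetric]) auto
  also have "\<dots> \<subseteq> lcs H (Suc n)"
  proof (rule H.generate_subgroup_incl[OF _ H.lcs_subgroup], safe)
    fix a k assume *: "a \<in> lcs G n" "k \<in> carrier G"
    then have "h (gcomm\<^bsub>G\<^esub> a k) = gcomm\<^bsub>H\<^esub> (h a) (h k)"
      using subsetD[OF G.lcs_carrier *(1)] by simp
    then show "h (gcomm\<^bsub>G\<^esub> a k) \<in> lcs H (Suc n)"
      using Suc.IH[OF *(1)] *(2) by (simp only: H.gcomm_lcs hom_closed)
  qed
  finally show ?case using Suc.prems by blast
qed

lemma (in group_hom) nilpotent_group_inj:
  assumes "nilpotent_group H" "inj_on h (carrier G)"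
  shows "nilpotent_group G"
proof -
  obtain n where n: "lcs H n = {\<one>\<^bsub>H\<^esub>}"
    using assms by (auto simp: nilpotent_group_def)
  have "x = \<one>" if "x \<in> lcs G n" for x
    using lcs_image[OF that] n that G.lcs_carrier assms(2) by (auto simp: inj_on_one_iff)
  then have "lcs G n = {\<one>}"
    using subgroup.one_closed[OF G.lcs_subgroup] by blast
  then show ?thesis using nilpotent_group_def by blast
qed

lemma (in group_hom) torsion_free_group_inj:
  assumes "torsion_free_group H" "inj_on h (carrier G)"
  shows "torsion_free_group G"
proof -
  have "x = \<one>" if "x \<in> carrier G" "0 < n" "x [^]\<^bsub>G\<^esub> (n::nat) = \<one>" for x n
  proof -
    have "h x [^]\<^bsub>H\<^esub> n = \<one>\<^bsub>H\<^esub>" using that by (metis hom_nat_pow hom_one)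
    then have "h x = \<one>\<^bsub>H\<^esub>" using assms(1) that by (auto simp: torsion_free_group_def)
    then show ?thesis using assms(2) that by (auto simp: inj_on_one_iff)
  qed
  then show ?thesis by (auto simp: torsion_free_group_def)
qed

lemma (in group) group_hom_subgroup: "subgroup H G \<Longrightarrow> group_hom (G\<lparr>carrier := H\<rparr>) G id"
  using canonical_inj_is_hom by (simp add: group_hom_iff subgroup_imp_group id_def)

lemma (in group) subgroup_nilpotent:
  "nilpotent_group G \<Longrightarrow> subgroup H G \<Longrightarrow> nilpotent_group (G\<lparr>carrier := H\<rparr>)"
  using group_hom.nilpotent_group_inj[OF group_hom_subgroup] by (auto simp: inj_on_def)

lemma (in group) subgroup_torsion_free:
  "torsion_free_group G \<Longrightarrow> subgroup H G \<Longrightarrow> torsion_free_group (G\<lparr>carrier := H\<rparr>)"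
  using group_hom.torsion_free_group_inj[OF group_hom_subgroup] by (auto simp: inj_on_def)

lemma nilpotent_DirProd:
  assumes "nilpotent_group G" "nilpotent_group H"
  shows "nilpotent_group (G \<times>\<times> H)"
proof -
  interpret G: group G using assms by (simp add: nilpotent_group_def)
  interpret H: group H using assms by (simp add: nilpotent_group_def)
  interpret P: group "G \<times>\<times> H" by (rule DirProd_group) auto
  interpret p1: group_hom "G \<times>\<times> H" G fst by unfold_locales (auto simp: hom_def)
  interpret p2: group_hom "G \<times>\<times> H" H snd by unfold_locales (auto simp: hom_def)
  obtain m n where mn: "lcs G m = {\<one>\<^bsub>G\<^esub>}" "lcs H n = {\<one>\<^bsub>H\<^esub>}"
    using assms by (auto simp: nilpotent_group_def)
  have "x = \<one>\<^bsub>G \<times>\<times> H\<^esub>" if "x \<in> lcs (G \<times>\<times> H) (max m n)" for x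
    using p1.lcs_image[OF that] p2.lcs_image[OF that] mn
      G.lcs_antimono[of m "max m n"] H.lcs_antimono[of n "max m n"]
    by (cases x) auto
  then have "lcs (G \<times>\<times> H) (max m n) = {\<one>\<^bsub>G \<times>\<times> H\<^esub>}"
    using subgroup.one_closed[OF P.lcs_subgroup] by blast
  then show ?thesis using P.is_group nilpotent_group_def by blast
qed

lemma (in group) nilpotent_imp_solvable:
  assumes "nilpotent_group G"
  shows "solvable G"
proof -
  obtain n where n: "lcs G n = {\<one>}"
    using assms by (auto simp: nilpotent_group_def)
  have "(derived G ^^ k) (carrier G) \<subseteq> lcs G k" for k
  proof (induction k)
    case (Suc k)
    have "derived_set G ((derived G ^^ k) (carrier G)) \<subseteq> lcs G (Suc k)"
      using Suc gcomm_lcs exp_of_derived_in_carrier[of "carrier G" k] by blast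
    then have "derived G ((derived G ^^ k) (carrier G)) \<subseteq> lcs G (Suc k)"
      unfolding derived_def by (rule generate_subgroup_incl[OF _ lcs_subgroup])
    then show ?case by simp
  qed simp
  then have "(derived G ^^ n) (carrier G) \<subseteq> {\<one>}" using n by metis
  moreover have "\<one> \<in> (derived G ^^ n) (carrier G)"
    using subgroup.one_closed[OF exp_of_derived_is_subgroup[OF subgroup_self]] .
  ultimately show ?thesis using solvable_iff_trivial_derived_seq by blast
qed

subsection \<open>Central filtrations\<close>

text \<open>Covers two series: the lower central series, and unipotent operators filtered by how far
  they lower degree. Questions about powers and roots are then settled one central factor at a
  time.\<close>

locale central_filtration = group +
  fixes F :: "nat \<Rightarrow> 'a set" and c :: nat
  assumes F_subgroup: "subgroup (F i) G"
    and F_0: "F 0 = carrier G"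
    and F_Suc: "F (Suc i) \<subseteq> F i"
    and F_gcomm: "x \<in> F i \<Longrightarrow> g \<in> carrier G \<Longrightarrow> gcomm x g \<in> F (Suc i)"
    and F_c: "F c = {\<one>}"
begin

lemma F_carrier: "x \<in> F i \<Longrightarrow> x \<in> carrier G"
  using F_subgroup subgroup.mem_carrier by metis

text \<open>Conjugating \<open>x\<close> by \<open>g\<close> multiplies it by the inverse of
  \<open>[x, g]\<close>, which lies in \<open>F (Suc i)\<close> and hence in
  \<open>M\<close>.\<close>

lemma between_normal:
  assumes "subgroup M G" "F (Suc i) \<subseteq> M" "M \<subseteq> F i"
  shows "M \<lhd> G"
proof (rule normal_invI[OF assms(1)])
  fix g x assume gx: "g \<in> carrier G" "x \<in> M"
  then have x: "x \<in> carrier G" using assms F_carrier by blast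
  have "inv (gcomm x g) \<in> M"
    using gx assms F_gcomm by (intro subgroup.m_inv_closed[OF assms(1)]) blast
  then have "inv (gcomm x g) \<otimes> x \<in> M" using gx assms(1) by (simp add: subgroup.m_closed)
  then show "g \<otimes> x \<otimes> inv g \<in> M" using gx x by (simp add: word_simps)
qed

lemma F_normal: "F i \<lhd> G"
proof (cases i)
  case 0
  then show ?thesis by (simp add: F_0 normal_self)
next
  case (Suc j)
  then show ?thesis using between_normal[OF F_subgroup, of j i] F_Suc by simp
qed

lemma central_mod:
  assumes "x \<in> F i" "g \<in> carrier G"
  shows "F (Suc i) #> (x \<otimes> g) = F (Suc i) #> (g \<otimes> x)"
proof -
  interpret N: normal "F (Suc i)" G by (rule F_normal)
  show ?thesis
    using F_gcomm[OF assms] assms F_carrier by (subst N.rcos_eq_iff) (auto simp: word_simps)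
qed

text \<open>\<open>x\<close> is central modulo \<open>F (Suc i)\<close>, so powers of the product
  distribute there.\<close>

lemma pow_mult_mod:
  assumes "x \<in> F i" "g \<in> carrier G"
  shows "F (Suc i) #> ((x \<otimes> g) [^] (n::nat)) = F (Suc i) #> (x [^] n \<otimes> g [^] n)"
proof -
  interpret N: normal "F (Suc i)" G by (rule F_normal)
  interpret q: group_hom G "G Mod F (Suc i)" "\<lambda>x. F (Suc i) #> x" by (rule N.group_hom_Mod)
  have x: "x \<in> carrier G" using assms F_carrier by blast
  have "(F (Suc i) #> x) \<otimes>\<^bsub>G Mod F (Suc i)\<^esub> (F (Suc i) #> g) = (F (Suc i) #> g) \<otimes>\<^bsub>G Mod F (Suc i)\<^esub> (F (Suc i) #> x)"
    using central_mod[OF assms] x assms by (simp only: q.hom_mult[symmetric])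
  then have "((F (Suc i) #> x) \<otimes>\<^bsub>G Mod F (Suc i)\<^esub> (F (Suc i) #> g)) [^]\<^bsub>G Mod F (Suc i)\<^esub> n =
      (F (Suc i) #> x) [^]\<^bsub>G Mod F (Suc i)\<^esub> n \<otimes>\<^bsub>G Mod F (Suc i)\<^esub> (F (Suc i) #> g) [^]\<^bsub>G Mod F (Suc i)\<^esub> n"
    using x assms by (intro q.H.pow_mult_distrib) (simp_all only: q.hom_closed)
  then show ?thesis
    using x assms by (simp only: q.hom_mult[symmetric] q.hom_nat_pow[symmetric] m_closed nat_pow_closed)
qed

lemma filtration_nilpotent: "nilpotent_group G"
proof -
  have "lcs G i \<subseteq> F i" for i
  proof (induction i)
    case (Suc i)
    then show ?case
      unfolding lower_central_series.simps commutator_subgroup_def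
      by (intro generate_subgroup_incl[OF _ F_subgroup]) (auto intro!: F_gcomm)
  qed (simp add: F_0)
  then have "lcs G c = {\<one>}"
    using F_c subgroup.one_closed[OF lcs_subgroup] by blast
  then show ?thesis using nilpotent_group_def by blast
qed

text \<open>The hypothesis says that the factors are torsion-free; an element of finite order then
  sinks through the whole filtration.\<close>

lemma filtration_torsion_free:
  assumes "\<And>i x n. x \<in> F i \<Longrightarrow> 0 < n \<Longrightarrow> x [^] (n::nat) \<in> F (Suc i) \<Longrightarrow> x \<in> F (Suc i)"
  shows "torsion_free_group G"
proof -
  have "x = \<one>" if "x \<in> carrier G" "0 < n" "x [^] (n::nat) = \<one>" for x n
  proof -
    have "x \<in> F i" for i
      by (induction i) (use that assms subgroup.one_closed[OF F_subgroup] in \<open>auto simp: F_0\<close>)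
    then show ?thesis using F_c by blast
  qed
  then show ?thesis by (simp add: torsion_free_group_def)
qed

text \<open>Successive approximation: if \<open>w\<close> is an \<open>n\<close>th root of
  \<open>x\<close> modulo \<open>F i\<close>, a root \<open>v\<close> of the error is taken in
  \<open>F i\<close>. Being central modulo \<open>F (Suc i)\<close>, it satisfies
  \<open>(v w)^n = v^n w^n\<close> there, so \<open>v w\<close> is a root to one more step.\<close>

lemma filtration_divisible:
  assumes roots: "\<And>i x n. x \<in> F i \<Longrightarrow> 0 < n \<Longrightarrow> \<exists>w \<in> F i. x \<otimes> inv (w [^] (n::nat)) \<in> F (Suc i)"
    and x: "x \<in> carrier G" and n: "0 < n"
  shows "\<exists>w \<in> carrier G. w [^] (n::nat) = x"
proof -
  have "\<exists>w \<in> carrier G. x \<otimes> inv (w [^] n) \<in> F i" for i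
  proof (induction i)
    case 0
    then show ?case using x by (auto simp: F_0 intro!: exI[of _ \<one>])
  next
    case (Suc i)
    interpret N: normal "F (Suc i)" G by (rule F_normal)
    obtain w where w: "w \<in> carrier G" "x \<otimes> inv (w [^] n) \<in> F i" using Suc by blast
    obtain v where v: "v \<in> F i" "x \<otimes> inv (w [^] n) \<otimes> inv (v [^] n) \<in> F (Suc i)"
      using roots[OF w(2) n] by blast
    have vc: "v \<in> carrier G" using v F_carrier by blast
    have "(v \<otimes> w) [^] n \<otimes> inv (v [^] n \<otimes> w [^] n) \<in> F (Suc i)"
      using pow_mult_mod[OF v(1) w(1), of n] vc w by (subst N.rcos_eq_iff[symmetric]) auto
    then have "x \<otimes> inv (w [^] n) \<otimes> inv (v [^] n) \<otimes> inv ((v \<otimes> w) [^] n \<otimes> inv (v [^] n \<otimes> w [^] n)) \<in> F (Suc i)"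
      by (rule N.m_closed[OF v(2) N.m_inv_closed])
    then have "x \<otimes> inv ((v \<otimes> w) [^] n) \<in> F (Suc i)"
      using vc w x by (simp add: word_simps)
    then show ?case using vc w by blast
  qed
  from this[of c] obtain w where w: "w \<in> carrier G" "x \<otimes> inv (w [^] n) = \<one>"
    using F_c by blast
  then have "w [^] n = x" using x by (metis inv_closed inv_equality inv_inv nat_pow_closed)
  then show ?thesis using w by blast
qed

end

lemma (in group) lcs_central_filtration:
  "lcs G c = {\<one>} \<Longrightarrow> central_filtration G (lcs G) c"
  using lcs_subgroup lcs_Suc_subset gcomm_lcs
  by (intro central_filtration.intro[OF is_group] central_filtration_axioms.intro)
     (auto simp del: lower_central_series.simps(2))

subsection \<open>Isolators\<close>

text \<open>The Heisenberg relation: a commutator \<open>y = [x, s]\<close> that commutes with both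
  entries satisfies \<open>[x^m, s^k] = y^(m k)\<close>.\<close>

lemma (in group) pow_commute_twisted:
  assumes "x \<in> carrier G" "s \<in> carrier G" "y \<in> carrier G"
    and eq: "x \<otimes> s = y \<otimes> s \<otimes> x" and ys: "y \<otimes> s = s \<otimes> y" and yx: "y \<otimes> x = x \<otimes> y"
  shows "x [^] (m::nat) \<otimes> s [^] (k::nat) = y [^] (m * k) \<otimes> s [^] k \<otimes> x [^] m"
proof -
  have 1: "x \<otimes> s [^] k = y [^] k \<otimes> s [^] k \<otimes> x" for k :: nat
  proof (induction k)
    case (Suc k)
    have "x \<otimes> s [^] Suc k = x \<otimes> s [^] k \<otimes> s"
      using assms(1-3) by (simp flip: m_assoc)
    also have "\<dots> = y [^] k \<otimes> s [^] k \<otimes> (x \<otimes> s)"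
      unfolding Suc using assms(1-3) by (simp add: m_assoc)
    also have "\<dots> = y [^] k \<otimes> (s [^] k \<otimes> y) \<otimes> s \<otimes> x"
      using assms(1-3) by (simp add: eq m_assoc)
    also have "s [^] k \<otimes> y = y \<otimes> s [^] k"
      using group_commutes_pow[OF ys[symmetric]] assms by simp
    finally show ?case using assms(1-3) by (simp add: m_assoc)
  qed (use assms in simp)
  show ?thesis
  proof (induction m)
    case (Suc m)
    have "x [^] Suc m \<otimes> s [^] k = x [^] m \<otimes> (x \<otimes> s [^] k)"
      using assms by (simp add: m_assoc)
    also have "\<dots> = (x [^] m \<otimes> y [^] k) \<otimes> s [^] k \<otimes> x"
      using assms(1-3) by (simp add: 1 m_assoc)
    also have "x [^] m \<otimes> y [^] k = y [^] k \<otimes> x [^] m"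
      using group_commutes_pow[of x "y [^] k" m] group_commutes_pow[OF yx] assms by simp
    also have "y [^] k \<otimes> x [^] m \<otimes> s [^] k \<otimes> x = y [^] k \<otimes> (x [^] m \<otimes> s [^] k) \<otimes> x"
      using assms by (simp add: m_assoc)
    also have "\<dots> = y [^] k \<otimes> y [^] (m * k) \<otimes> s [^] k \<otimes> (x [^] m \<otimes> x)"
      unfolding Suc using assms(1-3) by (simp add: m_assoc)
    finally show ?case using assms by (simp add: nat_pow_mult)
  qed (use assms in simp)
qed

text \<open>Removes a factor \<open>z\<close> commuting with \<open>t\<close> and \<open>y\<close>
  from a commutation relation: \<open>z h\<close> and \<open>h\<close> have the same commutator with
  \<open>t\<close>.\<close>

lemma (in group) eq_gcommI:
  assumes carr: "y \<in> carrier G" "t \<in> carrier G" "z \<in> carrier G" "h \<in> carrier G"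
    and eq: "y \<otimes> t \<otimes> z \<otimes> h = z \<otimes> h \<otimes> t" and zt: "z \<otimes> t = t \<otimes> z" and zy: "z \<otimes> y = y \<otimes> z"
  shows "y = gcomm h t"
proof -
  have "z \<otimes> (y \<otimes> (t \<otimes> h)) = (z \<otimes> y) \<otimes> t \<otimes> h" using carr by (simp add: m_assoc)
  also have "\<dots> = y \<otimes> (z \<otimes> t) \<otimes> h" unfolding zy using carr by (simp add: m_assoc)
  also have "\<dots> = z \<otimes> (h \<otimes> t)" unfolding zt using eq carr by (simp add: m_assoc)
  finally have "y \<otimes> (t \<otimes> h) = h \<otimes> t" using carr by simp
  then have "y = h \<otimes> t \<otimes> inv (t \<otimes> h)" using carr inv_solve_right by simp
  then show ?thesis using carr by (simp add: word_simps)
qed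

context central_filtration
begin

text \<open>The preimage in \<open>F i\<close> of those elements of the factor
  \<open>F i / F (Suc i)\<close> that have a positive power in the image of
  \<open>H \<inter> F i\<close>.\<close>

definition isolated :: "'a set \<Rightarrow> nat \<Rightarrow> 'a set" where
  "isolated H i = {x \<in> F i. \<exists>m>0. \<exists>h \<in> H \<inter> F i. F (Suc i) #> (x [^] (m::nat)) = F (Suc i) #> h}"

lemma isolated_subgroup:
  assumes H: "subgroup H G"
  shows "subgroup (isolated H i) G"
proof -
  interpret H: subgroup H G by (rule H)
  interpret Fi: subgroup "F i" G by (rule F_subgroup)
  interpret N: normal "F (Suc i)" G by (rule F_normal)
  interpret q: group_hom G "G Mod F (Suc i)" "\<lambda>x. F (Suc i) #> x" by (rule N.group_hom_Mod)
  let ?q = "\<lambda>x. F (Suc i) #> x" and ?Q = "G Mod F (Suc i)"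
  show ?thesis
  proof (rule subgroupI)
    show "isolated H i \<subseteq> carrier G" by (auto simp: isolated_def)
    have "\<one> \<in> isolated H i" by (auto simp: isolated_def intro!: exI[of _ "1::nat"] bexI[of _ \<one>])
    then show "isolated H i \<noteq> {}" by blast
  next
    fix x assume "x \<in> isolated H i"
    then obtain m h where *: "x \<in> F i" "0 < m" "h \<in> H \<inter> F i" "?q (x [^] (m::nat)) = ?q h"
      by (auto simp: isolated_def)
    then have "?q ((inv x) [^] m) = ?q (inv h)"
      using q.hom_inv[of "x [^] m"] q.hom_inv[of h] by (simp add: nat_pow_inv del: q.hom_inv)
    then have "\<exists>h \<in> H \<inter> F i. ?q ((inv x) [^] m) = ?q h"
      using * by (intro bexI[of _ "inv h"]) auto
    then show "inv x \<in> isolated H i" using * by (auto simp: isolated_def)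
  next
    fix x y assume "x \<in> isolated H i" "y \<in> isolated H i"
    then obtain m h n k where x: "x \<in> F i" "0 < m" "h \<in> H \<inter> F i" "?q (x [^] (m::nat)) = ?q h"
      and y: "y \<in> F i" "0 < n" "k \<in> H \<inter> F i" "?q (y [^] (n::nat)) = ?q k"
      by (auto simp: isolated_def)
    \<comment> \<open>The product \<open>m * n\<close> serves both elements, whose own exponents may
      differ.\<close>
    have "?q ((x \<otimes> y) [^] (m * n)) = ?q ((x [^] m) [^] n \<otimes> (y [^] n) [^] m)"
      using x y pow_mult_mod[of x i y "m * n"] by (simp add: nat_pow_pow mult.commute)
    also have "\<dots> = ?q (h [^] n \<otimes> k [^] m)"
      using x y by (simp del: nat_pow_pow add: q.hom_nat_pow)
    finally show "x \<otimes> y \<in> isolated H i"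
      using x y subgroup_int_pow_closed[OF H] subgroup_int_pow_closed[OF F_subgroup[of i]]
      unfolding isolated_def
      by (auto intro!: exI[of _ "m * n"] bexI[of _ "h [^] n \<otimes> k [^] m"] simp flip: int_pow_int)
  qed
qed

lemma F_Suc_isolated: "subgroup H G \<Longrightarrow> F (Suc i) \<subseteq> isolated H i"
proof
  fix x assume H: "subgroup H G" and x: "x \<in> F (Suc i)"
  interpret N: normal "F (Suc i)" G by (rule F_normal)
  have "F (Suc i) #> x = F (Suc i) #> \<one>"
    using x by (simp add: N.rcos_eq_iff F_carrier)
  then show "x \<in> isolated H i"
    unfolding isolated_def using x F_Suc[of i] subgroup.one_closed[OF H] subgroup.one_closed[OF F_subgroup[of i]]
    by (auto intro!: exI[of _ "1::nat"] bexI[of _ \<one>] simp: F_carrier)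
qed

end

text \<open>Commutators are bilinear to first order. If \<open>t = s^k\<close> lies in
  \<open>H\<close> and \<open>x^m\<close> agrees with some \<open>h\<close> in \<open>H\<close>
  modulo \<open>lcs G (Suc i)\<close>, then \<open>[x, s]^(m k)\<close> agrees with
  \<open>[h, t]\<close> modulo the term after that, and \<open>[h, t]\<close> is in
  \<open>H\<close>. So powers in \<open>H\<close> propagate from the generators down the
  series.\<close>

lemma (in group) isolated_lcs:
  assumes c: "lcs G c = {\<one>}" and H: "subgroup H G"
    and S: "S \<subseteq> carrier G" "generate G S = carrier G"
    and pow: "\<And>s. s \<in> S \<Longrightarrow> \<exists>m>0. s [^] (m::nat) \<in> H"
  shows "lcs G i \<subseteq> central_filtration.isolated G (lcs G) H i"
proof (induction i)
  interpret cf: central_filtration G "lcs G" c by (rule lcs_central_filtration[OF c])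
  case 0
  have "S \<subseteq> cf.isolated H 0"
    unfolding cf.isolated_def using pow S by fastforce
  then show ?case
    using generate_subgroup_incl[OF _ cf.isolated_subgroup[OF H], of S 0] S(2) by simp
next
  interpret cf: central_filtration G "lcs G" c by (rule lcs_central_filtration[OF c])
  case (Suc i)
  interpret H: subgroup H G by (rule H)
  let ?L = "lcs G" and ?P = "cf.isolated H (Suc i)"
  let ?q = "\<lambda>x. ?L (Suc (Suc i)) #> x" and ?Q = "G Mod ?L (Suc (Suc i))"
  interpret N: normal "?L (Suc (Suc i))" G by (rule cf.F_normal)
  interpret q: group_hom G ?Q ?q by (rule N.group_hom_Mod)
  interpret P: normal ?P G
    by (rule cf.between_normal[OF cf.isolated_subgroup[OF H] cf.F_Suc_isolated[OF H]])
       (auto simp: cf.isolated_def)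
  have comm: "gcomm x s \<in> ?P" if x: "x \<in> ?L i" and s: "s \<in> S" for x s
  proof -
    interpret N': normal "?L (Suc i)" G by (rule cf.F_normal)
    obtain m h where m: "0 < m" "h \<in> H \<inter> ?L i" "?L (Suc i) #> (x [^] (m::nat)) = ?L (Suc i) #> h"
      using Suc x by (auto simp: cf.isolated_def)
    obtain k where k: "0 < k" "s [^] (k::nat) \<in> H" using pow[OF s] by blast
    have xc: "x \<in> carrier G" and sc: "s \<in> carrier G" and hc: "h \<in> carrier G"
      using x s S m by (auto intro: cf.F_carrier)
    define y where "y = gcomm x s"
    have y: "y \<in> ?L (Suc i)" unfolding y_def using x sc by (rule gcomm_lcs)
    have yc: "y \<in> carrier G" using y by (rule cf.F_carrier)
    define z where "z = x [^] m \<otimes> inv h"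
    have z: "z \<in> ?L (Suc i)" unfolding z_def
      using m xc hc by (subst N'.rcos_eq_iff[symmetric]) auto
    have zc: "z \<in> carrier G" using z by (rule cf.F_carrier)
    have cen: "?q u \<otimes>\<^bsub>?Q\<^esub> ?q g = ?q g \<otimes>\<^bsub>?Q\<^esub> ?q u" if "u \<in> ?L (Suc i)" "g \<in> carrier G" for u g
      using cf.central_mod[OF that] that cf.F_carrier[OF that(1)] by (simp only: q.hom_mult[symmetric])
    have "x \<otimes> s = y \<otimes> s \<otimes> x" using xc sc by (simp add: y_def word_simps)
    then have "?q x \<otimes>\<^bsub>?Q\<^esub> ?q s = ?q y \<otimes>\<^bsub>?Q\<^esub> ?q s \<otimes>\<^bsub>?Q\<^esub> ?q x"
      using xc sc yc by (simp only: q.hom_mult[symmetric] m_closed)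
    then have "?q x [^]\<^bsub>?Q\<^esub> m \<otimes>\<^bsub>?Q\<^esub> ?q s [^]\<^bsub>?Q\<^esub> k = ?q y [^]\<^bsub>?Q\<^esub> (m * k) \<otimes>\<^bsub>?Q\<^esub> ?q s [^]\<^bsub>?Q\<^esub> k \<otimes>\<^bsub>?Q\<^esub> ?q x [^]\<^bsub>?Q\<^esub> m"
      using xc sc yc cen[OF y] by (intro q.H.pow_commute_twisted) (simp_all only: q.hom_closed)
    then have *: "?q (x [^] m \<otimes> s [^] k) = ?q (y [^] (m * k) \<otimes> s [^] k \<otimes> x [^] m)"
      using xc sc yc by (simp only: q.hom_mult q.hom_nat_pow m_closed nat_pow_closed)
    \<comment> \<open>The error \<open>z\<close> of replacing \<open>x^m\<close> by \<open>h\<close>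
      is central modulo \<open>lcs G (Suc (Suc i))\<close>, so it disappears from the commutator
      with \<open>t\<close>.\<close>
    have xm: "x [^] m = z \<otimes> h" using xc hc by (simp add: z_def m_assoc)
    define t where "t = s [^] k"
    have tc: "t \<in> carrier G" using sc by (simp add: t_def)
    have "?q (y [^] (m * k)) \<otimes>\<^bsub>?Q\<^esub> ?q t \<otimes>\<^bsub>?Q\<^esub> ?q z \<otimes>\<^bsub>?Q\<^esub> ?q h = ?q z \<otimes>\<^bsub>?Q\<^esub> ?q h \<otimes>\<^bsub>?Q\<^esub> ?q t"
      using * yc tc zc hc unfolding xm t_def[symmetric]
      by (simp only: q.hom_mult[symmetric] m_closed m_assoc nat_pow_closed)
    from q.H.eq_gcommI[OF _ _ _ _ this cen[OF z] cen[OF z]]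
    have "?q (y [^] (m * k)) = gcomm\<^bsub>?Q\<^esub> (?q h) (?q t)"
      using yc tc zc hc by auto
    then have "?q (y [^] (m * k)) = ?q (gcomm h t)"
      using tc hc by (simp only: q.hom_mult q.hom_inv m_closed inv_closed)
    moreover have "gcomm h t \<in> ?L (Suc i)" using m tc by (intro gcomm_lcs) auto
    moreover have "gcomm h t \<in> H" using m k by (simp add: t_def)
    ultimately show ?thesis
      unfolding y_def[symmetric] cf.isolated_def using y m k by (auto intro!: exI[of _ "m * k"])
  qed
  have "gcomm x g \<in> ?P" if x: "x \<in> ?L i" and g: "g \<in> carrier G" for x g
    by (rule P.gcomm_generate[of S "?L i"])
       (use S comm x g lcs_carrier in \<open>auto intro: generate.incl\<close>)
  then show ?case
    unfolding lower_central_series.simps(2)[of G i] commutator_subgroup_def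
    by (intro generate_subgroup_incl[OF _ P.is_subgroup]) auto
qed

text \<open>If \<open>g^m = z h\<close> with \<open>h\<close> in \<open>H\<close> and error
  \<open>z\<close> in \<open>lcs G i\<close>, some power \<open>z^l\<close> is in \<open>H\<close>
  up to the next term by \<open>isolated_lcs\<close>; centrality of \<open>z\<close> there gives
  \<open>g^(m l) = z^l h^l\<close>, and the error has moved one term down.\<close>

lemma (in group) nilpotent_pow_mem:
  assumes nil: "nilpotent_group G" and H: "subgroup H G"
    and S: "S \<subseteq> carrier G" "generate G S = carrier G"
    and pow: "\<And>s. s \<in> S \<Longrightarrow> \<exists>m>0. s [^] (m::nat) \<in> H"
    and g: "g \<in> carrier G"
  shows "\<exists>m>0. g [^] (m::nat) \<in> H"
proof -
  obtain c where c: "lcs G c = {\<one>}" using nil by (auto simp: nilpotent_group_def)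
  interpret cf: central_filtration G "lcs G" c by (rule lcs_central_filtration[OF c])
  interpret H: subgroup H G by (rule H)
  let ?L = "lcs G"
  have "\<exists>m>0. \<exists>h\<in>H. ?L i #> (g [^] (m::nat)) = ?L i #> h" for i
  proof (induction i)
    case 0
    have "carrier G #> g [^] (1::nat) = carrier G #> \<one>"
      using g by (subst normal.rcos_eq_iff[OF normal_self]) auto
    then have "\<exists>h\<in>H. ?L 0 #> (g [^] (1::nat)) = ?L 0 #> h" by (intro bexI[of _ \<one>]) simp_all
    then show ?case by blast
  next
    case (Suc i)
    let ?q = "\<lambda>x. ?L (Suc i) #> x"
    interpret N': normal "?L i" G by (rule cf.F_normal)
    interpret N: normal "?L (Suc i)" G by (rule cf.F_normal)
    interpret q: group_hom G "G Mod ?L (Suc i)" ?q by (rule N.group_hom_Mod)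
    obtain m h where m: "0 < m" "h \<in> H" "?L i #> (g [^] (m::nat)) = ?L i #> h" using Suc by blast
    define z where "z = g [^] m \<otimes> inv h"
    have z: "z \<in> ?L i" using m g by (simp add: z_def flip: N'.rcos_eq_iff)
    obtain l k where l: "0 < l" "k \<in> H" "?q (z [^] (l::nat)) = ?q k"
      using isolated_lcs[OF c H S pow, of i] z unfolding cf.isolated_def by blast
    have zc: "z \<in> carrier G" using z by (rule cf.F_carrier)
    have "g [^] (m * l) = (z \<otimes> h) [^] l" using g m by (simp add: z_def m_assoc flip: nat_pow_pow)
    then have "?q (g [^] (m * l)) = ?q (z [^] l \<otimes> h [^] l)"
      using cf.pow_mult_mod[OF z, of h l] m by simp
    also have "\<dots> = ?q (k \<otimes> h [^] l)" using l m zc by (simp del: lower_central_series.simps)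
    moreover have "k \<otimes> h [^] l \<in> H" using l m subgroup_int_pow_closed[OF H, of h "int l"] by (simp add: int_pow_int)
    ultimately show ?case using m l by (metis mult_pos_pos)
  qed
  from this[of c] obtain m h where m: "0 < m" "h \<in> H" "{\<one>} #> (g [^] (m::nat)) = {\<one>} #> h" using c by auto
  then have "g [^] m = h" using g by (simp add: r_coset_def)
  then show ?thesis using m by blast
qed

section \<open>Extending homomorphisms into divisible torsion-free nilpotent groups\<close>

lemma DirProd_nat_pow: "(a, b) [^]\<^bsub>G \<times>\<times> H\<^esub> (n::nat) = (a [^]\<^bsub>G\<^esub> n, b [^]\<^bsub>H\<^esub> n)"
  by (induction n) auto

definition divisible_group :: "('a, 'm) monoid_scheme \<Rightarrow> bool" where
  "divisible_group G \<longleftrightarrow>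
     group G \<and> (\<forall>x \<in> carrier G. \<forall>n::nat. 0 < n \<longrightarrow> (\<exists>w \<in> carrier G. w [^]\<^bsub>G\<^esub> n = x))"

text \<open>The graph of the extension is the isolator of the graph of \<open>f\<close> in \<open>A \<times>\<times> U\<close>.\<close>

lemma extend_hom_divisible:
  fixes A :: "('a, 'm) monoid_scheme" and U :: "('u, 'n) monoid_scheme"
  assumes A: "nilpotent_group A" and U: "nilpotent_group U" "torsion_free_group U" "divisible_group U"
    and C: "subgroup C A" and f: "f \<in> hom (A\<lparr>carrier := C\<rparr>) U"
    and pow: "\<And>a. a \<in> carrier A \<Longrightarrow> \<exists>m>0. a [^]\<^bsub>A\<^esub> (m::nat) \<in> C"
  obtains \<psi> where "\<psi> \<in> hom A U" "\<And>c. c \<in> C \<Longrightarrow> \<psi> c = f c"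
proof -
  interpret A: group A using A by (simp add: nilpotent_group_def)
  interpret U: group U using U by (simp add: nilpotent_group_def)
  interpret C: subgroup C A by (rule C)
  interpret f: group_hom "A\<lparr>carrier := C\<rparr>" U f
    using f A.subgroup_imp_group[OF C] by (simp add: group_hom_iff)
  let ?P = "A \<times>\<times> U"
  interpret P: group ?P by (rule DirProd_group) auto
  define \<Gamma> where "\<Gamma> = (\<lambda>c. (c, f c)) ` C"
  have fC: "f c \<in> carrier U" if "c \<in> C" for c using f.hom_closed that by simp
  have finv: "f (inv\<^bsub>A\<^esub> c) = inv\<^bsub>U\<^esub> f c" if "c \<in> C" for c
    using f.hom_inv[of c] that A.m_inv_consistent[OF C that] by simp
  have fmult: "f (c \<otimes>\<^bsub>A\<^esub> d) = f c \<otimes>\<^bsub>U\<^esub> f d" if "c \<in> C" "d \<in> C" for c d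
    using f.hom_mult[of c d] that by simp
  have \<Gamma>: "subgroup \<Gamma> ?P"
  proof (rule P.subgroupI)
    have "(\<one>\<^bsub>A\<^esub>, f \<one>\<^bsub>A\<^esub>) \<in> \<Gamma>" unfolding \<Gamma>_def by (intro image_eqI[of _ _ "\<one>\<^bsub>A\<^esub>"]) auto
    then show "\<Gamma> \<noteq> {}" by blast
    show "inv\<^bsub>?P\<^esub> x \<in> \<Gamma>" if "x \<in> \<Gamma>" for x
      using that by (auto simp: \<Gamma>_def fC finv intro!: rev_image_eqI[OF subgroup.m_inv_closed[OF C]])
    show "x \<otimes>\<^bsub>?P\<^esub> y \<in> \<Gamma>" if "x \<in> \<Gamma>" "y \<in> \<Gamma>" for x y
    proof -
      from that obtain c d where "c \<in> C" "d \<in> C" "x = (c, f c)" "y = (d, f d)" by (auto simp: \<Gamma>_def)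
      then show ?thesis unfolding \<Gamma>_def by (intro image_eqI[of _ _ "c \<otimes>\<^bsub>A\<^esub> d"]) (auto simp: fmult)
    qed
  qed (auto simp: \<Gamma>_def fC)
  define S where "S = {p \<in> carrier ?P. \<exists>m>0. p [^]\<^bsub>?P\<^esub> (m::nat) \<in> \<Gamma>}"
  have S: "S \<subseteq> carrier ?P" by (auto simp: S_def)
  \<comment> \<open>\<open>S\<close> is closed under the group operations because the subgroup it
    generates is nilpotent and its generators have powers in \<open>\<Gamma>\<close>; by
    \<open>nilpotent_pow_mem\<close> every element of that subgroup then has one.\<close>
  have "generate ?P S \<subseteq> S"
  proof
    fix p assume p: "p \<in> generate ?P S"
    let ?K = "?P\<lparr>carrier := generate ?P S\<rparr>"
    have K: "subgroup (generate ?P S) ?P" by (rule P.generate_is_subgroup[OF S])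
    interpret K: group ?K by (rule P.subgroup_imp_group[OF K])
    have "x \<in> S" if "x \<in> \<Gamma>" for x
    proof -
      have "x \<in> carrier ?P" using that subgroup.subset[OF \<Gamma>] by blast
      moreover have "x [^]\<^bsub>?P\<^esub> (1::nat) \<in> \<Gamma>" using that fC by (auto simp: \<Gamma>_def DirProd_nat_pow)
      ultimately show ?thesis unfolding S_def by blast
    qed
    then have \<Gamma>S: "\<Gamma> \<subseteq> generate ?P S" by (auto intro: generate.incl)
    have "\<exists>m>0. p [^]\<^bsub>?K\<^esub> (m::nat) \<in> \<Gamma>"
    proof (rule K.nilpotent_pow_mem)
      show "nilpotent_group ?K" by (rule P.subgroup_nilpotent[OF nilpotent_DirProd[OF A U(1)] K])
      show "subgroup \<Gamma> ?K" by (rule P.subgroup_incl[OF \<Gamma> K \<Gamma>S])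
      show "S \<subseteq> carrier ?K" by (auto intro: generate.incl)
      show "generate ?K S = carrier ?K"
        using P.generate_consistent[OF _ K, of S] by (auto intro: generate.incl)
      show "\<exists>m>0. s [^]\<^bsub>?K\<^esub> (m::nat) \<in> \<Gamma>" if "s \<in> S" for s
        using that by (auto simp: S_def simp flip: P.nat_pow_consistent)
      show "p \<in> carrier ?K" using p by simp
    qed
    then show "p \<in> S" using p P.generate_in_carrier[OF S] by (auto simp: S_def simp flip: P.nat_pow_consistent)
  qed
  then have "generate ?P S = S" by (auto intro: generate.incl)
  then have Ssub: "subgroup S ?P" using P.generate_is_subgroup[OF S] by simp
  \<comment> \<open>The graph is total: \<open>u\<close> is an \<open>m\<close>th root of
    \<open>f (a^m)\<close>, which divisibility provides.\<close>
  have ex: "\<exists>u. (a, u) \<in> S" if a: "a \<in> carrier A" for a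
  proof -
    obtain m where m: "0 < m" "a [^]\<^bsub>A\<^esub> (m::nat) \<in> C" using pow[OF a] by blast
    then obtain u where u: "u \<in> carrier U" "u [^]\<^bsub>U\<^esub> m = f (a [^]\<^bsub>A\<^esub> m)"
      using U(3) fC[OF m(2)] unfolding divisible_group_def by blast
    then have "(a, u) \<in> S" using m a by (auto simp: S_def \<Gamma>_def DirProd_nat_pow)
    then show ?thesis by blast
  qed
  \<comment> \<open>The graph is single-valued: the quotient of two values has a power
    \<open>f \<one>\<close>, so it is trivial by torsion-freeness.\<close>
  have uniq: "u = v" if "(a, u) \<in> S" "(a, v) \<in> S" for a u v
  proof -
    have carr: "a \<in> carrier A" "u \<in> carrier U" "v \<in> carrier U" using that by (auto simp: S_def)
    have "(a, u) \<otimes>\<^bsub>?P\<^esub> inv\<^bsub>?P\<^esub> (a, v) \<in> S"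
      using that by (intro subgroup.m_closed[OF Ssub] subgroup.m_inv_closed[OF Ssub])
    then have "(\<one>\<^bsub>A\<^esub>, u \<otimes>\<^bsub>U\<^esub> inv\<^bsub>U\<^esub> v) \<in> S" using carr by simp
    then obtain m c where "0 < m" "c \<in> C" "\<one>\<^bsub>A\<^esub> [^]\<^bsub>A\<^esub> (m::nat) = c" "(u \<otimes>\<^bsub>U\<^esub> inv\<^bsub>U\<^esub> v) [^]\<^bsub>U\<^esub> m = f c"
      by (auto simp: S_def \<Gamma>_def DirProd_nat_pow)
    then have "(u \<otimes>\<^bsub>U\<^esub> inv\<^bsub>U\<^esub> v) [^]\<^bsub>U\<^esub> m = \<one>\<^bsub>U\<^esub>" "0 < m" using f.hom_one by auto
    then have "u \<otimes>\<^bsub>U\<^esub> inv\<^bsub>U\<^esub> v = \<one>\<^bsub>U\<^esub>" using U(2) carr by (auto simp: torsion_free_group_def)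
    then show ?thesis using carr U.inv_equality by fastforce
  qed
  define \<psi> where "\<psi> a = (THE u. (a, u) \<in> S)" for a
  have \<psi>: "\<psi> a = u" if "(a, u) \<in> S" for a u
    unfolding \<psi>_def using that uniq by blast
  have \<psi>S: "(a, \<psi> a) \<in> S" if "a \<in> carrier A" for a
    using ex[OF that] \<psi> by auto
  show thesis
  proof
    show "\<psi> \<in> hom A U"
    proof (rule homI)
      show "\<psi> a \<in> carrier U" if "a \<in> carrier A" for a
        using \<psi>S[OF that] by (simp add: S_def)
      show "\<psi> (a \<otimes>\<^bsub>A\<^esub> b) = \<psi> a \<otimes>\<^bsub>U\<^esub> \<psi> b" if "a \<in> carrier A" "b \<in> carrier A" for a b
        using subgroup.m_closed[OF Ssub \<psi>S[OF that(1)] \<psi>S[OF that(2)]] by (simp add: \<psi>)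
    qed
    show "\<psi> c = f c" if "c \<in> C" for c
    proof (rule \<psi>)
      have "(c, f c) [^]\<^bsub>?P\<^esub> (1::nat) \<in> \<Gamma>" using that fC by (simp add: \<Gamma>_def DirProd_nat_pow)
      then show "(c, f c) \<in> S" using that fC by (auto simp: S_def simp del: P.nat_pow_Suc)
    qed
  qed
qed

text \<open>A kernel element has a positive power in \<open>C\<close>, where \<open>\<psi>\<close>
  is injective; that power is trivial, and torsion-freeness does the rest.\<close>

lemma (in group) extend_hom_inj:
  assumes tf: "torsion_free_group G" and "group U" and \<psi>: "\<psi> \<in> hom G U"
    and C: "subgroup C G" and inj: "inj_on \<psi> C"
    and pow: "\<And>a. a \<in> carrier G \<Longrightarrow> \<exists>m>0. a [^] (m::nat) \<in> C"
  shows "inj_on \<psi> (carrier G)"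
proof -
  interpret \<psi>: group_hom G U \<psi> using assms by (simp add: group_hom_iff)
  have "x = \<one>" if x: "x \<in> carrier G" "\<psi> x = \<one>\<^bsub>U\<^esub>" for x
  proof -
    obtain m where m: "0 < m" "x [^] (m::nat) \<in> C" using pow[OF x(1)] by blast
    have "\<psi> (x [^] m) = \<psi> \<one>" using x by (simp add: \<psi>.hom_nat_pow)
    then have "x [^] m = \<one>" by (rule inj_onD[OF inj _ m(2) subgroup.one_closed[OF C]])
    then show ?thesis using tf x m by (auto simp: torsion_free_group_def)
  qed
  then show ?thesis by (auto simp: \<psi>.inj_on_one_iff)
qed

lemma (in group) finite_index_pow_mem:
  assumes C: "subgroup C G" and fin: "finite (rcosets C)" and x: "x \<in> carrier G"
  shows "\<exists>m>0. x [^] (m::nat) \<in> C"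
proof -
  \<comment> \<open>Pigeonhole: infinitely many powers of \<open>x\<close> in finitely many
    cosets.\<close>
  have "\<not> inj (\<lambda>n::nat. C #> (x [^] n))"
  proof
    assume "inj (\<lambda>n::nat. C #> (x [^] n))"
    moreover have "range (\<lambda>n::nat. C #> (x [^] n)) \<subseteq> rcosets C"
      using x subgroup.subset[OF C] by (auto intro: rcosetsI)
    ultimately show False using fin finite_subset range_inj_infinite by blast
  qed
  then obtain i j :: nat where "C #> (x [^] i) = C #> (x [^] j)" "i \<noteq> j" by (auto simp: inj_def)
  then obtain i j :: nat where ij: "C #> (x [^] i) = C #> (x [^] j)" "i < j"
    by (metis linorder_neqE_nat)
  then have "x [^] j \<in> C #> (x [^] i)" using x rcos_self[OF _ C] by (metis nat_pow_closed)
  then have "x [^] j \<otimes> inv (x [^] i) \<in> C"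
    using subgroup.rcos_module_imp[OF C is_group] x by simp
  moreover have "x [^] j = x [^] (j - i) \<otimes> x [^] i" using ij x by (simp add: nat_pow_mult)
  ultimately have "x [^] (j - i) \<in> C" using x by (simp add: m_assoc)
  then show ?thesis using ij by (intro exI[of _ "j - i"]) simp
qed

subsection \<open>Finitely generated nilpotent groups\<close>

definition cyclic_extension :: "('a, 'm) monoid_scheme \<Rightarrow> 'a set \<Rightarrow> 'a \<Rightarrow> 'a set" where
  "cyclic_extension G H t = {h \<otimes>\<^bsub>G\<^esub> t [^]\<^bsub>G\<^esub> (k::int) | h k. h \<in> H}"

lemma cyclic_extensionI: "h \<in> H \<Longrightarrow> h \<otimes>\<^bsub>G\<^esub> t [^]\<^bsub>G\<^esub> (k::int) \<in> cyclic_extension G H t"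
  unfolding cyclic_extension_def by (intro CollectI exI conjI) auto

lemma cyclic_extensionE:
  assumes "x \<in> cyclic_extension G H t"
  obtains h and k :: int where "h \<in> H" "x = h \<otimes>\<^bsub>G\<^esub> t [^]\<^bsub>G\<^esub> k"
  using assms unfolding cyclic_extension_def by (elim CollectE exE conjE)

text \<open>Grown from the bottom, each extended subgroup being normal in all of \<open>G\<close>.
  Nilpotent groups allow this because every subgroup between consecutive lower central terms is
  normal.\<close>

inductive cyclic_series :: "('a, 'm) monoid_scheme \<Rightarrow> 'a set \<Rightarrow> bool" for G where
  trivial: "cyclic_series G {\<one>\<^bsub>G\<^esub>}"
| step: "cyclic_series G H \<Longrightarrow> H \<lhd> G \<Longrightarrow> t \<in> carrier G \<Longrightarrow> cyclic_series G (cyclic_extension G H t)"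

lemma (in normal) extend_cyclic_subgroup:
  assumes t: "t \<in> carrier G"
  shows "subgroup (cyclic_extension G H t) G"
proof (rule subgroupI)
  show "cyclic_extension G H t \<subseteq> carrier G" using t by (auto elim: cyclic_extensionE)
  show "cyclic_extension G H t \<noteq> {}"
    using cyclic_extensionI[OF subgroup.one_closed[OF is_subgroup]] by blast
next
  fix x assume "x \<in> cyclic_extension G H t"
  then obtain h k where x: "h \<in> H" "x = h \<otimes> t [^] (k::int)" by (rule cyclic_extensionE)
  then have "inv x = (t [^] (-k) \<otimes> inv h \<otimes> inv (t [^] (-k))) \<otimes> t [^] (-k)"
    using t by (simp add: word_simps int_pow_neg)
  moreover have "t [^] (-k) \<otimes> inv h \<otimes> inv (t [^] (-k)) \<in> H"
    using x t by (intro inv_op_closed2) auto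
  ultimately show "inv x \<in> cyclic_extension G H t" using cyclic_extensionI by metis
next
  fix x y assume xy: "x \<in> cyclic_extension G H t" "y \<in> cyclic_extension G H t"
  obtain h k where x: "h \<in> H" "x = h \<otimes> t [^] (k::int)" using xy(1) by (rule cyclic_extensionE)
  obtain h' k' where y: "h' \<in> H" "y = h' \<otimes> t [^] (k'::int)" using xy(2) by (rule cyclic_extensionE)
  from x y have "x \<otimes> y = (h \<otimes> (t [^] k \<otimes> h' \<otimes> inv (t [^] k))) \<otimes> t [^] (k + k')"
    using t by (simp add: word_simps int_pow_mult)
  moreover have "h \<otimes> (t [^] k \<otimes> h' \<otimes> inv (t [^] k)) \<in> H"
    using x y t by (intro subgroup.m_closed[OF is_subgroup] inv_op_closed2) auto
  ultimately show "x \<otimes> y \<in> cyclic_extension G H t" using cyclic_extensionI by metis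
qed

lemma (in group) cyclic_extension_incl:
  assumes H: "subgroup H G" and t: "t \<in> carrier G"
  shows "H \<subseteq> cyclic_extension G H t" "t \<in> cyclic_extension G H t"
proof -
  show "H \<subseteq> cyclic_extension G H t"
  proof
    fix h assume "h \<in> H"
    then show "h \<in> cyclic_extension G H t"
      using cyclic_extensionI[of h H G t 0] subgroup.mem_carrier[OF H] by simp
  qed
  show "t \<in> cyclic_extension G H t"
    using cyclic_extensionI[OF subgroup.one_closed[OF H], of G t 1] t by simp
qed

lemma (in central_filtration) cyclic_series_extend:
  assumes "finite T" "T \<subseteq> F i" "cyclic_series G (F (Suc i))"
  shows "\<exists>K. cyclic_series G K \<and> subgroup K G \<and> F (Suc i) \<union> T \<subseteq> K \<and> K \<subseteq> F i"
  using assms(1,2)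
proof (induction T)
  case empty
  then show ?case using assms(3) F_subgroup F_Suc by blast
next
  case (insert t T)
  then obtain K where K: "cyclic_series G K" "subgroup K G" "F (Suc i) \<union> T \<subseteq> K" "K \<subseteq> F i"
    by auto
  have n: "K \<lhd> G" using K by (intro between_normal) auto
  interpret K: normal K G by (rule n)
  have t: "t \<in> carrier G" "t \<in> F i" using insert.prems F_carrier by auto
  let ?K' = "cyclic_extension G K t"
  have "?K' \<subseteq> F i"
    using K(4) t
    by (auto elim!: cyclic_extensionE intro!: subgroup.m_closed[OF F_subgroup] subgroup_int_pow_closed[OF F_subgroup])
  moreover have "cyclic_series G ?K'" using K(1) n t(1) by (rule cyclic_series.step)
  moreover have "subgroup ?K' G" using t(1) by (rule K.extend_cyclic_subgroup)
  moreover note cyclic_extension_incl[OF K(2) t(1)]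
  ultimately show ?case using K(3) by (intro exI[of _ ?K'] conjI) auto
qed

text \<open>\<open>T\<close> generates \<open>lcs G i\<close> modulo \<open>lcs G (Suc i)\<close>,
  phrased through subgroups \<open>K\<close> to avoid quotients. Commutators of such a
  \<open>T\<close> with \<open>S\<close> do the same one term further down.\<close>

lemma (in group) lcs_finite_generators:
  assumes c: "lcs G c = {\<one>}"
    and S: "finite S" "S \<subseteq> carrier G" "generate G S = carrier G"
  shows "\<exists>T. finite T \<and> T \<subseteq> lcs G i \<and>
    (\<forall>K. subgroup K G \<longrightarrow> lcs G (Suc i) \<union> T \<subseteq> K \<longrightarrow> lcs G i \<subseteq> K)"
proof (induction i)
  case 0
  have "carrier G \<subseteq> K" if "subgroup K G" "S \<subseteq> K" for K
    using generate_subgroup_incl[OF that(2,1)] S by simp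
  then show ?case using S by (intro exI[of _ S]) auto
next
  case (Suc i)
  interpret cf: central_filtration G "lcs G" c by (rule lcs_central_filtration[OF c])
  let ?L = "lcs G"
  obtain T where T: "finite T" "T \<subseteq> ?L i"
    "\<And>K. subgroup K G \<Longrightarrow> ?L (Suc i) \<union> T \<subseteq> K \<Longrightarrow> ?L i \<subseteq> K"
    using Suc by blast
  let ?T = "(\<lambda>(x, s). gcomm x s) ` (T \<times> S)"
  have "?L (Suc i) \<subseteq> K" if K: "subgroup K G" "?L (Suc (Suc i)) \<union> ?T \<subseteq> K" for K
  proof -
    let ?M = "K \<inter> ?L (Suc i)"
    have T_sub: "?T \<subseteq> ?L (Suc i)" using T(2) S(2) by (auto intro!: gcomm_lcs)
    have sub: "subgroup ?M G" using K(1) lcs_subgroup by (rule subgroups_Inter_pair)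
    \<comment> \<open>Cutting \<open>K\<close> down to \<open>lcs G (Suc i)\<close> places it
      between consecutive terms, which makes it normal and \<open>gcomm_generate\<close>
      applicable.\<close>
    interpret M: normal ?M G
      using K(2) by (intro cf.between_normal[OF sub, of "Suc i"] Int_greatest lcs_Suc_subset) auto
    have 1: "gcomm x s \<in> ?M" if "x \<in> ?L i" "s \<in> S" for x s
    proof -
      have s: "s \<in> carrier G" using that S by blast
      \<comment> \<open>The centralizer of \<open>s\<close> modulo \<open>?M\<close> contains
        \<open>lcs G (Suc i)\<close> and \<open>T\<close>, hence all of
        \<open>lcs G i\<close>.\<close>
      have "?L (Suc i) \<subseteq> {x \<in> carrier G. gcomm x s \<in> ?M}"
        using K(2) gcomm_lcs[OF _ s] lcs_Suc_subset lcs_carrier s by blast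
      moreover have "T \<subseteq> {x \<in> carrier G. gcomm x s \<in> ?M}"
        using K(2) T_sub T(2) lcs_carrier that(2) by auto
      ultimately show ?thesis using T(3)[OF M.subgroup_centralizer_mod[OF s]] that by blast
    qed
    have "gcomm x g \<in> ?M" if x: "x \<in> ?L i" and g: "g \<in> carrier G" for x g
      by (rule M.gcomm_generate[of S "?L i"])
         (use S 1 x g lcs_carrier in \<open>auto intro: generate.incl\<close>)
    then have "?L (Suc i) \<subseteq> ?M"
      unfolding lower_central_series.simps(2)[of G i] commutator_subgroup_def
      by (intro generate_subgroup_incl[OF _ sub[unfolded lower_central_series.simps(2)[of G i] commutator_subgroup_def]]) auto
    then show ?thesis by blast
  qed
  moreover have "?T \<subseteq> ?L (Suc i)" using T(2) S(2) by (auto intro!: gcomm_lcs)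
  ultimately show ?case using T(1) S(1) by (intro exI[of _ ?T]) blast
qed

lemma (in group) nilpotent_fg_cyclic_series:
  assumes "nilpotent_group G" "finitely_generated_group G"
  shows "cyclic_series G (carrier G)"
proof -
  obtain c where c: "lcs G c = {\<one>}" using assms by (auto simp: nilpotent_group_def)
  obtain S where S: "finite S" "S \<subseteq> carrier G" "generate G S = carrier G"
    using assms by (auto simp: finitely_generated_group_def)
  interpret cf: central_filtration G "lcs G" c by (rule lcs_central_filtration[OF c])
  \<comment> \<open>Climbs from the trivial term; truncated subtraction makes the steps beyond
    \<open>c\<close> idle.\<close>
  have "cyclic_series G (lcs G (c - i))" for i
  proof (induction i)
    case 0
    then show ?case using c cyclic_series.trivial by simp
  next
    case (Suc i)
    show ?case
    proof (cases "i < c")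
      case True
      define j where "j = c - Suc i"
      have j: "c - i = Suc j" using True by (simp add: j_def)
      obtain T where T: "finite T" "T \<subseteq> lcs G j"
        "\<And>K. subgroup K G \<Longrightarrow> lcs G (Suc j) \<union> T \<subseteq> K \<Longrightarrow> lcs G j \<subseteq> K"
        using lcs_finite_generators[OF c S, of j] by blast
      obtain K where "cyclic_series G K" "subgroup K G" "lcs G (Suc j) \<union> T \<subseteq> K"
        "K \<subseteq> lcs G j"
        using cf.cyclic_series_extend[OF T(1,2)] Suc j by auto
      then have "K = lcs G j" using T(3) by blast
      then show ?thesis using \<open>cyclic_series G K\<close> by (simp add: j_def)
    next
      case False
      then show ?thesis using Suc by (simp add: le_diff_conv)
    qed
  qed
  from this[of c] show ?thesis by simp
qed

section \<open>Unipotent operators\<close>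

locale filtered_space =
  fixes V :: "nat \<Rightarrow> 'v::real_vector set" and d :: nat
  assumes subspace_V: "subspace (V i)"
    and V_0: "V 0 = {0}"
    and V_Suc: "V i \<subseteq> V (Suc i)"
begin

lemma V_mono: "i \<le> j \<Longrightarrow> V i \<subseteq> V j"
  by (rule lift_Suc_mono_le[of V]) (use V_Suc in auto)

lemma V_add: "u \<in> V i \<Longrightarrow> v \<in> V i \<Longrightarrow> u + v \<in> V i"
  and V_diff: "u \<in> V i \<Longrightarrow> v \<in> V i \<Longrightarrow> u - v \<in> V i"
  and V_scale: "u \<in> V i \<Longrightarrow> r *\<^sub>R u \<in> V i"
  and V_zero: "0 \<in> V i"
  and V_neg: "u \<in> V i \<Longrightarrow> - u \<in> V i"
  using subspace_V[of i] by (auto simp: subspace_add subspace_diff subspace_scale subspace_0 subspace_neg)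

text \<open>\<open>f\<close> is additive on \<open>V d\<close> and \<open>f - 1\<close> lowers the
  filtration by \<open>k\<close>. Subtraction is truncated and \<open>V 0 = {0}\<close>, so
  \<open>f\<close> fixes \<open>V j\<close> pointwise whenever \<open>j \<le> k\<close>.\<close>

definition lowering :: "nat \<Rightarrow> ('v \<Rightarrow> 'v) \<Rightarrow> bool" where
  "lowering k f \<longleftrightarrow>
     (\<forall>u \<in> V d. \<forall>v \<in> V d. f (u + v) = f u + f v) \<and>
     (\<forall>j \<le> d. \<forall>v \<in> V j. f v - v \<in> V (j - k))"

definition unip :: "nat \<Rightarrow> ('v \<Rightarrow> 'v) set" where
  "unip k = {f \<in> Bij (V d). lowering k f}"

abbreviation Uni :: "('v \<Rightarrow> 'v) monoid" where
  "Uni \<equiv> BijGroup (V d)\<lparr>carrier := unip 1\<rparr>"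

abbreviation Uni_mult_op (infixl \<open>\<odot>\<close> 70) where "f \<odot> g \<equiv> f \<otimes>\<^bsub>Uni\<^esub> g"
abbreviation "uinv \<equiv> m_inv Uni"

lemma lowering_add: "lowering k f \<Longrightarrow> u \<in> V d \<Longrightarrow> v \<in> V d \<Longrightarrow> f (u + v) = f u + f v"
  by (simp add: lowering_def)

lemma lowering_lower: "lowering k f \<Longrightarrow> j \<le> d \<Longrightarrow> v \<in> V j \<Longrightarrow> f v - v \<in> V (j - k)"
  by (simp add: lowering_def)

lemma lowering_mono: "lowering k f \<Longrightarrow> l \<le> k \<Longrightarrow> lowering l f"
  unfolding lowering_def using V_mono[of "j - k" "j - l" for j] by (meson diff_le_mono2 subsetD)

lemma lowering_stable:
  assumes "lowering k f" "j \<le> d" "v \<in> V j"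
  shows "f v \<in> V j"
proof -
  have "f v - v \<in> V j"
    using lowering_lower[OF assms] V_mono[of "j - k" j] by auto
  then have "(f v - v) + v \<in> V j" using assms(3) by (rule V_add)
  then show ?thesis by simp
qed

lemma lowering_diff:
  assumes f: "lowering k f" and "u \<in> V d" "v \<in> V d"
  shows "f (u - v) = f u - f v"
  using lowering_add[OF f, of "u - v" v] assms V_diff by (simp add: algebra_simps)

lemma lowering_zero: "lowering k f \<Longrightarrow> f 0 = 0"
  using lowering_diff[of k f 0 0] V_zero by simp

text \<open>Inverting \<open>1\<close> plus a nilpotent: the error \<open>f w - w\<close> lies one
  level lower, is hit by some \<open>v\<close> by induction, and \<open>w - v\<close> is the
  preimage of \<open>w\<close>.\<close>

lemma lowering_surj:
  assumes f: "lowering k f" and k: "0 < k"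
  shows "j \<le> d \<Longrightarrow> w \<in> V j \<Longrightarrow> \<exists>v \<in> V j. f v = w"
proof (induction j arbitrary: w)
  case 0
  then show ?case using lowering_zero[OF f] by (simp add: V_0)
next
  case (Suc j)
  have "f w - w \<in> V (Suc j - k)" using lowering_lower[OF f] Suc.prems by blast
  moreover have "Suc j - k \<le> j" using k by simp
  ultimately have "f w - w \<in> V j" using V_mono by blast
  then obtain v where v: "v \<in> V j" "f v = f w - w" using Suc by auto
  have vV: "v \<in> V (Suc j)" using v V_Suc by blast
  then have "f (w - v) = f w - f v" using Suc.prems V_mono[of "Suc j" d] by (intro lowering_diff[OF f]) auto
  then show ?case using v vV Suc.prems by (intro bexI[of _ "w - v"] V_diff) auto
qed

text \<open>If \<open>f v = 0\<close> then \<open>f v - v = - v\<close> lies one level lower, and so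
  on down to \<open>V 0\<close>.\<close>

lemma lowering_kernel:
  assumes f: "lowering k f" and k: "0 < k"
  shows "j \<le> d \<Longrightarrow> v \<in> V j \<Longrightarrow> f v = 0 \<Longrightarrow> v = 0"
proof (induction j)
  case 0
  then show ?case by (simp add: V_0)
next
  case (Suc j)
  have "f v - v \<in> V (Suc j - k)" using lowering_lower[OF f] Suc.prems by blast
  moreover have "Suc j - k \<le> j" using k by simp
  ultimately have "- v \<in> V j" using V_mono[of "Suc j - k" j] Suc.prems by auto
  then have "v \<in> V j" using V_neg by force
  then show ?case using Suc by simp
qed

lemma lowering_bij:
  assumes f: "lowering k f" and k: "0 < k"
  shows "bij_betw f (V d) (V d)"
proof (rule bij_betw_imageI)
  show "inj_on f (V d)"
  proof (rule inj_onI)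
    fix u v assume uv: "u \<in> V d" "v \<in> V d" "f u = f v"
    then have "f (u - v) = 0" using lowering_diff[OF f] by simp
    then have "u - v = 0" using lowering_kernel[OF f k, of d "u - v"] uv V_diff by simp
    then show "u = v" by simp
  qed
  show "f ` V d = V d"
  proof
    show "f ` V d \<subseteq> V d" using lowering_stable[OF f] by blast
    show "V d \<subseteq> f ` V d" using lowering_surj[OF f k, of d] by force
  qed
qed

lemma lowering_cong:
  assumes "\<And>v. v \<in> V d \<Longrightarrow> f v = g v"
  shows "lowering k f \<longleftrightarrow> lowering k g"
proof -
  have "V j \<subseteq> V d" if "j \<le> d" for j using V_mono that by auto
  then show ?thesis unfolding lowering_def using assms V_add by (auto simp: subset_iff)
qed

lemma restrict_unip:
  assumes "lowering k f" "0 < k"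
  shows "restrict f (V d) \<in> unip k"
proof -
  have "lowering k (restrict f (V d))"
    using lowering_cong[of f "restrict f (V d)" k] assms by auto
  moreover have "bij_betw (restrict f (V d)) (V d) (V d)"
    using lowering_bij[OF assms] by (auto cong: bij_betw_cong)
  ultimately show ?thesis by (simp add: unip_def Bij_def)
qed

section \<open>The group of unipotent operators and its central filtration\<close>

sublocale BG: group "BijGroup (V d)" by (rule group_BijGroup)

lemma BG_mult: "f \<in> Bij (V d) \<Longrightarrow> g \<in> Bij (V d) \<Longrightarrow> v \<in> V d \<Longrightarrow> (f \<otimes>\<^bsub>BijGroup (V d)\<^esub> g) v = f (g v)"
  by (simp add: BijGroup_def compose_def)

lemma BG_carrier: "carrier (BijGroup (V d)) = Bij (V d)"
  by (simp add: BijGroup_def)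

lemma BG_one: "v \<in> V d \<Longrightarrow> \<one>\<^bsub>BijGroup (V d)\<^esub> v = v"
  by (simp add: BijGroup_def)

lemma Bij_eqI: "f \<in> Bij (V d) \<Longrightarrow> g \<in> Bij (V d) \<Longrightarrow> (\<And>v. v \<in> V d \<Longrightarrow> f v = g v) \<Longrightarrow> f = g"
  by (rule extensionalityI[of _ "V d"]) (auto simp: Bij_def)

lemma unip_subgroup:
  assumes k: "0 < k"
  shows "subgroup (unip k) (BijGroup (V d))"
proof (rule BG.subgroupI)
  show "unip k \<subseteq> carrier (BijGroup (V d))" by (auto simp: unip_def BG_carrier)
  have "lowering k (\<lambda>v. v)" using V_zero by (simp add: lowering_def)
  then show "unip k \<noteq> {}" using restrict_unip k by blast
next
  fix f assume f: "f \<in> unip k"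
  then have fB: "f \<in> Bij (V d)" and low: "lowering k f" by (auto simp: unip_def)
  define g where "g = inv\<^bsub>BijGroup (V d)\<^esub> f"
  have gB: "g \<in> Bij (V d)" using BG.inv_closed[of f] fB by (simp add: g_def BG_carrier)
  have fg: "f (g v) = v" if "v \<in> V d" for v
    using BG_mult[OF fB gB that] BG.r_inv[of f] fB that by (simp add: g_def BG_carrier BG_one)
  have gf: "g (f v) = v" if "v \<in> V d" for v
    using BG_mult[OF gB fB that] BG.l_inv[of f] fB that by (simp add: g_def BG_carrier BG_one)
  \<comment> \<open>The inverse preserves each level since \<open>f\<close> is onto level by
    level.\<close>
  have gV: "g v \<in> V j" if "j \<le> d" "v \<in> V j" for j v
    using lowering_surj[OF low k that] gf V_mono[OF that(1)] by auto
  have "lowering k g"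
    unfolding lowering_def
  proof (intro conjI ballI allI impI)
    fix u v assume uv: "u \<in> V d" "v \<in> V d"
    then have "f (g u + g v) = u + v" using lowering_add[OF low] gV[of d] fg by simp
    then show "g (u + v) = g u + g v" using gf[of "g u + g v"] V_add[OF gV[of d u] gV[of d v]] uv by simp
  next
    fix j v assume jv: "j \<le> d" "v \<in> V j"
    then have "f (g v) - g v \<in> V (j - k)" using lowering_lower[OF low] gV by blast
    then have "- (v - g v) \<in> V (j - k)" using fg jv V_mono[of j d] V_neg by (metis subsetD)
    then show "g v - v \<in> V (j - k)" by simp
  qed
  then show "inv\<^bsub>BijGroup (V d)\<^esub> f \<in> unip k" using gB by (simp add: unip_def g_def)
next
  fix f g assume "f \<in> unip k" "g \<in> unip k"
  then have B: "f \<in> Bij (V d)" "g \<in> Bij (V d)" and low: "lowering k f" "lowering k g"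
    by (auto simp: unip_def)
  have "lowering k (\<lambda>v. f (g v))"
    unfolding lowering_def
  proof (intro conjI ballI allI impI)
    fix u v assume "u \<in> V d" "v \<in> V d"
    then show "f (g (u + v)) = f (g u) + f (g v)"
      using lowering_add[OF low(1)] lowering_add[OF low(2)] lowering_stable[OF low(2), of d] by simp
  next
    fix j v assume jv: "j \<le> d" "v \<in> V j"
    then have "(f (g v) - g v) + (g v - v) \<in> V (j - k)"
      using lowering_lower[OF low(1) jv(1)] lowering_lower[OF low(2) jv] lowering_stable[OF low(2) jv]
      by (intro V_add) auto
    then show "f (g v) - v \<in> V (j - k)" by simp
  qed
  then have "lowering k (f \<otimes>\<^bsub>BijGroup (V d)\<^esub> g)"
    using lowering_cong[of "f \<otimes>\<^bsub>BijGroup (V d)\<^esub> g" "\<lambda>v. f (g v)"] BG_mult[OF B] by simp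
  then show "f \<otimes>\<^bsub>BijGroup (V d)\<^esub> g \<in> unip k"
    using BG.m_closed[of f g] B by (simp add: unip_def BG_carrier)
qed

sublocale Uni: group Uni
  by (rule BG.subgroup_imp_group[OF unip_subgroup]) simp

lemma unip_Bij: "f \<in> unip k \<Longrightarrow> f \<in> Bij (V d)"
  and unip_lowering: "f \<in> unip k \<Longrightarrow> lowering k f"
  by (auto simp: unip_def)

lemma unip_lowerI:
  "f \<in> unip 1 \<Longrightarrow> (\<And>j v. j \<le> d \<Longrightarrow> v \<in> V j \<Longrightarrow> f v - v \<in> V (j - k)) \<Longrightarrow> f \<in> unip k"
  by (simp add: unip_def lowering_def)

lemma unip_mono: "l \<le> k \<Longrightarrow> unip k \<subseteq> unip l"
  using lowering_mono by (auto simp: unip_def)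

lemma Uni_mult: "f \<in> unip 1 \<Longrightarrow> g \<in> unip 1 \<Longrightarrow> v \<in> V d \<Longrightarrow> (f \<odot> g) v = f (g v)"
  using BG_mult unip_Bij by simp

lemma Uni_one: "v \<in> V d \<Longrightarrow> \<one>\<^bsub>Uni\<^esub> v = v"
  using BG_one by simp

lemma unip_stable: "f \<in> unip k \<Longrightarrow> j \<le> d \<Longrightarrow> v \<in> V j \<Longrightarrow> f v \<in> V j"
  using lowering_stable unip_lowering by blast

lemma Uni_inv:
  assumes "f \<in> unip 1" "v \<in> V d"
  shows "f ((uinv f) v) = v"
  using Uni_mult[of f "uinv f" v] Uni.r_inv[of f] Uni.inv_closed[of f] assms Uni_one
  by simp

text \<open>First-order binomial expansion. With \<open>f = 1 + a\<close>, the square of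
  \<open>a\<close> lowers by \<open>2 k\<close>, which is at least \<open>Suc k\<close>, so
  \<open>f^n - 1\<close> is \<open>n a\<close> up to deeper terms.\<close>

lemma unip_pow:
  assumes f: "f \<in> unip k" and k: "0 < k"
  shows "j \<le> d \<Longrightarrow> v \<in> V j \<Longrightarrow> ((f [^]\<^bsub>Uni\<^esub> (n::nat)) v - v) - real n *\<^sub>R (f v - v) \<in> V (j - Suc k)"
proof (induction n arbitrary: v)
  case 0
  then show ?case using Uni_one V_mono[of j d] V_zero by auto
next
  case (Suc n)
  have f1: "f \<in> unip 1" using f k unip_mono[of 1 k] by auto
  note low = unip_lowering[OF f]
  have Vd: "V j \<subseteq> V d" using V_mono Suc.prems by blast
  have fv: "f v \<in> V j" using unip_stable[OF f] Suc.prems by blast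
  have 1: "((f [^]\<^bsub>Uni\<^esub> n) (f v) - f v) - real n *\<^sub>R (f (f v) - f v) \<in> V (j - Suc k)"
    using Suc.IH[OF Suc.prems(1) fv] .
  have "f v - v \<in> V (j - k)" using lowering_lower[OF low Suc.prems] .
  then have "f (f v - v) - (f v - v) \<in> V (j - k - k)"
    using lowering_lower[OF low, of "j - k"] Suc.prems by simp
  moreover have "f (f v - v) = f (f v) - f v" using lowering_diff[OF low] fv Suc.prems Vd by blast
  moreover have "j - k - k \<le> j - Suc k" using k by simp
  ultimately have "(f (f v) - f v) - (f v - v) \<in> V (j - Suc k)"
    using V_mono[of "j - k - k" "j - Suc k"] by auto
  then have "(((f [^]\<^bsub>Uni\<^esub> n) (f v) - f v) - real n *\<^sub>R (f (f v) - f v)) +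
      real n *\<^sub>R ((f (f v) - f v) - (f v - v)) \<in> V (j - Suc k)"
    using 1 by (intro V_add V_scale)
  moreover have "(f [^]\<^bsub>Uni\<^esub> Suc n) v = (f [^]\<^bsub>Uni\<^esub> n) (f v)"
    using Uni_mult[of "f [^]\<^bsub>Uni\<^esub> n" f v] f1 Uni.nat_pow_closed[of f n] Vd Suc.prems by auto
  ultimately show ?case by (simp add: algebra_simps)
qed

text \<open>Dividing \<open>f - 1\<close> by \<open>n\<close> gives a root to first order, by
  \<open>unip_pow\<close>. This is the approximate root that \<open>filtration_divisible\<close>
  asks for.\<close>

lemma unip_root:
  assumes f: "f \<in> unip k" and k: "0 < k" and n: "0 < n"
  defines "g \<equiv> restrict (\<lambda>v. v + (1 / real n) *\<^sub>R (f v - v)) (V d)"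
  shows "g \<in> unip k" "f \<odot> uinv (g [^]\<^bsub>Uni\<^esub> n) \<in> unip (Suc k)"
proof -
  note low = unip_lowering[OF f]
  have Vd: "V j \<subseteq> V d" if "j \<le> d" for j using V_mono that by blast
  have "lowering k (\<lambda>v. v + (1 / real n) *\<^sub>R (f v - v))"
    unfolding lowering_def
    using lowering_add[OF low] V_scale[OF lowering_lower[OF low]] by (simp add: algebra_simps)
  then show g: "g \<in> unip k" unfolding g_def using k by (rule restrict_unip)
  have f1: "f \<in> unip 1" and g1: "g \<in> unip 1" using f g k unip_mono[of 1 k] by auto
  define p where "p = g [^]\<^bsub>Uni\<^esub> n"
  have p1: "p \<in> unip 1" using g1 Uni.nat_pow_closed[of g n] by (simp add: p_def)
  have q1: "uinv p \<in> unip 1" using p1 Uni.inv_closed[of p] by simp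
  show "f \<odot> uinv (g [^]\<^bsub>Uni\<^esub> n) \<in> unip (Suc k)"
    unfolding p_def[symmetric]
  proof (rule unip_lowerI)
    show "f \<odot> uinv p \<in> unip 1" using f1 q1 Uni.m_closed[of f "uinv p"] by simp
    fix j v assume jv: "j \<le> d" "v \<in> V j"
    define w where "w = (uinv p) v"
    have w: "w \<in> V j" unfolding w_def using unip_stable[OF q1 jv] .
    have "g w - w = (1 / real n) *\<^sub>R (f w - w)" using w Vd[OF jv(1)] by (auto simp: g_def)
    then have "real n *\<^sub>R (g w - w) = f w - w" using n by simp
    then have "(p w - w) - (f w - w) \<in> V (j - Suc k)"
      using unip_pow[OF g k jv(1) w, of n] by (simp add: p_def)
    then have "p w - f w \<in> V (j - Suc k)" by (simp add: algebra_simps)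
    moreover have "p w = v" unfolding w_def using Uni_inv[OF p1] jv Vd by blast
    moreover have "(f \<odot> uinv p) v = f w" unfolding w_def using Uni_mult[OF f1 q1] jv Vd by blast
    ultimately have "- ((f \<odot> uinv p) v - v) \<in> V (j - Suc k)" by simp
    then show "(f \<odot> uinv p) v - v \<in> V (j - Suc k)" using V_neg by force
  qed
qed

text \<open>With \<open>f = 1 + a\<close> and \<open>g = 1 + b\<close>, the difference of
  \<open>f g\<close> and \<open>g f\<close> is \<open>a b - b a\<close>, which lowers by
  \<open>Suc k\<close>. The commutator minus \<open>1\<close> is this difference evaluated at
  \<open>w\<close>, the preimage of \<open>v\<close> under \<open>g f\<close>.\<close>

lemma unip_gcomm:
  assumes f: "f \<in> unip k" and k: "0 < k" and g: "g \<in> unip 1"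
  shows "gcomm\<^bsub>Uni\<^esub> f g \<in> unip (Suc k)"
proof -
  have f1: "f \<in> unip 1" using f k unip_mono[of 1 k] by auto
  note fl = unip_lowering[OF f] and gl = unip_lowering[OF g]
  have Vd: "V j \<subseteq> V d" if "j \<le> d" for j using V_mono that by blast
  define p where "p = g \<odot> f"
  have p1: "p \<in> unip 1" using f1 g Uni.m_closed[of g f] by (simp add: p_def)
  have q1: "uinv p \<in> unip 1" using p1 Uni.inv_closed[of p] by simp
  have fg1: "f \<odot> g \<in> unip 1" using f1 g Uni.m_closed[of f g] by simp
  have eq: "gcomm\<^bsub>Uni\<^esub> f g = (f \<odot> g) \<odot> uinv p"
    using f1 g Uni.inv_mult_group[of g f] Uni.m_assoc[of "f \<odot> g" "uinv f" "uinv g"]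
      Uni.inv_closed[of f] Uni.inv_closed[of g] fg1 by (simp add: p_def)
  have c1: "(f \<odot> g) \<odot> uinv p \<in> unip 1"
    using fg1 q1 Uni.m_closed[of "f \<odot> g" "uinv p"] by simp
  show ?thesis
    unfolding eq
  proof (rule unip_lowerI[OF c1])
    fix j v assume jv: "j \<le> d" "v \<in> V j"
    define w where "w = (uinv p) v"
    have w: "w \<in> V j" unfolding w_def using unip_stable[OF q1 jv] .
    then have wd: "w \<in> V d" using Vd jv by blast
    have mem: "f w \<in> V d" "g w \<in> V d" using unip_stable f1 g wd by blast+
    have "p w = v" unfolding w_def using Uni_inv[OF p1] jv Vd by blast
    then have v: "v = g (f w)" unfolding p_def using Uni_mult[OF g f1 wd] by simp
    have c: "(f \<odot> g \<odot> uinv p) v = f (g w)"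
      using Uni_mult[OF fg1 q1, of v] Uni_mult[OF f1 g wd] jv Vd unfolding w_def by auto
    have "g w - w \<in> V (j - 1)" using lowering_lower[OF gl jv(1) w] .
    then have "f (g w - w) - (g w - w) \<in> V (j - 1 - k)" using lowering_lower[OF fl, of "j - 1"] jv by simp
    moreover have "f w - w \<in> V (j - k)" using lowering_lower[OF fl jv(1) w] .
    then have "g (f w - w) - (f w - w) \<in> V (j - k - 1)" using lowering_lower[OF gl, of "j - k"] jv by simp
    moreover have "j - 1 - k = j - Suc k" "j - k - 1 = j - Suc k" by simp_all
    ultimately have "(f (g w - w) - (g w - w)) - (g (f w - w) - (f w - w)) \<in> V (j - Suc k)"
      using V_diff by metis
    moreover have "f (g w - w) = f (g w) - f w" "g (f w - w) = g (f w) - g w"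
      using lowering_diff[OF fl mem(2) wd] lowering_diff[OF gl mem(1) wd] .
    ultimately have "f (g w) - g (f w) \<in> V (j - Suc k)" by (simp add: algebra_simps)
    then show "(f \<odot> g \<odot> uinv p) v - v \<in> V (j - Suc k)" using c v by simp
  qed
qed

text \<open>The shift makes index \<open>0\<close> the whole group. At index \<open>d\<close>,
  \<open>f v - v\<close> lies in \<open>V (d - Suc d) = V 0\<close> and vanishes.\<close>

sublocale UF: central_filtration Uni "\<lambda>i. unip (Suc i)" d
proof (intro central_filtration.intro[OF Uni.is_group] central_filtration_axioms.intro)
  show "subgroup (unip (Suc i)) Uni" for i
    by (rule BG.subgroup_incl[OF unip_subgroup unip_subgroup]) (auto intro: subsetD[OF unip_mono])
  show "unip (Suc 0) = carrier Uni" by simp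
  show "unip (Suc (Suc i)) \<subseteq> unip (Suc i)" for i by (rule unip_mono) simp
  show "gcomm\<^bsub>Uni\<^esub> x g \<in> unip (Suc (Suc i))" if "x \<in> unip (Suc i)" "g \<in> carrier Uni" for x g i
    using unip_gcomm[of x "Suc i" g] that by simp
  have "f = \<one>\<^bsub>Uni\<^esub>" if f: "f \<in> unip (Suc d)" for f
  proof (rule Bij_eqI)
    show "f \<in> Bij (V d)" "\<one>\<^bsub>Uni\<^esub> \<in> Bij (V d)"
      using f unip_Bij Uni.one_closed by auto
    show "f v = \<one>\<^bsub>Uni\<^esub> v" if "v \<in> V d" for v
      using lowering_lower[OF unip_lowering[OF f], of d v] that V_0 Uni_one by simp
  qed
  moreover have "\<one>\<^bsub>Uni\<^esub> \<in> unip (Suc d)"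
    using subgroup.one_closed[OF unip_subgroup[of "Suc d"]] by simp
  ultimately show "unip (Suc d) = {\<one>\<^bsub>Uni\<^esub>}" by blast
qed

lemma Uni_nilpotent: "nilpotent_group Uni"
  by (rule UF.filtration_nilpotent)

text \<open>To first order \<open>f^n - 1\<close> is \<open>n (f - 1)\<close>, and real scalars
  allow division by \<open>n\<close>.\<close>

lemma Uni_torsion_free: "torsion_free_group Uni"
proof (rule UF.filtration_torsion_free)
  fix i f and n :: nat
  assume f: "f \<in> unip (Suc i)" and n: "0 < n" and p: "f [^]\<^bsub>Uni\<^esub> n \<in> unip (Suc (Suc i))"
  show "f \<in> unip (Suc (Suc i))"
  proof (rule unip_lowerI)
    show "f \<in> unip 1" using f unip_mono[of 1 "Suc i"] by auto
    fix j v assume jv: "j \<le> d" "v \<in> V j"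
    have "((f [^]\<^bsub>Uni\<^esub> n) v - v) - (((f [^]\<^bsub>Uni\<^esub> n) v - v) - real n *\<^sub>R (f v - v)) \<in> V (j - Suc (Suc i))"
      by (rule V_diff[OF lowering_lower[OF unip_lowering[OF p] jv] unip_pow[OF f _ jv]]) simp
    then have "real n *\<^sub>R (f v - v) \<in> V (j - Suc (Suc i))" by simp
    then have "(1 / real n) *\<^sub>R (real n *\<^sub>R (f v - v)) \<in> V (j - Suc (Suc i))"
      by (rule V_scale)
    then show "f v - v \<in> V (j - Suc (Suc i))" using n by simp
  qed
qed

lemma Uni_divisible: "divisible_group Uni"
  unfolding divisible_group_def
proof (intro conjI ballI allI impI)
  fix x and n :: nat assume "x \<in> carrier Uni" "0 < n"
  then show "\<exists>w\<in>carrier Uni. w [^]\<^bsub>Uni\<^esub> n = x"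
    by (intro UF.filtration_divisible) (use unip_root in blast)+
qed (rule Uni.is_group)

end

instantiation "fun" :: (type, real_vector) real_vector
begin

definition scaleR_fun :: "real \<Rightarrow> ('a \<Rightarrow> 'b) \<Rightarrow> 'a \<Rightarrow> 'b" where
  "scaleR_fun r f = (\<lambda>x. r *\<^sub>R f x)"

instance
  by standard (simp_all add: scaleR_fun_def fun_eq_iff scaleR_add_right scaleR_add_left)

end

section \<open>Polynomial functions on nilpotent groups\<close>

text \<open>Level \<open>d\<close> means degree below \<open>d\<close>: all \<open>d\<close>-fold
  left differences vanish on the carrier. Level \<open>0\<close> is the zero function and constants
  appear at level \<open>1\<close>, matching \<open>V 0 = {0}\<close> of a filtered space.\<close>

primrec gpoly :: "('a, 'm) monoid_scheme \<Rightarrow> nat \<Rightarrow> ('a \<Rightarrow> real) \<Rightarrow> bool" where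
  "gpoly G 0 f \<longleftrightarrow> (\<forall>x \<in> carrier G. f x = 0)"
| "gpoly G (Suc d) f \<longleftrightarrow> (\<forall>g \<in> carrier G. gpoly G d (\<lambda>x. f (g \<otimes>\<^bsub>G\<^esub> x) - f x))"

text \<open>Separation from the identity is what makes the translation action on level
  \<open>d\<close> faithful.\<close>

definition gpoly_separates :: "('a, 'm) monoid_scheme \<Rightarrow> nat \<Rightarrow> bool" where
  "gpoly_separates G d \<longleftrightarrow>
     (\<forall>x \<in> carrier G. x \<noteq> \<one>\<^bsub>G\<^esub> \<longrightarrow> (\<exists>f. gpoly G d f \<and> f x \<noteq> f \<one>\<^bsub>G\<^esub>))"

context group
begin

lemma gpoly_cong: "(\<And>x. x \<in> carrier G \<Longrightarrow> f x = g x) \<Longrightarrow> gpoly G d f \<longleftrightarrow> gpoly G d g"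
proof (induction d arbitrary: f g)
  case 0
  then show ?case by simp
next
  case (Suc d)
  have "gpoly G d (\<lambda>x. f (y \<otimes> x) - f x) \<longleftrightarrow> gpoly G d (\<lambda>x. g (y \<otimes> x) - g x)" if "y \<in> carrier G" for y
    using that Suc.prems by (intro Suc.IH) auto
  then show ?case by simp
qed

lemma gpoly_zero: "gpoly G d (\<lambda>x. 0)"
  by (induction d) auto

lemma gpoly_add: "gpoly G d f \<Longrightarrow> gpoly G d g \<Longrightarrow> gpoly G d (\<lambda>x. f x + g x)"
proof (induction d arbitrary: f g)
  case (Suc d)
  have "gpoly G d (\<lambda>x. (f (y \<otimes> x) - f x) + (g (y \<otimes> x) - g x))" if "y \<in> carrier G" for y
    using that Suc.prems by (intro Suc.IH) auto
  then show ?case by (simp add: algebra_simps)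
qed simp

lemma gpoly_scale: "gpoly G d f \<Longrightarrow> gpoly G d (\<lambda>x. r * f x)"
proof (induction d arbitrary: f)
  case (Suc d)
  have "gpoly G d (\<lambda>x. r * (f (y \<otimes> x) - f x))" if "y \<in> carrier G" for y
    using that Suc.prems by (intro Suc.IH) auto
  then show ?case by (simp add: algebra_simps)
qed simp

lemma gpoly_Suc: "gpoly G d f \<Longrightarrow> gpoly G (Suc d) f"
proof (induction d arbitrary: f)
  case (Suc d)
  have "gpoly G (Suc d) (\<lambda>x. f (y \<otimes> x) - f x)" if "y \<in> carrier G" for y
    using that Suc.prems by (intro Suc.IH) auto
  then show ?case by (simp only: gpoly.simps(2)) blast
qed simp

lemma gpoly_mono: "gpoly G d f \<Longrightarrow> d \<le> e \<Longrightarrow> gpoly G e f"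
  by (induction e rule: nat_induct) (auto simp: le_Suc_eq intro: gpoly_Suc simp del: gpoly.simps(2))

text \<open>Vanishing off the carrier makes equality of functions mean equality on the group, so
  that level \<open>0\<close> is exactly \<open>{0}\<close>.\<close>

definition poly_space :: "nat \<Rightarrow> ('a \<Rightarrow> real) set" where
  "poly_space i = {f. gpoly G i f \<and> (\<forall>x. x \<notin> carrier G \<longrightarrow> f x = 0)}"

lemma filtered_poly_space: "filtered_space poly_space"
proof
  show "subspace (poly_space i)" for i
    using gpoly_zero gpoly_add gpoly_scale
    by (auto simp: subspace_def poly_space_def scaleR_fun_def plus_fun_def zero_fun_def)
  show "poly_space 0 = {0}" unfolding poly_space_def by (auto simp: fun_eq_iff) metis
  show "poly_space i \<subseteq> poly_space (Suc i)" for i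
    using gpoly_Suc by (auto simp: poly_space_def simp del: gpoly.simps)
qed

text \<open>The left regular representation; the inverse turns an antihomomorphism into a
  homomorphism.\<close>

definition translation :: "'a \<Rightarrow> ('a \<Rightarrow> real) \<Rightarrow> 'a \<Rightarrow> real" where
  "translation g f = (\<lambda>x. if x \<in> carrier G then f (inv g \<otimes> x) else 0)"

lemma translation_lower:
  assumes g: "g \<in> carrier G" and f: "f \<in> poly_space (Suc j)"
  shows "translation g f - f \<in> poly_space j"
proof -
  have "gpoly G j (\<lambda>x. f (inv g \<otimes> x) - f x)" using f g by (simp add: poly_space_def)
  then have "gpoly G j (translation g f - f)"
    using gpoly_cong[of "translation g f - f" "\<lambda>x. f (inv g \<otimes> x) - f x"] by (simp add: translation_def)
  then show ?thesis using f by (auto simp: poly_space_def translation_def)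
qed

text \<open>Translating and subtracting is a difference by \<open>inv g\<close>, which drops the
  level by one, so translations are unipotent. If \<open>g\<close> acts trivially then
  \<open>f (inv g) = f \<one>\<close> for all \<open>f\<close> of level \<open>d\<close>, contrary
  to separation.\<close>

lemma poly_embedding:
  assumes sep: "gpoly_separates G d"
  obtains \<psi> where
    "\<psi> \<in> hom G (filtered_space.Uni poly_space d)" "inj_on \<psi> (carrier G)"
proof -
  interpret fs: filtered_space poly_space d by (rule filtered_poly_space)
  let ?\<psi> = "\<lambda>g. restrict (translation g) (poly_space d)"
  have low: "fs.lowering 1 (translation g)" if "g \<in> carrier G" for g
    unfolding fs.lowering_def
  proof (intro conjI ballI allI impI)
    show "translation g (u + v) = translation g u + translation g v" for u v
      by (auto simp: translation_def fun_eq_iff)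
    fix j v assume v: "v \<in> poly_space j"
    show "translation g v - v \<in> poly_space (j - 1)"
    proof (cases j)
      case 0
      then have "v = 0" using v fs.V_0 by simp
      then show ?thesis using 0 fs.V_0 by (simp add: translation_def fun_eq_iff)
    next
      case (Suc i)
      then show ?thesis using translation_lower[OF that] v by simp
    qed
  qed
  have \<psi>: "?\<psi> g \<in> fs.unip 1" if "g \<in> carrier G" for g
    using fs.restrict_unip[OF low[OF that]] by simp
  have hom: "?\<psi> \<in> hom G fs.Uni"
  proof (rule homI)
    show "?\<psi> g \<in> carrier fs.Uni" if "g \<in> carrier G" for g using \<psi>[OF that] by simp
    fix g h assume gh: "g \<in> carrier G" "h \<in> carrier G"
    have "?\<psi> (g \<otimes> h) v = (?\<psi> g \<otimes>\<^bsub>fs.Uni\<^esub> ?\<psi> h) v" if v: "v \<in> poly_space d" for v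
    proof -
      have "(?\<psi> g \<otimes>\<^bsub>fs.Uni\<^esub> ?\<psi> h) v = ?\<psi> g (?\<psi> h v)"
        using fs.Uni_mult[OF \<psi>[OF gh(1)] \<psi>[OF gh(2)] v] .
      also have "\<dots> = translation g (translation h v)"
        using v fs.unip_stable[OF \<psi>[OF gh(2)], of d v] by simp
      also have "\<dots> = translation (g \<otimes> h) v"
        using gh by (auto simp: translation_def fun_eq_iff inv_mult_group m_assoc)
      finally show ?thesis using v by simp
    qed
    then show "?\<psi> (g \<otimes> h) = ?\<psi> g \<otimes>\<^bsub>fs.Uni\<^esub> ?\<psi> h"
      using \<psi> gh fs.Uni.m_closed[of "?\<psi> g" "?\<psi> h"]
      by (intro fs.Bij_eqI fs.unip_Bij[of _ 1]) auto
  qed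
  interpret \<psi>: group_hom G fs.Uni ?\<psi>
    using hom fs.Uni.is_group by (simp add: group_hom_iff)
  have "g = \<one>" if g: "g \<in> carrier G" "?\<psi> g = \<one>\<^bsub>fs.Uni\<^esub>" for g
  proof (rule ccontr)
    assume "g \<noteq> \<one>"
    then have "inv g \<noteq> \<one>" using g by simp
    then obtain f where f: "gpoly G d f" "f (inv g) \<noteq> f \<one>"
      using sep g unfolding gpoly_separates_def by blast
    define f' where "f' x = (if x \<in> carrier G then f x else 0)" for x
    have f': "f' \<in> poly_space d" using f(1) gpoly_cong[of f f'] by (simp add: poly_space_def f'_def)
    then have "?\<psi> g f' = f'" using g(2) fs.Uni_one by metis
    then have "translation g f' \<one> = f' \<one>" using f' by simp
    then show False using f(2) g(1) by (simp add: translation_def f'_def)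
  qed
  then have "inj_on ?\<psi> (carrier G)" by (auto simp: \<psi>.inj_on_one_iff)
  then show thesis using that[OF hom] by blast
qed

lemma separates_imp_embedding:
  assumes "gpoly_separates G d"
  shows "\<exists>(U :: (('a \<Rightarrow> real) \<Rightarrow> 'a \<Rightarrow> real) monoid) \<psi>. nilpotent_group U \<and> torsion_free_group U
    \<and> divisible_group U \<and> \<psi> \<in> hom G U \<and> inj_on \<psi> (carrier G)"
proof -
  interpret fs: filtered_space poly_space d by (rule filtered_poly_space)
  show ?thesis
    using poly_embedding[OF assms] fs.Uni_nilpotent fs.Uni_torsion_free fs.Uni_divisible by metis
qed

end

text \<open>Matrix coefficients of a unipotent representation are polynomial.\<close>

lemma (in group) separates_finite_extension:
  assumes nil: "nilpotent_group G" and tf: "torsion_free_group G" and H: "subgroup H G"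
    and pow: "\<And>a. a \<in> carrier G \<Longrightarrow> \<exists>m>0. a [^] (m::nat) \<in> H"
    and sep: "gpoly_separates (G\<lparr>carrier := H\<rparr>) d"
  shows "gpoly_separates G d"
proof -
  let ?H = "G\<lparr>carrier := H\<rparr>"
  interpret H: group ?H by (rule subgroup_imp_group[OF H])
  interpret fs: filtered_space H.poly_space d by (rule H.filtered_poly_space)
  obtain \<psi>0 where \<psi>0: "\<psi>0 \<in> hom ?H fs.Uni" "inj_on \<psi>0 H"
    using H.poly_embedding[OF sep] by auto
  \<comment> \<open>The operators on polynomials of \<open>H\<close> form a divisible group, so the
    representation of \<open>H\<close> extends to \<open>G\<close>.\<close>
  obtain \<psi> where \<psi>: "\<psi> \<in> hom G fs.Uni" "\<And>h. h \<in> H \<Longrightarrow> \<psi> h = \<psi>0 h"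
    using extend_hom_divisible[OF nil fs.Uni_nilpotent fs.Uni_torsion_free fs.Uni_divisible H \<psi>0(1) pow]
    by blast
  have "inj_on \<psi> H" using \<psi>0(2) \<psi>(2) by (simp cong: inj_on_cong)
  then have inj: "inj_on \<psi> (carrier G)"
    using extend_hom_inj[OF tf fs.Uni.is_group \<psi>(1) H _ pow] by blast
  interpret \<psi>: group_hom G fs.Uni \<psi>
    using \<psi> fs.Uni.is_group by (simp add: group_hom_iff)
  have u: "\<psi> g \<in> fs.unip 1" if "g \<in> carrier G" for g using \<psi>.hom_closed[OF that] by simp
  \<comment> \<open>Because of the inverse, replacing \<open>b\<close> by
    \<open>g \<otimes> b\<close> only changes the vector \<open>v\<close>; the difference is the
    coefficient of \<open>\<psi> (inv g) v - v\<close>, which lies one level lower.\<close>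
  have coeff: "j \<le> d \<Longrightarrow> v \<in> H.poly_space j \<Longrightarrow> gpoly G j (\<lambda>b. \<psi> (inv b) v y)" for j v y
  proof (induction j arbitrary: v)
    case 0
    then have "v = 0" using fs.V_0 by simp
    have "\<psi> (inv b) v = 0" if "b \<in> carrier G" for b
      unfolding \<open>v = 0\<close> using that by (intro fs.lowering_zero[OF fs.unip_lowering[OF u]]) simp
    then show ?case by simp
  next
    case (Suc j)
    have vd: "v \<in> H.poly_space d" using Suc.prems fs.V_mono[of "Suc j" d] by blast
    have "gpoly G j (\<lambda>b. \<psi> (inv (g \<otimes> b)) v y - \<psi> (inv b) v y)" if g: "g \<in> carrier G" for g
    proof -
      define w where "w = \<psi> (inv g) v - v"
      have w: "w \<in> H.poly_space j"
        unfolding w_def using fs.lowering_lower[OF fs.unip_lowering[OF u[of "inv g"]] Suc.prems] g by simp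
      have "\<psi> (inv (g \<otimes> b)) v y - \<psi> (inv b) v y = \<psi> (inv b) w y" if b: "b \<in> carrier G" for b
      proof -
        have "\<psi> (inv (g \<otimes> b)) v = \<psi> (inv b) (\<psi> (inv g) v)"
          using fs.Uni_mult[OF u[of "inv b"] u[of "inv g"] vd] \<psi>.hom_mult[of "inv b" "inv g"] g b
          by (simp add: inv_mult_group)
        moreover have "\<psi> (inv b) w = \<psi> (inv b) (\<psi> (inv g) v) - \<psi> (inv b) v"
          unfolding w_def using g b vd fs.unip_stable[OF u, of "inv g" d v]
          by (intro fs.lowering_diff[OF fs.unip_lowering[OF u]]) auto
        ultimately show ?thesis by simp
      qed
      then show ?thesis
        using Suc.IH[OF _ w] Suc.prems gpoly_cong[of "\<lambda>b. \<psi> (inv (g \<otimes> b)) v y - \<psi> (inv b) v y" "\<lambda>b. \<psi> (inv b) w y" j]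
        by simp
    qed
    then show ?case by simp
  qed
  show ?thesis
    unfolding gpoly_separates_def
  proof (intro ballI impI)
    fix x assume x: "x \<in> carrier G" "x \<noteq> \<one>"
    have "\<psi> (inv x) \<noteq> \<one>\<^bsub>fs.Uni\<^esub>"
      using x inj by (metis \<psi>.inj_on_one_iff inv_closed inv_eq_1_iff)
    then obtain v where v: "v \<in> H.poly_space d" "\<psi> (inv x) v \<noteq> v"
      using fs.Bij_eqI[of "\<psi> (inv x)" "\<one>\<^bsub>fs.Uni\<^esub>"] fs.unip_Bij[OF u[of "inv x"]]
        fs.unip_Bij[of "\<one>\<^bsub>fs.Uni\<^esub>" 1] fs.Uni.one_closed x fs.Uni_one by force
    then obtain y where y: "\<psi> (inv x) v y \<noteq> v y" by (auto simp: fun_eq_iff)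
    moreover have "\<psi> (inv \<one>) v = v" using fs.Uni_one[OF v(1)] by simp
    ultimately show "\<exists>f. gpoly G d f \<and> f x \<noteq> f \<one>"
      using coeff[OF order_refl v(1), of y] by (intro exI[of _ "\<lambda>b. \<psi> (inv b) v y"]) simp
  qed
qed

text \<open>Polynomials on a normal subgroup \<open>H\<close> graded by the lower central series of \<open>G\<close>: conjugation by
  an arbitrary element of \<open>G\<close> then acts unipotently.\<close>

fun wpoly :: "('a, 'm) monoid_scheme \<Rightarrow> 'a set \<Rightarrow> nat \<Rightarrow> ('a \<Rightarrow> real) \<Rightarrow> bool" where
  "wpoly G H 0 f \<longleftrightarrow> (\<forall>x \<in> H. f x = 0)"
| "wpoly G H (Suc w) f \<longleftrightarrow>
     (\<forall>i. \<forall>n \<in> H \<inter> lcs G i. wpoly G H (w - i) (\<lambda>x. f (n \<otimes>\<^bsub>G\<^esub> x) - f x))"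

declare wpoly.simps(2) [simp del]

text \<open>Follows the recursion of \<open>wpoly\<close>, where a single difference may lower the
  weight by any positive amount.\<close>

lemma weight_induct [case_names 0 Suc]:
  "P 0 \<Longrightarrow> (\<And>w. (\<And>i. P (w - i)) \<Longrightarrow> P (Suc w)) \<Longrightarrow> P (n :: nat)"
  by (induction n rule: less_induct) (metis diff_le_self le_imp_less_Suc not0_implies_Suc)

context normal
begin

lemma wpoly_cong: "(\<And>x. x \<in> H \<Longrightarrow> f x = g x) \<Longrightarrow> wpoly G H w f \<longleftrightarrow> wpoly G H w g"
proof (induction w arbitrary: f g rule: weight_induct)
  case (Suc w)
  have "wpoly G H (w - i) (\<lambda>x. f (y \<otimes> x) - f x) \<longleftrightarrow> wpoly G H (w - i) (\<lambda>x. g (y \<otimes> x) - g x)"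
    if "y \<in> H" for y i
    using that Suc.prems by (intro Suc.IH) auto
  then show ?case unfolding wpoly.simps(2) by blast
qed simp

lemma wpoly_zero: "(\<And>x. x \<in> H \<Longrightarrow> f x = 0) \<Longrightarrow> wpoly G H w f"
  by (induction w arbitrary: f rule: weight_induct) (auto simp: wpoly.simps(2))

lemma wpoly_add: "wpoly G H w f \<Longrightarrow> wpoly G H w g \<Longrightarrow> wpoly G H w (\<lambda>x. f x + g x)"
proof (induction w arbitrary: f g rule: weight_induct)
  case (Suc w)
  have "wpoly G H (w - i) (\<lambda>x. (f (y \<otimes> x) - f x) + (g (y \<otimes> x) - g x))"
    if "y \<in> H \<inter> lcs G i" for y i
    using that Suc.prems by (intro Suc.IH) (auto simp: wpoly.simps(2))
  then show ?case unfolding wpoly.simps(2) by (simp add: algebra_simps)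
qed simp

lemma wpoly_Suc: "wpoly G H w f \<Longrightarrow> wpoly G H (Suc w) f"
proof (induction w arbitrary: f rule: weight_induct)
  case 0
  then show ?case by (auto simp: wpoly.simps(2))
next
  case (Suc w)
  have "wpoly G H (Suc w - i) (\<lambda>x. f (n \<otimes> x) - f x)" if "n \<in> H \<inter> lcs G i" for n i
  proof -
    have *: "wpoly G H (w - i) (\<lambda>x. f (n \<otimes> x) - f x)"
      using Suc.prems that by (auto simp: wpoly.simps(2))
    show ?thesis
      using Suc.IH[OF *] * by (cases "i \<le> w") (simp_all add: Suc_diff_le)
  qed
  then show ?case unfolding wpoly.simps(2)[of G H "Suc w"] by blast
qed

lemma wpoly_mono: "wpoly G H v f \<Longrightarrow> v \<le> w \<Longrightarrow> wpoly G H w f"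
  by (induction w) (auto simp: le_Suc_eq intro: wpoly_Suc)

lemma wpoly_diff:
  assumes "wpoly G H (Suc w) f" "n \<in> H"
  shows "wpoly G H w (\<lambda>x. f (n \<otimes> x) - f x)"
  using assms(1)[unfolded wpoly.simps(2)[of G H w], rule_format, of n 0] assms(2) by simp

lemma wpoly_translate:
  assumes "wpoly G H w f" "n \<in> H"
  shows "wpoly G H w (\<lambda>x. f (n \<otimes> x))"
proof -
  have "wpoly G H w (\<lambda>x. f (n \<otimes> x) - f x)" using wpoly_diff[OF wpoly_Suc[OF assms(1)] assms(2)] .
  from wpoly_add[OF this assms(1)] show ?thesis by simp
qed

text \<open>Conjugation moves an element of \<open>lcs G i\<close> by a commutator in
  \<open>lcs G (Suc i)\<close>, and a difference by such a commutator costs one more unit of weight,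
  just what is needed. Plain degree would not drop: on the plane inside the Heisenberg group a
  linear function minus its conjugate can be linear and nonconstant.\<close>

lemma wpoly_conj:
  "s \<in> carrier G \<Longrightarrow> wpoly G H (Suc w) f \<Longrightarrow> wpoly G H w (\<lambda>x. f (s \<otimes> x \<otimes> inv s) - f x)"
proof (induction w arbitrary: f rule: less_induct)
  case (less w)
  note s = \<open>s \<in> carrier G\<close>
  show ?case
  proof (cases w)
    case 0
    have "f (s \<otimes> x \<otimes> inv s) = f x" if x: "x \<in> H" for x
    proof -
      have "s \<otimes> x \<otimes> inv s \<otimes> inv x \<in> H"
        using x s by (intro subgroup.m_closed[OF is_subgroup] inv_op_closed2 subgroup.m_inv_closed[OF is_subgroup])
      then have "f (s \<otimes> x \<otimes> inv s \<otimes> inv x \<otimes> x) = f x"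
        using wpoly_diff[of 0 f "s \<otimes> x \<otimes> inv s \<otimes> inv x"] less.prems(2) 0 x by auto
      then show ?thesis using x s by (simp add: m_assoc)
    qed
    then show ?thesis using 0 by simp
  next
    case (Suc v)
    have "wpoly G H (v - i) (\<lambda>x. (f (s \<otimes> (n \<otimes> x) \<otimes> inv s) - f (n \<otimes> x)) - (f (s \<otimes> x \<otimes> inv s) - f x))"
      if n: "n \<in> H \<inter> lcs G i" for n i
    proof -
      interpret L: normal "lcs G i" G by (rule lcs_normal)
      define n2 where "n2 = s \<otimes> n \<otimes> inv s"
      define n' where "n' = n2 \<otimes> inv n"
      have nc: "n \<in> carrier G" using n by auto
      have n2: "n2 \<in> H \<inter> lcs G i"
        using n s inv_op_closed2 L.inv_op_closed2 by (simp add: n2_def)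
      have "inv (gcomm n s) \<in> lcs G (Suc i)"
        using n s by (intro subgroup.m_inv_closed[OF lcs_subgroup] gcomm_lcs) auto
      then have "n' \<in> lcs G (Suc i)"
        using nc s by (simp add: n'_def n2_def m_assoc inv_mult_group)
      moreover have "n' \<in> H"
        using n n2 by (auto simp: n'_def intro!: subgroup.m_closed[OF is_subgroup])
      ultimately have "wpoly G H (w - Suc i) (\<lambda>x. f (n' \<otimes> x) - f x)"
        using less.prems(2) by (auto simp: wpoly.simps(2))
      then have "wpoly G H (v - i) (\<lambda>x. f (n' \<otimes> (n \<otimes> x)) - f (n \<otimes> x))"
        using wpoly_translate[of "w - Suc i" "\<lambda>x. f (n' \<otimes> x) - f x" n] n Suc by simp
      moreover have "n' \<otimes> (n \<otimes> x) = n2 \<otimes> x" if "x \<in> H" for x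
        using that nc n2 by (simp add: n'_def m_assoc)
      ultimately have b: "wpoly G H (v - i) (\<lambda>x. f (n2 \<otimes> x) - f (n \<otimes> x))"
        using wpoly_cong[of "\<lambda>x. f (n' \<otimes> (n \<otimes> x)) - f (n \<otimes> x)" "\<lambda>x. f (n2 \<otimes> x) - f (n \<otimes> x)"] by simp
      \<comment> \<open>The \<open>n\<close>-difference is the sum of two parts: the conjugation
        difference of \<open>g\<close>, handled by induction, and the gap between translating
        \<open>f\<close> by \<open>n2\<close> and by \<open>n\<close>, which is an
        \<open>n'\<close>-difference.\<close>
      define g where "g x = f (n2 \<otimes> x) - f x" for x
      have g: "wpoly G H (w - i) g"
        using less.prems(2) n2 by (auto simp: wpoly.simps(2) g_def[abs_def])
      have a: "wpoly G H (v - i) (\<lambda>x. g (s \<otimes> x \<otimes> inv s) - g x)"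
      proof (cases "i \<le> v")
        case True
        then show ?thesis using less.IH[OF _ s, of "v - i" g] g Suc by (simp add: Suc_diff_le)
      next
        case False
        then show ?thesis using g Suc s inv_op_closed2 by simp
      qed
      have "f (s \<otimes> (n \<otimes> x) \<otimes> inv s) = f (n2 \<otimes> (s \<otimes> x \<otimes> inv s))" if "x \<in> H" for x
        using that nc s by (simp add: n2_def m_assoc)
      then show ?thesis
        using wpoly_add[OF a b] by (subst wpoly_cong[where g = "\<lambda>x. (g (s \<otimes> x \<otimes> inv s) - g x) + (f (n2 \<otimes> x) - f (n \<otimes> x))"])
          (auto simp: g_def)
    qed
    then show ?thesis unfolding Suc wpoly.simps(2) by blast
  qed
qed

text \<open>A nontrivial element lies in no \<open>lcs G i\<close> with \<open>i \<ge> c\<close>, so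
  each difference costs at most \<open>c\<close> units of weight.\<close>

lemma gpoly_imp_wpoly:
  assumes c: "lcs G c = {\<one>}" "0 < c"
  shows "gpoly (G\<lparr>carrier := H\<rparr>) d f \<Longrightarrow> wpoly G H (d * c) f"
proof (induction d arbitrary: f)
  case (Suc d)
  \<comment> \<open>The predecessor of \<open>Suc d * c\<close>, because \<open>wpoly\<close>
    recurses on a successor; \<open>e - i\<close> is at least \<open>d * c\<close> as long as
    \<open>i < c\<close>.\<close>
  define e where "e = d * c + c - 1"
  have e: "Suc d * c = Suc e" using c by (simp add: e_def)
  have "wpoly G H (e - i) (\<lambda>x. f (n \<otimes> x) - f x)" if n: "n \<in> H \<inter> lcs G i" for n i
  proof (cases "i < c")
    case True
    have "wpoly G H (d * c) (\<lambda>x. f (n \<otimes> x) - f x)" using Suc n by auto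
    then show ?thesis by (rule wpoly_mono) (use True in \<open>simp add: e_def\<close>)
  next
    case False
    then have "n = \<one>" using lcs_antimono[of c i] c n by auto
    then show ?thesis by (intro wpoly_zero) simp
  qed
  then show ?case unfolding e wpoly.simps(2) by blast
qed simp

lemma int_pow_not_mem:
  assumes t: "t \<in> carrier G" and inf: "\<And>m::nat. 0 < m \<Longrightarrow> t [^] m \<notin> H" and k: "t [^] (k::int) \<in> H"
  shows "k = 0"
proof (rule ccontr)
  assume "k \<noteq> 0"
  have "t [^] \<bar>k\<bar> \<in> H"
    using k subgroup.m_inv_closed[OF is_subgroup k] t by (cases "0 \<le> k") (auto simp: int_pow_neg)
  then have "t [^] nat \<bar>k\<bar> \<in> H" by (simp flip: int_pow_int)
  then show False using inf[of "nat \<bar>k\<bar>"] \<open>k \<noteq> 0\<close> by simp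
qed

text \<open>Write \<open>x = h t^k\<close>, uniquely. The exponent separates elements outside
  \<open>H\<close>. On the \<open>H\<close>-part, left multiplication acts as a conjugation followed
  by a translation, so weighted polynomials on \<open>H\<close> pull back to polynomials on
  \<open>G\<close> and separate the elements of \<open>H\<close>.\<close>

lemma separates_infinite_cyclic_extension:
  assumes nil: "nilpotent_group G" and t: "t \<in> carrier G"
    and carr: "carrier G = cyclic_extension G H t"
    and inf: "\<And>m::nat. 0 < m \<Longrightarrow> t [^] m \<notin> H"
    and sep: "gpoly_separates (G\<lparr>carrier := H\<rparr>) d"
  shows "\<exists>e. gpoly_separates G e"
proof -
  obtain c0 where "lcs G c0 = {\<one>}" using nil by (auto simp: nilpotent_group_def)
  \<comment> \<open>A positive length is required by \<open>gpoly_imp_wpoly\<close>.\<close>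
  then have c: "lcs G (Suc c0) = {\<one>}"
    using lcs_Suc_subset[of c0] subgroup.one_closed[OF lcs_subgroup[of "Suc c0"]] by blast
  have uniq: "h = h' \<and> k = k'"
    if "h \<in> H" "h' \<in> H" "h \<otimes> t [^] (k::int) = h' \<otimes> t [^] (k'::int)" for h h' k k'
  proof -
    have "inv h' \<otimes> h \<otimes> t [^] k \<otimes> inv (t [^] k') = inv h' \<otimes> (h \<otimes> t [^] k) \<otimes> inv (t [^] k')"
      using that t by (simp add: m_assoc)
    also have "\<dots> = \<one>" unfolding that(3) using that(1,2) t by (simp add: m_assoc)
    finally have "inv h' \<otimes> h \<otimes> t [^] (k - k') = \<one>"
      using that(1,2) t by (simp add: int_pow_diff m_assoc)
    then have "t [^] (k - k') = inv (inv h' \<otimes> h)"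
      using that(1,2) t by (metis inv_closed inv_equality int_pow_closed m_closed mem_carrier inv_inv)
    then have "t [^] (k - k') \<in> H"
      using that by (auto intro!: subgroup.m_closed[OF is_subgroup])
    then have "k = k'" using int_pow_not_mem[OF t inf] by fastforce
    then show ?thesis using that t by simp
  qed
  define \<pi> where "\<pi> x = (THE h. h \<in> H \<and> (\<exists>k::int. x = h \<otimes> t [^] k))" for x
  define \<kappa> where "\<kappa> x = (THE k::int. \<exists>h \<in> H. x = h \<otimes> t [^] k)" for x
  have \<pi>: "\<pi> (h \<otimes> t [^] k) = h" and \<kappa>: "\<kappa> (h \<otimes> t [^] k) = k" if "h \<in> H" for h and k :: int
    unfolding \<pi>_def \<kappa>_def by (rule the_equality; use that uniq in blast)+
  have mult: "(h \<otimes> t [^] k) \<otimes> (h' \<otimes> t [^] k') = (h \<otimes> (t [^] k \<otimes> h' \<otimes> inv (t [^] k))) \<otimes> t [^] (k + k')"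
    and memH: "h \<otimes> (t [^] k \<otimes> h' \<otimes> inv (t [^] k)) \<in> H"
    if "h \<in> H" "h' \<in> H" for h h' and k k' :: int
    using that t inv_op_closed2[of "t [^] k" h'] by (auto simp: int_pow_mult m_assoc)
  \<comment> \<open>\<open>wpoly_conj\<close> handles the power of \<open>t\<close> in
    \<open>b\<close>, and \<open>wpoly_diff\<close> its \<open>H\<close>-part; each lowers the
    weight by one.\<close>
  have \<pi>_poly: "wpoly G H w f \<Longrightarrow> gpoly G w (\<lambda>x. f (\<pi> x))" for w f
  proof (induction w arbitrary: f)
    case 0
    then show ?case using \<pi> by (auto simp: carr elim!: cyclic_extensionE)
  next
    case (Suc w)
    have "gpoly G w (\<lambda>x. f (\<pi> (b \<otimes> x)) - f (\<pi> x))" if bG: "b \<in> carrier G" for b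
    proof -
      obtain h k where b: "h \<in> H" "b = h \<otimes> t [^] (k::int)"
        using bG unfolding carr by (rule cyclic_extensionE)
      define s where "s = t [^] k"
      have s: "s \<in> carrier G" using t by (simp add: s_def)
      have "wpoly G H w (\<lambda>y. (f (h \<otimes> (s \<otimes> y \<otimes> inv s)) - f (h \<otimes> y)) + (f (h \<otimes> y) - f y))"
        using wpoly_add[OF wpoly_conj[OF s wpoly_translate[OF Suc.prems b(1)]] wpoly_diff[OF Suc.prems b(1)]] .
      from Suc.IH[OF this] have "gpoly G w (\<lambda>x. f (h \<otimes> (s \<otimes> \<pi> x \<otimes> inv s)) - f (\<pi> x))"
        by simp
      moreover have "\<pi> (b \<otimes> x) = h \<otimes> (s \<otimes> \<pi> x \<otimes> inv s)" if xG: "x \<in> carrier G" for x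
      proof -
        obtain h' k' where "h' \<in> H" "x = h' \<otimes> t [^] (k'::int)"
          using xG unfolding carr by (rule cyclic_extensionE)
        then show ?thesis using b mult \<pi> memH by (simp add: s_def)
      qed
      ultimately show ?thesis
        using gpoly_cong[of "\<lambda>x. f (\<pi> (b \<otimes> x)) - f (\<pi> x)" "\<lambda>x. f (h \<otimes> (s \<otimes> \<pi> x \<otimes> inv s)) - f (\<pi> x)"] by simp
    qed
    then show ?case by simp
  qed
  \<comment> \<open>The exponent is additive, so its first differences are constant: degree
    \<open>1\<close>, level \<open>2\<close>.\<close>
  have \<kappa>_poly: "gpoly G 2 (\<lambda>x. real_of_int (\<kappa> x))"
  proof -
    have "gpoly G 1 (\<lambda>x. real_of_int (\<kappa> (b \<otimes> x)) - real_of_int (\<kappa> x))" if "b \<in> carrier G" for b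
    proof -
      have "real_of_int (\<kappa> (b \<otimes> x)) - real_of_int (\<kappa> x) = real_of_int (\<kappa> b)" if xG: "x \<in> carrier G" for x
      proof -
        obtain h k where "h \<in> H" "b = h \<otimes> t [^] (k::int)"
          using \<open>b \<in> carrier G\<close> unfolding carr by (rule cyclic_extensionE)
        moreover obtain h' k' where "h' \<in> H" "x = h' \<otimes> t [^] (k'::int)"
          using xG unfolding carr by (rule cyclic_extensionE)
        ultimately show ?thesis using mult \<kappa> memH by simp
      qed
      then show ?thesis
        using gpoly_cong[of "\<lambda>x. real_of_int (\<kappa> (b \<otimes> x)) - real_of_int (\<kappa> x)" "\<lambda>x. real_of_int (\<kappa> b)" 1] by simp
    qed
    then show ?thesis by (simp add: numeral_2_eq_2)
  qed
  have one: "\<one> = \<one> \<otimes> t [^] (0::int)" by simp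
  have \<kappa>_one: "\<kappa> \<one> = 0" and \<pi>_one: "\<pi> \<one> = \<one>"
    using \<kappa>[OF subgroup.one_closed[OF is_subgroup], of 0] \<pi>[OF subgroup.one_closed[OF is_subgroup], of 0] by auto
  \<comment> \<open>Level \<open>2\<close> accommodates the exponent; \<open>d * Suc c0\<close> is
    the weight acquired by level \<open>d\<close> polynomials of \<open>H\<close>.\<close>
  have "gpoly_separates G (max 2 (d * Suc c0))"
    unfolding gpoly_separates_def
  proof (intro ballI impI)
    fix x assume x: "x \<in> carrier G" "x \<noteq> \<one>"
    obtain h k where hk: "h \<in> H" "x = h \<otimes> t [^] (k::int)"
      using x(1) unfolding carr by (rule cyclic_extensionE)
    show "\<exists>f. gpoly G (max 2 (d * Suc c0)) f \<and> f x \<noteq> f \<one>"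
    proof (cases "k = 0")
      case False
      then show ?thesis
        using gpoly_mono[OF \<kappa>_poly, of "max 2 (d * Suc c0)"] \<kappa>[OF hk(1), of k] hk(2) \<kappa>_one
        by (intro exI[of _ "\<lambda>x. real_of_int (\<kappa> x)"]) simp
    next
      case True
      then have xh: "x = h" using hk by simp
      then obtain f where f: "gpoly (G\<lparr>carrier := H\<rparr>) d f" "f h \<noteq> f \<one>"
        using sep hk x by (auto simp: gpoly_separates_def)
      have "gpoly G (d * Suc c0) (\<lambda>x. f (\<pi> x))"
        using \<pi>_poly[OF gpoly_imp_wpoly[OF c _ f(1)]] by simp
      then show ?thesis
        using gpoly_mono[of "d * Suc c0" _ "max 2 (d * Suc c0)"] \<pi>[OF hk(1), of 0] hk f(2) \<pi>_one xh
        by (intro exI[of _ "\<lambda>x. f (\<pi> x)"]) auto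
    qed
  qed
  then show ?thesis by blast
qed

end

text \<open>Either no positive power of \<open>t\<close> lies in \<open>H\<close>, and the
  coordinates \<open>h t^k\<close> are unique, or some power does, and then every element of the
  extension has a power in \<open>H\<close>.\<close>

lemma (in group) cyclic_series_separates:
  assumes nil: "nilpotent_group G" and tf: "torsion_free_group G"
  shows "cyclic_series G K \<Longrightarrow> \<exists>d. gpoly_separates (G\<lparr>carrier := K\<rparr>) d"
proof (induction rule: cyclic_series.induct)
  case trivial
  then show ?case by (simp add: gpoly_separates_def)
next
  case (step H t)
  let ?K = "cyclic_extension G H t"
  let ?GK = "G\<lparr>carrier := ?K\<rparr>"
  interpret H: normal H G by (rule step)
  have K: "subgroup ?K G" using step by (intro H.extend_cyclic_subgroup)
  interpret GK: group ?GK by (rule subgroup_imp_group[OF K])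
  have t: "t \<in> carrier G" using step by simp
  note HK = cyclic_extension_incl(1)[OF H.is_subgroup t] and tK = cyclic_extension_incl(2)[OF H.is_subgroup t]
  interpret HK: normal H ?GK
    by (rule normal_restrict_supergroup[OF K step(2) HK])
  obtain d where d: "gpoly_separates (?GK\<lparr>carrier := H\<rparr>) d" using step by auto
  have nilK: "nilpotent_group ?GK" and tfK: "torsion_free_group ?GK"
    using subgroup_nilpotent[OF nil K] subgroup_torsion_free[OF tf K] .
  show ?case
  proof (cases "\<exists>m>0. t [^] (m::nat) \<in> H")
    case False
    show ?thesis
    proof (rule HK.separates_infinite_cyclic_extension[OF nilK _ _ _ d, of t])
      show "t \<in> carrier ?GK" using tK by simp
      show "carrier ?GK = cyclic_extension ?GK H t"
      proof -
        define L where "L = ?GK"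
        have "t [^]\<^bsub>L\<^esub> k = t [^] k" for k :: int
          unfolding L_def by (rule int_pow_consistent[OF K tK, symmetric])
        moreover have "mult L = mult G" "carrier L = ?K" by (simp_all add: L_def)
        ultimately have "carrier L = cyclic_extension L H t" by (simp add: cyclic_extension_def)
        then show ?thesis by (simp only: L_def)
      qed
      show "t [^]\<^bsub>?GK\<^esub> (m::nat) \<notin> H" if "0 < m" for m
        using False that unfolding nat_pow_consistent[symmetric] by blast
    qed
  next
    case True
    then obtain m where m: "0 < m" "t [^] (m::nat) \<in> H" by blast
    \<comment> \<open>Modulo \<open>H\<close> the element \<open>x\<close> is a power of
      \<open>t\<close>, and \<open>t^m\<close> is trivial there.\<close>
    have "x [^] m \<in> H" if xK: "x \<in> ?K" for x
    proof -
      interpret q: group_hom G "G Mod H" "\<lambda>x. H #> x" by (rule H.group_hom_Mod)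
      obtain h k where x: "h \<in> H" "x = h \<otimes> t [^] (k::int)" using xK by (rule cyclic_extensionE)
      have tm: "H #> t [^] int m = \<one>\<^bsub>G Mod H\<^esub>"
        using m t by (simp add: int_pow_int coset_join2 H.is_subgroup)
      have "H #> x = H #> (t [^] k)" using x t by (simp add: H.rcos_eq_iff m_assoc del: q.hom_mult)
      then have "H #> x [^] int m = H #> (t [^] k) [^] int m"
        using x t by (simp only: q.hom_int_pow m_closed int_pow_closed H.mem_carrier)
      also have "\<dots> = H #> (t [^] int m) [^] k" using t by (simp add: int_pow_pow mult.commute)
      also have "\<dots> = \<one>\<^bsub>G Mod H\<^esub>"
        using t by (simp only: q.hom_int_pow[of "t [^] int m"] int_pow_closed tm q.H.int_pow_one)
      finally have "H #> x [^] m = H" by (simp add: int_pow_int)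
      then show ?thesis using coset_join1[OF _ _ H.is_subgroup, of "x [^] m"] x t H.subset by simp
    qed
    then have "\<exists>m>0. x [^]\<^bsub>?GK\<^esub> (m::nat) \<in> H" if "x \<in> carrier ?GK" for x
      using that m(1) by (intro exI[of _ m]) (simp flip: nat_pow_consistent)
    then show ?thesis
      using GK.separates_finite_extension[OF nilK tfK HK.is_subgroup _ d] by blast
  qed
qed

theorem malcev_embedding:
  assumes "finitely_generated_group G" "nilpotent_group G" "torsion_free_group G"
  obtains U :: "(('a \<Rightarrow> real) \<Rightarrow> 'a \<Rightarrow> real) monoid" and \<psi>
  where "nilpotent_group U" "torsion_free_group U" "divisible_group U"
    "\<psi> \<in> hom (G :: ('a, 'm) monoid_scheme) U" "inj_on \<psi> (carrier G)"
proof -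
  interpret group G using assms(2) by (simp add: nilpotent_group_def)
  obtain d where "gpoly_separates (G\<lparr>carrier := carrier G\<rparr>) d"
    using cyclic_series_separates[OF assms(2,3)] nilpotent_fg_cyclic_series[OF assms(2,1)] by blast
  then have "gpoly_separates G d" by (simp add: gpoly_separates_def) 
  then show thesis using separates_imp_embedding that by blast
qed

section \<open>Kernels acting freely\<close>

lemma action_hom_BijGroup:
  assumes "group H"
    and closed: "\<And>g w. g \<in> carrier H \<Longrightarrow> w \<in> \<Omega> \<Longrightarrow> a g w \<in> \<Omega>"
    and one: "\<And>w. w \<in> \<Omega> \<Longrightarrow> a \<one>\<^bsub>H\<^esub> w = w"
    and mult: "\<And>g h w. g \<in> carrier H \<Longrightarrow> h \<in> carrier H \<Longrightarrow> w \<in> \<Omega> \<Longrightarrow> a (g \<otimes>\<^bsub>H\<^esub> h) w = a g (a h w)"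
  shows "(\<lambda>g. restrict (a g) \<Omega>) \<in> hom H (BijGroup \<Omega>)"
proof -
  interpret H: group H by fact
  have bij: "restrict (a g) \<Omega> \<in> Bij \<Omega>" if g: "g \<in> carrier H" for g
  proof -
    have "a (inv\<^bsub>H\<^esub> g) (a g w) = w" "a g (a (inv\<^bsub>H\<^esub> g) w) = w" if "w \<in> \<Omega>" for w
      using mult[of "inv\<^bsub>H\<^esub> g" g w] mult[of g "inv\<^bsub>H\<^esub> g" w] one that g by simp_all
    then have "bij_betw (a g) \<Omega> \<Omega>"
      using closed g by (intro bij_betw_byWitness[of \<Omega> "a (inv\<^bsub>H\<^esub> g)"]) auto
    then show ?thesis by (simp add: Bij_def cong: bij_betw_cong)
  qed
  show ?thesis
  proof (rule homI)
    show "restrict (a g) \<Omega> \<in> carrier (BijGroup \<Omega>)" if "g \<in> carrier H" for g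
      using bij[OF that] by (simp add: BijGroup_def)
    show "restrict (a (g \<otimes>\<^bsub>H\<^esub> h)) \<Omega> = restrict (a g) \<Omega> \<otimes>\<^bsub>BijGroup \<Omega>\<^esub> restrict (a h) \<Omega>"
      if "g \<in> carrier H" "h \<in> carrier H" for g h
      using bij that mult closed by (auto simp: BijGroup_def compose_def fun_eq_iff)
  qed
qed

text \<open>\<open>G\<close> is the amalgam of \<open>P True\<close> and \<open>P False\<close> over \<open>D\<close>, all of them subgroups of \<open>Q\<close> lifted to \<open>G\<close>
  by \<open>l\<close>. The kernel of \<open>p\<close> is the fundamental group of the graph with vertices the cosets
  \<open>P s #> q\<close> and edges the cosets \<open>D #> q\<close>.\<close>

locale amalgam_over =
  G: group G + Q: group Q + p: group_hom G Q p
  for G :: "('g, 'm) monoid_scheme" and Q :: "('g, 'n) monoid_scheme" and p :: "'g \<Rightarrow> 'g" +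
  fixes P :: "bool \<Rightarrow> 'g set" and l :: "bool \<Rightarrow> 'g \<Rightarrow> 'g" and D :: "'g set"
  assumes p_surj: "p ` carrier G = carrier Q"
    and P_subgroup: "subgroup (P s) Q"
    and l_hom: "l s \<in> hom (Q\<lparr>carrier := P s\<rparr>) G"
    and p_l: "y \<in> P s \<Longrightarrow> p (l s y) = y"
    and D_subgroup: "subgroup D Q"
    and D_P: "D \<subseteq> P s"
    and l_agree: "c \<in> D \<Longrightarrow> l True c = l False c"
    and gen_induct: "\<And>R g. \<lbrakk>g \<in> carrier G; R \<one>\<^bsub>G\<^esub>;
        \<And>s y g. \<lbrakk>y \<in> P s; g \<in> carrier G; R g\<rbrakk> \<Longrightarrow> R (l s y \<otimes>\<^bsub>G\<^esub> g)\<rbrakk> \<Longrightarrow> R g"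
    and universal: "\<And>(H :: ('g \<times> ('g \<times> bool) list set \<Rightarrow> 'g \<times> ('g \<times> bool) list set) monoid) f.
        \<lbrakk>group H; \<And>s. f s \<in> hom (Q\<lparr>carrier := P s\<rparr>) H; \<And>c. c \<in> D \<Longrightarrow> f True c = f False c\<rbrakk> \<Longrightarrow>
        \<exists>h \<in> hom G H. \<forall>s. \<forall>y \<in> P s. h (l s y) = f s y"
begin

abbreviation G_mult (infixl \<open>\<cdot>\<close> 70) where "x \<cdot> y \<equiv> x \<otimes>\<^bsub>G\<^esub> y"
abbreviation Q_mult (infixl \<open>\<star>\<close> 70) where "x \<star> y \<equiv> x \<otimes>\<^bsub>Q\<^esub> y"

section \<open>The graph of cosets, its distances and a spanning tree\<close>

lemma P_carrier: "y \<in> P s \<Longrightarrow> y \<in> carrier Q"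
  using subgroup.mem_carrier[OF P_subgroup] .

lemma D_carrier: "y \<in> D \<Longrightarrow> y \<in> carrier Q"
  using subgroup.mem_carrier[OF D_subgroup] .

lemma P_mult: "y \<in> P s \<Longrightarrow> z \<in> P s \<Longrightarrow> y \<star> z \<in> P s"
  and P_inv: "y \<in> P s \<Longrightarrow> inv\<^bsub>Q\<^esub> y \<in> P s"
  and P_one: "\<one>\<^bsub>Q\<^esub> \<in> P s"
  using subgroup.m_closed[OF P_subgroup] subgroup.m_inv_closed[OF P_subgroup]
    subgroup.one_closed[OF P_subgroup] by blast+

lemma l_closed: "y \<in> P s \<Longrightarrow> l s y \<in> carrier G"
  using hom_in_carrier[OF l_hom[of s]] by simp

lemma l_mult: "y \<in> P s \<Longrightarrow> z \<in> P s \<Longrightarrow> l s (y \<star> z) = l s y \<cdot> l s z"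
  using hom_mult[OF l_hom[of s], of y z] by simp

lemma l_one: "l s \<one>\<^bsub>Q\<^esub> = \<one>\<^bsub>G\<^esub>"
  using hom_one[OF l_hom[of s]] Q.subgroup_imp_group[OF P_subgroup] G.is_group by simp

text \<open>\<open>q \<in> reach n s\<close> means that the vertex \<open>P s #> q\<close> is within
  distance \<open>n\<close> of the root \<open>P True\<close>. The edge \<open>D #> r\<close> joins
  \<open>P True #> r\<close> to \<open>P False #> r\<close>, so a step changes the representative
  within a coset and then the type.\<close>

primrec reach :: "nat \<Rightarrow> bool \<Rightarrow> 'g set" where
  "reach 0 s = (if s then P True else {})"
| "reach (Suc n) s = reach n s \<union> {y \<star> q | y q. y \<in> P s \<and> q \<in> reach n (\<not> s)}"

declare reach.simps(2) [simp del]

lemma reach_SucI: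
  "q \<in> reach n s \<Longrightarrow> q \<in> reach (Suc n) s"
  "y \<in> P s \<Longrightarrow> q \<in> reach n (\<not> s) \<Longrightarrow> y \<star> q \<in> reach (Suc n) s"
  by (auto simp: reach.simps(2))

lemma reach_SucE:
  assumes "q \<in> reach (Suc n) s" "q \<notin> reach n s"
  obtains y r where "q = y \<star> r" "y \<in> P s" "r \<in> reach n (\<not> s)"
  using assms by (auto simp: reach.simps(2))

lemma reach_carrier: "q \<in> reach n s \<Longrightarrow> q \<in> carrier Q"
  by (induction n arbitrary: q s) (auto simp: reach.simps(2) split: if_splits intro: P_carrier)

lemma reach_mult: "y \<in> P s \<Longrightarrow> q \<in> reach n s \<Longrightarrow> y \<star> q \<in> reach n s"
proof (induction n arbitrary: q)
  case 0
  then show ?case by (auto split: if_splits intro: P_mult)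
next
  case (Suc n)
  show ?case
  proof (cases "q \<in> reach n s")
    case True
    then show ?thesis using Suc reach_SucI(1) by simp
  next
    case False
    then obtain z r where zr: "q = z \<star> r" "z \<in> P s" "r \<in> reach n (\<not> s)"
      using Suc.prems reach_SucE by blast
    then have "y \<star> q = (y \<star> z) \<star> r"
      using Suc.prems P_carrier reach_carrier by (simp add: Q.m_assoc)
    then show ?thesis using reach_SucI(2)[OF P_mult[OF Suc.prems(1) zr(2)] zr(3)] by simp
  qed
qed

text \<open>If one endpoint of the edge \<open>D #> q\<close> is reached, the other is too, one step
  later.\<close>

lemma reach_both:
  assumes "q \<in> reach n s"
  shows "\<exists>n. q \<in> reach n s' \<and> q \<in> reach n (\<not> s')"
proof -
  have "q = \<one>\<^bsub>Q\<^esub> \<star> q" using reach_carrier[OF assms] by simp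
  then have "q \<in> reach (Suc n) (\<not> s)" using reach_SucI(2)[OF P_one, of q n "\<not> s"] assms by simp
  moreover have "q \<in> reach (Suc n) s" using assms by (rule reach_SucI)
  ultimately show ?thesis by (cases "s' = s") auto
qed

text \<open>Connectedness of the graph: the two factors generate. Both types are carried through the
  induction because the next letter may come from either factor.\<close>

lemma reach_ex:
  assumes "q \<in> carrier Q"
  shows "\<exists>n. q \<in> reach n s"
proof -
  obtain g where g: "g \<in> carrier G" "q = p g" using assms p_surj by blast
  have "\<exists>n. p g \<in> reach n s \<and> p g \<in> reach n (\<not> s)"
    using g(1)
  proof (rule gen_induct)
    have "p \<one>\<^bsub>G\<^esub> \<in> reach 0 True" using P_one by simp
    then show "\<exists>n. p \<one>\<^bsub>G\<^esub> \<in> reach n s \<and> p \<one>\<^bsub>G\<^esub> \<in> reach n (\<not> s)" by (rule reach_both)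
  next
    fix s' y g assume *: "y \<in> P s'" "g \<in> carrier G" "\<exists>n. p g \<in> reach n s \<and> p g \<in> reach n (\<not> s)"
    then obtain n where n: "p g \<in> reach n s'" by (cases "s' = s") auto
    have pg: "p (l s' y \<cdot> g) = y \<star> p g" using * l_closed p_l by simp
    have "p (l s' y \<cdot> g) \<in> reach n s'" unfolding pg using *(1) n by (rule reach_mult)
    then show "\<exists>n. p (l s' y \<cdot> g) \<in> reach n s \<and> p (l s' y \<cdot> g) \<in> reach n (\<not> s)"
      by (rule reach_both)
  qed
  then show ?thesis using g by blast
qed

definition dist :: "bool \<Rightarrow> 'g \<Rightarrow> nat" where
  "dist s q = (LEAST n. q \<in> reach n s)"

text \<open>The edge through \<open>parent s q\<close> leads from the vertex \<open>P s #> q\<close>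
  to one nearer the root. The choice depends on the coset of \<open>q\<close> alone, which gives
  \<open>parent_mult\<close>.\<close>

definition parent :: "bool \<Rightarrow> 'g \<Rightarrow> 'g" where
  "parent s q = (SOME r. r \<in> P s #>\<^bsub>Q\<^esub> q \<and> dist (\<not> s) r < dist s q)"

lemma dist_reach: "q \<in> carrier Q \<Longrightarrow> q \<in> reach (dist s q) s"
  unfolding dist_def using reach_ex LeastI_ex by metis

lemma dist_le: "q \<in> reach n s \<Longrightarrow> dist s q \<le> n"
  unfolding dist_def by (rule Least_le)

lemma dist_mult:
  assumes "y \<in> P s" "q \<in> carrier Q"
  shows "dist s (y \<star> q) = dist s q"
proof -
  have "y \<star> q \<in> reach n s \<longleftrightarrow> q \<in> reach n s" for n
    using reach_mult[OF assms(1)] reach_mult[OF P_inv[OF assms(1)], of "y \<star> q"] assms P_carrier by auto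
  then show ?thesis by (simp add: dist_def)
qed

lemma coset_mult: "subgroup S Q \<Longrightarrow> y \<in> S \<Longrightarrow> q \<in> carrier Q \<Longrightarrow> S #>\<^bsub>Q\<^esub> (y \<star> q) = S #>\<^bsub>Q\<^esub> q"
  by (metis Q.coset_join2 Q.coset_mult_assoc subgroup.mem_carrier subgroup.subset)

lemma parent_mult:
  assumes "y \<in> P s" "q \<in> carrier Q"
  shows "parent s (y \<star> q) = parent s q"
  using dist_mult[OF assms] coset_mult[OF P_subgroup assms] by (simp add: parent_def)

lemma parent_props:
  assumes q: "q \<in> carrier Q" and d: "0 < dist s q"
  shows "parent s q \<in> P s #>\<^bsub>Q\<^esub> q" "dist (\<not> s) (parent s q) < dist s q"
proof -
  obtain n where n: "dist s q = Suc n" using d by (cases "dist s q") auto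
  then have "q \<in> reach (Suc n) s" "q \<notin> reach n s"
    using dist_reach[OF q, of s] dist_le[of q n s] by auto
  then obtain y r where yr: "q = y \<star> r" "y \<in> P s" "r \<in> reach n (\<not> s)"
    using reach_SucE by blast
  then have "r = inv\<^bsub>Q\<^esub> y \<star> q" using P_carrier reach_carrier by simp
  then have "r \<in> P s #>\<^bsub>Q\<^esub> q" using P_inv[OF yr(2)] by (auto simp: r_coset_def)
  moreover have "dist (\<not> s) r < dist s q" using dist_le[OF yr(3)] n by simp
  ultimately have "parent s q \<in> P s #>\<^bsub>Q\<^esub> q \<and> dist (\<not> s) (parent s q) < dist s q"
    unfolding parent_def by (intro someI[where P = "\<lambda>r. r \<in> P s #>\<^bsub>Q\<^esub> q \<and> dist (\<not> s) r < dist s q"]) simp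
  then show "parent s q \<in> P s #>\<^bsub>Q\<^esub> q" "dist (\<not> s) (parent s q) < dist s q" by auto
qed

lemma parentE:
  assumes "q \<in> carrier Q" "0 < dist s q"
  obtains y where "y \<in> P s" "q = y \<star> parent s q" "parent s q \<in> carrier Q"
    "y = q \<star> inv\<^bsub>Q\<^esub> (parent s q)"
proof -
  obtain z where z: "z \<in> P s" "parent s q = z \<star> q"
    using parent_props(1)[OF assms] by (auto simp: r_coset_def)
  show thesis
  proof
    show "inv\<^bsub>Q\<^esub> z \<in> P s" using z P_inv by simp
    show "q = inv\<^bsub>Q\<^esub> z \<star> parent s q" "parent s q \<in> carrier Q"
      "inv\<^bsub>Q\<^esub> z = q \<star> inv\<^bsub>Q\<^esub> (parent s q)"
      using z P_carrier assms by (simp_all add: Q.word_simps)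
  qed
qed

lemma dist_zero: "q \<in> carrier Q \<Longrightarrow> dist s q = 0 \<Longrightarrow> s \<and> q \<in> P True"
  using dist_reach[of q s] by (auto split: if_splits)

lemma dist_root: "q \<in> P True \<Longrightarrow> dist True q = 0"
  using dist_le[of q 0 True] by simp

text \<open>Lifts of the elements of \<open>Q\<close> along the spanning tree of parent edges.\<close>

function lift :: "bool \<Rightarrow> 'g \<Rightarrow> 'g" where
  "lift s q = (if dist (\<not> s) (parent s q) < dist s q
     then l s (q \<star> inv\<^bsub>Q\<^esub> (parent s q)) \<cdot> lift (\<not> s) (parent s q) else l True q)"
  by auto
termination by (relation "measure (\<lambda>(s, q). dist s q)") auto

declare lift.simps [simp del]

lemma lift_root: "q \<in> P True \<Longrightarrow> lift True q = l True q"
  using dist_root by (simp add: lift.simps)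

text \<open>The guard in \<open>lift\<close> secures termination for arbitrary arguments; by
  \<open>parent_props\<close> it holds away from the root.\<close>

lemma lift_step:
  assumes "q \<in> carrier Q" "0 < dist s q"
  shows "lift s q = l s (q \<star> inv\<^bsub>Q\<^esub> (parent s q)) \<cdot> lift (\<not> s) (parent s q)"
  using parent_props[OF assms] by (subst lift.simps) simp

lemma lift_induct [consumes 1, case_names root step]:
  assumes "q \<in> carrier Q"
    and root: "\<And>q. q \<in> P True \<Longrightarrow> R True q"
    and step: "\<And>s y q. \<lbrakk>q \<in> carrier Q; y \<in> P s; y \<star> parent s q = q; parent s q \<in> carrier Q; 0 < dist s q;
      R (\<not> s) (parent s q); lift s q = l s y \<cdot> lift (\<not> s) (parent s q)\<rbrakk> \<Longrightarrow> R s q"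
  shows "R s q"
  using assms(1)
proof (induction "dist s q" arbitrary: s q rule: less_induct)
  case less
  show ?case
  proof (cases "dist s q = 0")
    case True
    then show ?thesis using dist_zero[OF less.prems] root by metis
  next
    case False
    then obtain y where y: "y \<in> P s" "q = y \<star> parent s q" "parent s q \<in> carrier Q"
      "y = q \<star> inv\<^bsub>Q\<^esub> (parent s q)" using parentE less.prems by blast
    show ?thesis
    proof (rule step[OF less.prems y(1) y(2)[symmetric] y(3)])
      show "R (\<not> s) (parent s q)" using less.hyps parent_props[OF less.prems] False y(3) by blast
      show "lift s q = l s y \<cdot> lift (\<not> s) (parent s q)"
        unfolding y(4) using lift_step[OF less.prems] False by blast
    qed (use False in simp)
  qed
qed

lemma lift_props: "q \<in> carrier Q \<Longrightarrow> lift s q \<in> carrier G \<and> p (lift s q) = q"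
proof (induction s q rule: lift_induct)
  case (root q)
  then show ?case by (simp add: lift_root l_closed p_l)
next
  case (step s y q)
  then show ?case by (simp add: l_closed p_l)
qed

text \<open>All representatives of a vertex share one parent, so their lifts differ only in the
  first letter, where \<open>l s\<close> is multiplicative.\<close>

lemma lift_mult:
  assumes y: "y \<in> P s" and q: "q \<in> carrier Q"
  shows "lift s (y \<star> q) = l s y \<cdot> lift s q"
proof (cases "dist s q = 0")
  case True
  then have "s" "q \<in> P True" using dist_zero[OF q] by auto
  then show ?thesis using y P_mult by (simp add: lift_root l_mult)
next
  case False
  obtain z where z: "z \<in> P s" "q = z \<star> parent s q" "parent s q \<in> carrier Q"
      "z = q \<star> inv\<^bsub>Q\<^esub> (parent s q)" using parentE[OF q] False by blast
  have yq: "y \<star> q \<in> carrier Q" "0 < dist s (y \<star> q)" using False y q dist_mult P_carrier by auto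
  have "y \<star> q \<star> inv\<^bsub>Q\<^esub> (parent s q) = y \<star> z"
    using y q z(3) P_carrier by (simp add: z(4) Q.m_assoc)
  then have "lift s (y \<star> q) = l s (y \<star> z) \<cdot> lift (\<not> s) (parent s q)"
    using lift_step[OF yq] parent_mult[OF y q] by simp
  also have "\<dots> = l s y \<cdot> (l s z \<cdot> lift (\<not> s) (parent s q))"
    using y z lift_props by (simp add: l_mult l_closed G.m_assoc)
  also have "l s z \<cdot> lift (\<not> s) (parent s q) = lift s q"
    using lift_step[OF q] False z(4) by simp
  finally show ?thesis .
qed

text \<open>The lifts to the two ends of a tree edge coincide; this is why tree edges give trivial
  loops.\<close>

lemma lift_parent:
  assumes q: "q \<in> carrier Q" and d: "0 < dist s q"
  shows "lift s (parent s q) = lift (\<not> s) (parent s q)"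
proof -
  obtain z where z: "z \<in> P s" "q = z \<star> parent s q" "parent s q \<in> carrier Q"
      "z = q \<star> inv\<^bsub>Q\<^esub> (parent s q)" using parentE[OF q d] by blast
  have "l s z \<cdot> lift s (parent s q) = lift s q" using lift_mult[OF z(1,3)] z(2) by simp
  also have "\<dots> = l s z \<cdot> lift (\<not> s) (parent s q)" using lift_step[OF q d] z(4) by simp
  finally show ?thesis using z lift_props l_closed by simp
qed

section \<open>Edges outside the tree and the free group on them\<close>

definition edge :: "'g \<Rightarrow> 'g" where
  "edge q = (SOME r. r \<in> D #>\<^bsub>Q\<^esub> q)"

definition tree :: "'g \<Rightarrow> bool" where
  "tree q \<longleftrightarrow> (\<exists>s r. r \<in> carrier Q \<and> 0 < dist s r \<and> D #>\<^bsub>Q\<^esub> q = D #>\<^bsub>Q\<^esub> parent s r)"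

definition X :: "'g set" where
  "X = edge ` {q \<in> carrier Q. \<not> tree q}"

abbreviation "F \<equiv> free_group_on X"
abbreviation F_mult (infixl \<open>\<bullet>\<close> 70) where "x \<bullet> y \<equiv> x \<otimes>\<^bsub>F\<^esub> y"

text \<open>Contracts the spanning tree: its edges become trivial, the remaining ones are free
  generators.\<close>

definition xgen :: "'g \<Rightarrow> ('g \<times> bool) list set" where
  "xgen q = (if tree q then \<one>\<^bsub>F\<^esub> else free_gen X (edge q))"

sublocale F: group F by (rule group_free_group_on)

lemma edge_mem: "q \<in> carrier Q \<Longrightarrow> edge q \<in> D #>\<^bsub>Q\<^esub> q"
  unfolding edge_def using Q.rcos_self[OF _ D_subgroup] by (rule someI)

lemma edge_eq: "q \<in> carrier Q \<Longrightarrow> \<exists>c \<in> D. edge q = c \<star> q"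
  using edge_mem by (auto simp: r_coset_def)

lemma edge_mult: "c \<in> D \<Longrightarrow> q \<in> carrier Q \<Longrightarrow> edge (c \<star> q) = edge q"
  using coset_mult[OF D_subgroup] by (simp add: edge_def)

lemma tree_mult: "c \<in> D \<Longrightarrow> q \<in> carrier Q \<Longrightarrow> tree (c \<star> q) = tree q"
  using coset_mult[OF D_subgroup] by (simp add: tree_def)

lemma xgen_mult: "c \<in> D \<Longrightarrow> q \<in> carrier Q \<Longrightarrow> xgen (c \<star> q) = xgen q"
  by (simp add: xgen_def edge_mult tree_mult)

lemma xgen_closed: "q \<in> carrier Q \<Longrightarrow> xgen q \<in> carrier F"
  using free_gen_closed[of "edge q" X] by (auto simp: xgen_def) (auto simp: X_def)

lemma xgen_parent: "q \<in> carrier Q \<Longrightarrow> 0 < dist s q \<Longrightarrow> xgen (parent s q) = \<one>\<^bsub>F\<^esub>"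
proof -
  assume "q \<in> carrier Q" "0 < dist s q"
  then have "tree (parent s q)" unfolding tree_def by blast
  then show ?thesis by (simp add: xgen_def)
qed

lemma X_props:
  assumes "x \<in> X"
  shows "x \<in> carrier Q" "xgen x = free_gen X x"
proof -
  obtain q where q: "q \<in> carrier Q" "\<not> tree q" "x = edge q" using assms by (auto simp: X_def)
  then obtain c where c: "c \<in> D" "x = c \<star> q" using edge_eq by blast
  then show "x \<in> carrier Q" using D_carrier q by simp
  have "xgen x = xgen q" using c q xgen_mult by simp
  then show "xgen x = free_gen X x" using q by (simp add: xgen_def)
qed

text \<open>Dictated by the loops to be recovered: closing up \<open>l s y\<close> with lifts of
  type \<open>True\<close> gives the trivial element on the first factor and
  \<open>inv loop (y \<star> q) \<cdot> loop q\<close> on the second. Both formulas agree on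
  \<open>D\<close>, as \<open>xgen\<close> is constant on its cosets.\<close>

definition \<kappa>0 :: "bool \<Rightarrow> 'g \<Rightarrow> 'g \<Rightarrow> ('g \<times> bool) list set" where
  "\<kappa>0 s y q = (if s then \<one>\<^bsub>F\<^esub> else inv\<^bsub>F\<^esub> xgen (y \<star> q) \<bullet> xgen q)"

lemma \<kappa>0_closed: "y \<in> carrier Q \<Longrightarrow> q \<in> carrier Q \<Longrightarrow> \<kappa>0 s y q \<in> carrier F"
  by (simp add: \<kappa>0_def xgen_closed)

text \<open>A cocycle is an action on \<open>Q \<times> F\<close> covering translation on
  \<open>Q\<close>. In this form, extending it from the factors to \<open>G\<close> is a case of
  \<open>universal\<close>, with a permutation group as target; this fixes the type at which the
  locale assumes that property.\<close>

lemma cocycle_ex: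
  "\<exists>h \<in> hom G (BijGroup (carrier Q \<times> carrier F)). \<forall>s. \<forall>y \<in> P s. \<forall>q \<in> carrier Q. \<forall>f \<in> carrier F.
     h (l s y) (q, f) = (y \<star> q, \<kappa>0 s y q \<bullet> f)"
proof -
  let ?\<Omega> = "carrier Q \<times> carrier F"
  define a where "a s y w = (y \<star> fst w, \<kappa>0 s y (fst w) \<bullet> snd w)" for s y and w :: "'g \<times> ('g \<times> bool) list set"
  have hom: "(\<lambda>y. restrict (a s y) ?\<Omega>) \<in> hom (Q\<lparr>carrier := P s\<rparr>) (BijGroup ?\<Omega>)" for s
  proof (rule action_hom_BijGroup)
    show "group (Q\<lparr>carrier := P s\<rparr>)" by (rule Q.subgroup_imp_group[OF P_subgroup])
    show "a s y w \<in> ?\<Omega>" if "y \<in> carrier (Q\<lparr>carrier := P s\<rparr>)" "w \<in> ?\<Omega>" for y w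
      using that P_carrier by (auto simp: a_def \<kappa>0_closed)
    show "a s \<one>\<^bsub>Q\<lparr>carrier := P s\<rparr>\<^esub> w = w" if "w \<in> ?\<Omega>" for w
      using that by (auto simp: a_def \<kappa>0_def xgen_closed)
    show "a s (y \<otimes>\<^bsub>Q\<lparr>carrier := P s\<rparr>\<^esub> z) w = a s y (a s z w)"
      if "y \<in> carrier (Q\<lparr>carrier := P s\<rparr>)" "z \<in> carrier (Q\<lparr>carrier := P s\<rparr>)" "w \<in> ?\<Omega>" for y z w
      using that P_carrier by (auto simp: a_def \<kappa>0_def xgen_closed Q.m_assoc F.m_assoc)
  qed
  have agree: "restrict (a True c) ?\<Omega> = restrict (a False c) ?\<Omega>" if "c \<in> D" for c
    using that by (auto simp: a_def \<kappa>0_def xgen_mult xgen_closed fun_eq_iff)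
  obtain h where h: "h \<in> hom G (BijGroup ?\<Omega>)"
    "\<And>s y. y \<in> P s \<Longrightarrow> h (l s y) = restrict (a s y) ?\<Omega>"
    using universal[OF group_BijGroup, of "\<lambda>s y. restrict (a s y) ?\<Omega>"] hom agree by blast
  then show ?thesis by (auto simp: a_def intro!: bexI[of _ h])
qed

definition act where
  "act = (SOME h. h \<in> hom G (BijGroup (carrier Q \<times> carrier F)) \<and>
     (\<forall>s. \<forall>y \<in> P s. \<forall>q \<in> carrier Q. \<forall>f \<in> carrier F. h (l s y) (q, f) = (y \<star> q, \<kappa>0 s y q \<bullet> f)))"

lemma act_hom: "act \<in> hom G (BijGroup (carrier Q \<times> carrier F))"
  and act_l: "y \<in> P s \<Longrightarrow> q \<in> carrier Q \<Longrightarrow> f \<in> carrier F \<Longrightarrow>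
    act (l s y) (q, f) = (y \<star> q, \<kappa>0 s y q \<bullet> f)"
  using someI_ex[OF cocycle_ex[unfolded Bex_def]] unfolding act_def[symmetric] by auto

lemma act_mult:
  assumes "g \<in> carrier G" "h \<in> carrier G" "w \<in> carrier Q \<times> carrier F"
  shows "act (g \<cdot> h) w = act g (act h w)"
  using hom_mult[OF act_hom assms(1,2)] hom_in_carrier[OF act_hom assms(1)]
    hom_in_carrier[OF act_hom assms(2)] assms(3)
  by (simp add: BijGroup_def compose_def)

lemma act_one: "w \<in> carrier Q \<times> carrier F \<Longrightarrow> act \<one>\<^bsub>G\<^esub> w = w"
  using hom_one[OF act_hom G.is_group group_BijGroup] by (simp add: BijGroup_def)

definition \<kappa> :: "'g \<Rightarrow> 'g \<Rightarrow> ('g \<times> bool) list set" where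
  "\<kappa> g q = snd (act g (q, \<one>\<^bsub>F\<^esub>))"

text \<open>Acting on the fibre by a left multiplication is true of the letters and survives
  composition; hence \<open>\<kappa>\<close>, read off at the identity of \<open>F\<close>,
  determines the action.\<close>

lemma act_eq:
  assumes "g \<in> carrier G" "q \<in> carrier Q"
  shows "\<kappa> g q \<in> carrier F \<and> (\<forall>f \<in> carrier F. act g (q, f) = (p g \<star> q, \<kappa> g q \<bullet> f))"
proof -
  let ?R = "\<lambda>g q. \<exists>k \<in> carrier F. \<forall>f \<in> carrier F. act g (q, f) = (p g \<star> q, k \<bullet> f)"
  have "\<forall>q \<in> carrier Q. ?R g q"
    using assms(1)
  proof (rule gen_induct)
    show "\<forall>q \<in> carrier Q. ?R \<one>\<^bsub>G\<^esub> q"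
      using act_one by (auto intro!: bexI[of _ "\<one>\<^bsub>F\<^esub>"])
  next
    fix s y g
    assume y: "y \<in> P s" and g: "g \<in> carrier G"
      and IH: "\<forall>q \<in> carrier Q. ?R g q"
    show "\<forall>q \<in> carrier Q. ?R (l s y \<cdot> g) q"
    proof
      fix q assume q: "q \<in> carrier Q"
      then obtain k where k: "k \<in> carrier F" "\<forall>f \<in> carrier F. act g (q, f) = (p g \<star> q, k \<bullet> f)"
        using IH by blast
      show "?R (l s y \<cdot> g) q"
      proof (intro bexI ballI)
        have k0: "\<kappa>0 s y (p g \<star> q) \<in> carrier F"
          using g q P_carrier[OF y] by (intro \<kappa>0_closed) auto
        then show "\<kappa>0 s y (p g \<star> q) \<bullet> k \<in> carrier F" using k by blast
        fix f assume f: "f \<in> carrier F"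
        have "act (l s y \<cdot> g) (q, f) = act (l s y) (act g (q, f))"
          using l_closed[OF y] g q f by (intro act_mult) auto
        also have "\<dots> = (y \<star> (p g \<star> q), \<kappa>0 s y (p g \<star> q) \<bullet> (k \<bullet> f))"
          using k f g q y by (simp add: act_l)
        also have "\<kappa>0 s y (p g \<star> q) \<bullet> (k \<bullet> f) = \<kappa>0 s y (p g \<star> q) \<bullet> k \<bullet> f"
          using k0 k(1) f by (simp add: F.m_assoc)
        also have "y \<star> (p g \<star> q) = p (l s y \<cdot> g) \<star> q"
          using l_closed[OF y] p_l[OF y] P_carrier[OF y] g q by (simp add: Q.m_assoc)
        finally show "act (l s y \<cdot> g) (q, f)
            = (p (l s y \<cdot> g) \<star> q, \<kappa>0 s y (p g \<star> q) \<bullet> k \<bullet> f)" .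
      qed
    qed
  qed
  then obtain k where k: "k \<in> carrier F" "\<forall>f \<in> carrier F. act g (q, f) = (p g \<star> q, k \<bullet> f)"
    using assms(2) by blast
  then have "\<kappa> g q = k" by (simp add: \<kappa>_def)
  then show ?thesis using k by simp
qed

lemma \<kappa>_closed: "g \<in> carrier G \<Longrightarrow> q \<in> carrier Q \<Longrightarrow> \<kappa> g q \<in> carrier F"
  using act_eq by blast

lemma \<kappa>_mult:
  assumes "g \<in> carrier G" "h \<in> carrier G" "q \<in> carrier Q"
  shows "\<kappa> (g \<cdot> h) q = \<kappa> g (p h \<star> q) \<bullet> \<kappa> h q"
proof -
  have "act (g \<cdot> h) (q, \<one>\<^bsub>F\<^esub>) = act g (act h (q, \<one>\<^bsub>F\<^esub>))"
    using assms by (intro act_mult) auto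
  also have "act h (q, \<one>\<^bsub>F\<^esub>) = (p h \<star> q, \<kappa> h q)"
    using act_eq[OF assms(2,3)] by auto
  also have "act g \<dots> = (p g \<star> (p h \<star> q), \<kappa> g (p h \<star> q) \<bullet> \<kappa> h q)"
    using act_eq[of g "p h \<star> q"] \<kappa>_closed[OF assms(2,3)] assms by auto
  finally show ?thesis unfolding \<kappa>_def[of "g \<cdot> h"] by simp
qed

lemma \<kappa>_l: "y \<in> P s \<Longrightarrow> q \<in> carrier Q \<Longrightarrow> \<kappa> (l s y) q = \<kappa>0 s y q"
  using act_l[of y s q "\<one>\<^bsub>F\<^esub>"] \<kappa>0_closed[of y q s] P_carrier by (simp add: \<kappa>_def)

lemma \<kappa>_one: "q \<in> carrier Q \<Longrightarrow> \<kappa> \<one>\<^bsub>G\<^esub> q = \<one>\<^bsub>F\<^esub>"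
  using act_one[of "(q, \<one>\<^bsub>F\<^esub>)"] by (simp add: \<kappa>_def)

text \<open>A lift travels through tree edges, where \<open>xgen\<close> is trivial; only a last
  step of type \<open>False\<close> leaves the contribution of \<open>q\<close> itself.\<close>

lemma \<kappa>_lift: "q \<in> carrier Q \<Longrightarrow> \<kappa> (lift s q) \<one>\<^bsub>Q\<^esub> = (if s then \<one>\<^bsub>F\<^esub> else inv\<^bsub>F\<^esub> xgen q)"
proof (induction s q rule: lift_induct)
  case (root q)
  then show ?case by (simp add: lift_root \<kappa>_l \<kappa>0_def)
next
  case (step s y q)
  have "\<kappa> (lift s q) \<one>\<^bsub>Q\<^esub> = \<kappa>0 s y (parent s q) \<bullet> \<kappa> (lift (\<not> s) (parent s q)) \<one>\<^bsub>Q\<^esub>"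
    using step lift_props by (simp add: \<kappa>_mult l_closed \<kappa>_l)
  then have "\<kappa> (lift s q) \<one>\<^bsub>Q\<^esub> = \<kappa>0 s y (parent s q) \<bullet> (if \<not> s then \<one>\<^bsub>F\<^esub> else inv\<^bsub>F\<^esub> xgen (parent s q))"
    using step by simp
  moreover have "xgen (parent s q) = \<one>\<^bsub>F\<^esub>" using step xgen_parent by simp
  ultimately show ?case
    using step(1,3) xgen_closed[OF step(1)] by (cases s) (simp_all add: \<kappa>0_def)
qed

section \<open>Loops, and the isomorphism from the free group to the kernel\<close>

abbreviation "Ker \<equiv> kernel G Q p"

text \<open>The closed path that runs through the tree to one end of the edge \<open>D #> q\<close>,
  crosses it and returns from the other end.\<close>

definition loop :: "'g \<Rightarrow> 'g" where
  "loop q = inv\<^bsub>G\<^esub> lift False q \<cdot> lift True q"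

lemma loop_Ker: "q \<in> carrier Q \<Longrightarrow> loop q \<in> Ker"
  using lift_props by (simp add: loop_def kernel_def)

lemma loop_mult:
  assumes "c \<in> D" "q \<in> carrier Q"
  shows "loop (c \<star> q) = loop q"
proof -
  have c: "c \<in> P s" for s using assms D_P by blast
  then show ?thesis
    using assms lift_props l_closed[OF c[of False]]
    by (simp add: loop_def lift_mult l_agree G.word_simps)
qed

lemma loop_tree:
  assumes q: "q \<in> carrier Q" and tree: "tree q"
  shows "loop q = \<one>\<^bsub>G\<^esub>"
proof -
  obtain s r where r: "r \<in> carrier Q" "0 < dist s r" "D #>\<^bsub>Q\<^esub> q = D #>\<^bsub>Q\<^esub> parent s r"
    using tree by (auto simp: tree_def)
  have pr: "parent s r \<in> carrier Q" using parentE[OF r(1,2)] by blast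
  have "q \<in> D #>\<^bsub>Q\<^esub> parent s r" using r(3) Q.rcos_self[OF q D_subgroup] by simp
  then obtain c where c: "c \<in> D" "q = c \<star> parent s r" by (auto simp: r_coset_def)
  have "loop (parent s r) = \<one>\<^bsub>G\<^esub>"
    using lift_parent[OF r(1,2)] lift_props[OF pr] by (cases s) (auto simp: loop_def)
  then show ?thesis using loop_mult[OF c(1) pr] c(2) by simp
qed

text \<open>Generators go to loops by \<open>\<sigma>\<close>; its inverse is the cocycle at the
  base point. One composite is the identity \<open>?R\<close> at the base point, the other is
  checked on generators.\<close>

theorem kernel_is_free: "is_free_group (G\<lparr>carrier := Ker\<rparr>)"
proof -
  let ?K = "G\<lparr>carrier := Ker\<rparr>"
  have Ksub: "subgroup Ker G" by (rule p.subgroup_kernel)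
  interpret K: group ?K by (rule G.subgroup_imp_group[OF Ksub])
  have XQ: "loop \<in> X \<rightarrow> carrier ?K" using X_props loop_Ker by auto
  obtain \<sigma> where \<sigma>: "\<sigma> \<in> hom F ?K" "\<And>x. x \<in> X \<Longrightarrow> \<sigma> (free_gen X x) = loop x"
    using K.free_universal[OF XQ] by blast
  interpret \<sigma>: group_hom F ?K \<sigma> using \<sigma> by (simp add: group_hom_iff F.is_group K.is_group)
  have \<sigma>G: "\<sigma> f \<in> carrier G" if "f \<in> carrier F" for f
    using \<sigma>.hom_closed[OF that] by (simp add: kernel_def)
  have \<sigma>_mult: "\<sigma> (f \<bullet> g) = \<sigma> f \<cdot> \<sigma> g" if "f \<in> carrier F" "g \<in> carrier F" for f g
    using \<sigma>.hom_mult[OF that] by simp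
  have \<sigma>_inv: "\<sigma> (inv\<^bsub>F\<^esub> f) = inv\<^bsub>G\<^esub> \<sigma> f" if "f \<in> carrier F" for f
    using \<sigma>.hom_inv[OF that] G.m_inv_consistent[OF Ksub] \<sigma>.hom_closed[OF that] by simp
  have \<sigma>_one: "\<sigma> \<one>\<^bsub>F\<^esub> = \<one>\<^bsub>G\<^esub>" using \<sigma>.hom_one by simp
  have \<sigma>_xgen: "\<sigma> (xgen q) = loop q" if q: "q \<in> carrier Q" for q
  proof (cases "tree q")
    case True
    then show ?thesis using loop_tree[OF q] by (simp add: xgen_def \<sigma>_one)
  next
    case False
    obtain c where "c \<in> D" "edge q = c \<star> q" using edge_eq[OF q] by blast
    then have "loop (edge q) = loop q" using loop_mult q by simp
    moreover have "edge q \<in> X" using q False by (simp add: X_def)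
    ultimately show ?thesis using False \<sigma>(2) by (simp add: xgen_def)
  qed
  \<comment> \<open>Reidemeister-Schreier rewriting: \<open>g\<close>, closed up by lifts at both
    ends, is the product of loops recorded by the cocycle.\<close>
  let ?R = "\<lambda>g q. inv\<^bsub>G\<^esub> lift True (p g \<star> q) \<cdot> g \<cdot> lift True q = \<sigma> (\<kappa> g q)"
  have \<sigma>_\<kappa>: "\<forall>q \<in> carrier Q. ?R g q"
    if "g \<in> carrier G" for g
    using that
  proof (rule gen_induct)
    show "\<forall>q \<in> carrier Q. ?R \<one>\<^bsub>G\<^esub> q"
      using lift_props by (simp add: \<kappa>_one \<sigma>_one)
  next
    fix s y g
    assume y: "y \<in> P s" and g: "g \<in> carrier G"
      and IH: "\<forall>q \<in> carrier Q. ?R g q"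
    show "\<forall>q \<in> carrier Q. ?R (l s y \<cdot> g) q"
    proof
      fix q assume q: "q \<in> carrier Q"
      define r where "r = p g \<star> q"
      have r: "r \<in> carrier Q" using g q by (simp add: r_def)
      have yc: "y \<in> carrier Q" "l s y \<in> carrier G" using y P_carrier l_closed by auto
      note lp = lift_props[OF q, of True] lift_props[OF r, of True] lift_props[OF r, of False]
        lift_props[of "y \<star> r" True] lift_props[of "y \<star> r" False]
      have "\<sigma> (\<kappa>0 s y r) = inv\<^bsub>G\<^esub> lift True (y \<star> r) \<cdot> l s y \<cdot> lift True r"
      proof (cases s)
        case True
        then show ?thesis using y r yc lp by (simp add: \<kappa>0_def \<sigma>_one lift_mult G.word_simps)
      next
        case False
        have "\<sigma> (\<kappa>0 s y r) = inv\<^bsub>G\<^esub> loop (y \<star> r) \<cdot> loop r"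
          using False r yc by (simp add: \<kappa>0_def \<sigma>_mult \<sigma>_inv \<sigma>_xgen xgen_closed del: \<sigma>.hom_inv)
        also have "\<dots> = inv\<^bsub>G\<^esub> lift True (y \<star> r) \<cdot> lift False (y \<star> r) \<cdot> inv\<^bsub>G\<^esub> lift False r \<cdot> lift True r"
          using r yc lp by (simp add: loop_def G.word_simps)
        also have "lift False (y \<star> r) = l s y \<cdot> lift False r"
          using y r False lift_mult by simp
        finally show ?thesis using r yc lp by (simp add: G.word_simps)
      qed
      moreover have "p (l s y \<cdot> g) \<star> q = y \<star> r"
        using yc y g q p_l by (simp add: r_def Q.m_assoc)
      moreover have "\<kappa> (l s y \<cdot> g) q = \<kappa>0 s y r \<bullet> \<kappa> g q"
        using yc y g q r by (simp add: \<kappa>_mult \<kappa>_l r_def)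
      moreover have "\<sigma> (\<kappa> g q) = inv\<^bsub>G\<^esub> lift True r \<cdot> g \<cdot> lift True q"
        using IH q by (simp add: r_def)
      ultimately show "?R (l s y \<cdot> g) q"
        using yc g q r lp \<kappa>0_closed[of y r s] \<kappa>_closed[of g q]
        by (simp add: \<sigma>_mult G.word_simps del: Q.m_assoc)
    qed
  qed
  have lift_one: "lift True \<one>\<^bsub>Q\<^esub> = \<one>\<^bsub>G\<^esub>" using lift_root[OF P_one] l_one by simp
  define \<theta> where "\<theta> k = \<kappa> k \<one>\<^bsub>Q\<^esub>" for k
  have \<sigma>\<theta>: "\<sigma> (\<theta> k) = k" and \<theta>_closed: "\<theta> k \<in> carrier F" if "k \<in> Ker" for k
    using \<sigma>_\<kappa>[of k] that lift_one \<kappa>_closed by (auto simp: \<theta>_def kernel_def dest: bspec[of _ _ "\<one>\<^bsub>Q\<^esub>"])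
  have \<theta>_hom: "\<theta> \<in> hom ?K F"
    by (rule homI) (auto simp: \<theta>_closed \<theta>_def \<kappa>_mult kernel_def \<kappa>_closed)
  \<comment> \<open>The cocycle of the inverted lift follows from the cocycle identity for
    \<open>inv lift \<cdot> lift = \<one>\<close>; \<open>\<kappa>_lift\<close> supplies the other
    factor.\<close>
  have \<theta>_loop: "\<theta> (loop q) = xgen q" if q: "q \<in> carrier Q" for q
  proof -
    note lp = lift_props[OF q, of True] lift_props[OF q, of False]
    have "\<one>\<^bsub>F\<^esub> = \<kappa> (inv\<^bsub>G\<^esub> lift False q \<cdot> lift False q) \<one>\<^bsub>Q\<^esub>"
      using lp by (simp add: \<kappa>_one)
    also have "\<dots> = \<kappa> (inv\<^bsub>G\<^esub> lift False q) q \<bullet> inv\<^bsub>F\<^esub> xgen q"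
      using lp q by (subst \<kappa>_mult) (auto simp: \<kappa>_lift)
    finally have "\<kappa> (inv\<^bsub>G\<^esub> lift False q) q \<bullet> inv\<^bsub>F\<^esub> xgen q = \<one>\<^bsub>F\<^esub>" by simp
    then have "\<kappa> (inv\<^bsub>G\<^esub> lift False q) q = xgen q"
      using F.inv_equality[of "\<kappa> (inv\<^bsub>G\<^esub> lift False q) q" "inv\<^bsub>F\<^esub> xgen q"] lp q xgen_closed \<kappa>_closed by simp
    then show ?thesis
      using lp q xgen_closed by (simp add: \<theta>_def loop_def \<kappa>_mult \<kappa>_lift)
  qed
  have \<theta>\<sigma>: "\<theta> (\<sigma> f) = f" if "f \<in> carrier F" for f
  proof -
    have "(\<theta> \<circ> \<sigma>) f = (\<lambda>x. x) f"
    proof (rule free_hom_eq[OF F.is_group _ _ _ that])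
      show "\<theta> \<circ> \<sigma> \<in> hom F F" using \<sigma>(1) \<theta>_hom by (rule hom_compose)
      show "(\<lambda>x. x) \<in> hom F F" by (simp add: hom_def)
      show "(\<theta> \<circ> \<sigma>) (free_gen X x) = free_gen X x" if "x \<in> X" for x
        using that X_props[OF that] \<sigma>(2) \<theta>_loop by simp
    qed
    then show ?thesis by simp
  qed
  have "\<sigma> \<in> iso F ?K"
    using \<sigma>(1) \<theta>_hom \<sigma>\<theta> \<theta>\<sigma> by (intro group_isomorphisms_imp_iso[of _ _ _ \<theta>]) (auto simp: group_isomorphisms_def)
  then have "F \<cong> ?K" by (rule is_isoI)
  then show ?thesis using K.is_group unfolding is_free_group_def by blast
qed

end

section \<open>Residual solvability\<close>

subsection \<open>Free groups are residually nilpotent\<close>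

definition syllable_eval :: "'x set \<Rightarrow> ('x \<times> int) list \<Rightarrow> ('x \<times> bool) list set" where
  "syllable_eval X = word_eval (free_group_on X) (\<lambda>(x, k). free_gen X x [^]\<^bsub>free_group_on X\<^esub> k)"

text \<open>Powers of one generator are merged, so that each syllable becomes a single transvection
  with a nonzero coefficient.\<close>

definition reduced_syllables :: "'x set \<Rightarrow> ('x \<times> int) list \<Rightarrow> bool" where
  "reduced_syllables X w \<longleftrightarrow> distinct_adj (map fst w) \<and> (\<forall>s \<in> set w. fst s \<in> X \<and> snd s \<noteq> 0)"

lemma syllable_eval_closed:
  assumes "reduced_syllables X w"
  shows "syllable_eval X w \<in> carrier (free_group_on X)"
proof -
  interpret F: group "free_group_on X" by (rule group_free_group_on)
  have "\<forall>s \<in> set w. fst s \<in> X" using assms by (simp add: reduced_syllables_def)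
  then show ?thesis
    unfolding syllable_eval_def
    by (induction w) (auto simp: free_gen_closed)
qed

lemma syllable_prepend:
  assumes w: "reduced_syllables X w" and x: "x \<in> X" and k: "(k::int) \<noteq> 0"
  shows "\<exists>v. reduced_syllables X v \<and>
    free_gen X x [^]\<^bsub>free_group_on X\<^esub> k \<otimes>\<^bsub>free_group_on X\<^esub> syllable_eval X w = syllable_eval X v"
proof -
  interpret F: group "free_group_on X" by (rule group_free_group_on)
  have gx: "free_gen X x \<in> carrier (free_group_on X)" using x by (rule free_gen_closed)
  show ?thesis
  proof (cases "w = [] \<or> fst (hd w) \<noteq> x")
    case True
    then have "reduced_syllables X ((x, k) # w)"
      using w x k by (cases w) (auto simp: reduced_syllables_def distinct_adj_Cons)
    then show ?thesis by (intro exI[of _ "(x, k) # w"]) (simp add: syllable_eval_def)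
  next
    case False
    then obtain m v where wv: "w = (x, m) # v" by (cases w) auto
    have v: "reduced_syllables X v" using w wv by (auto simp: reduced_syllables_def distinct_adj_Cons)
    have ev: "syllable_eval X v \<in> carrier (free_group_on X)" by (rule syllable_eval_closed[OF v])
    have eq: "free_gen X x [^]\<^bsub>free_group_on X\<^esub> k \<otimes>\<^bsub>free_group_on X\<^esub> syllable_eval X w =
        free_gen X x [^]\<^bsub>free_group_on X\<^esub> (k + m) \<otimes>\<^bsub>free_group_on X\<^esub> syllable_eval X v"
      using gx ev by (simp add: wv syllable_eval_def F.int_pow_mult F.m_assoc)
    show ?thesis
    proof (cases "k + m = 0")
      case True
      then show ?thesis using eq v ev by auto
    next
      case False
      then have "reduced_syllables X ((x, k + m) # v)"
        using w wv by (auto simp: reduced_syllables_def distinct_adj_Cons)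
      then show ?thesis using eq by (intro exI[of _ "(x, k + m) # v"]) (simp add: syllable_eval_def)
    qed
  qed
qed

lemma syllable_form:
  assumes "g \<in> carrier (free_group_on X)"
  shows "\<exists>w. reduced_syllables X w \<and> g = syllable_eval X w"
  using assms
proof (rule free_group_induct)
  interpret F: group "free_group_on X" by (rule group_free_group_on)
  show "\<exists>w. reduced_syllables X w \<and> \<one>\<^bsub>free_group_on X\<^esub> = syllable_eval X w"
    by (intro exI[of _ "[]"]) (simp add: reduced_syllables_def syllable_eval_def)
  fix x g
  assume x: "x \<in> X" and IH: "\<exists>w. reduced_syllables X w \<and> g = syllable_eval X w"
  show "\<exists>w. reduced_syllables X w \<and> free_gen X x \<otimes>\<^bsub>free_group_on X\<^esub> g = syllable_eval X w"
    using IH syllable_prepend[OF _ x, of _ 1] free_gen_closed[OF x] by auto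
  show "\<exists>w. reduced_syllables X w \<and> inv\<^bsub>free_group_on X\<^esub> free_gen X x \<otimes>\<^bsub>free_group_on X\<^esub> g = syllable_eval X w"
    using IH syllable_prepend[OF _ x, of _ "-1"] free_gen_closed[OF x] by (auto simp: F.int_pow_neg)
qed

section \<open>Detecting a reduced word by transvections\<close>

definition finite_support :: "nat \<Rightarrow> (nat \<Rightarrow> real) set" where
  "finite_support j = {v. \<forall>i \<ge> j. v i = 0}"

interpretation fsup: filtered_space finite_support d for d
  by standard (auto simp: finite_support_def subspace_def scaleR_fun_def fun_eq_iff)

text \<open>The shift \<open>v \<mapsto> (\<lambda>i. v (Suc i))\<close> cut down to the positions where the syllable list \<open>w\<close> has letter \<open>x\<close>;
  since neighbouring syllables differ, it squares to zero.\<close>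

definition letter_shift :: "('x \<times> int) list \<Rightarrow> 'x \<Rightarrow> (nat \<Rightarrow> real) \<Rightarrow> nat \<Rightarrow> real" where
  "letter_shift w x v = (\<lambda>i. if i < length w \<and> fst (w ! i) = x then v (Suc i) else 0)"

definition transvection :: "('x \<times> int) list \<Rightarrow> 'x \<Rightarrow> int \<Rightarrow> (nat \<Rightarrow> real) \<Rightarrow> nat \<Rightarrow> real" where
  "transvection w x k v = v + of_int k *\<^sub>R letter_shift w x v"

lemma letter_shift_square:
  assumes "distinct_adj (map fst w)"
  shows "letter_shift w x (letter_shift w x v) = 0"
proof -
  have "fst (w ! i) \<noteq> fst (w ! Suc i)" if "Suc i < length w" for i
    using assms that by (auto simp: distinct_adj_conv_nth)
  then show ?thesis by (auto simp: letter_shift_def fun_eq_iff)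
qed

text \<open>Send \<open>x\<close> to \<open>1 + N\<close>, with \<open>N\<close> the letter shift of
  \<open>x\<close>. As \<open>N\<close> squares to zero, \<open>x^k\<close> goes to
  \<open>1 + k N\<close>. Read from the right, each syllable moves the first nonzero position of the
  vector one place down and multiplies that entry by its exponent, so the word carries the basis
  vector at \<open>r\<close> to one with a nonzero entry at \<open>0\<close>.\<close>

lemma free_group_residually_nilpotent:
  assumes g: "g \<in> carrier (free_group_on X)" "g \<noteq> \<one>\<^bsub>free_group_on X\<^esub>"
  shows "\<exists>(U :: ((nat \<Rightarrow> real) \<Rightarrow> nat \<Rightarrow> real) monoid) h.
    nilpotent_group U \<and> h \<in> hom (free_group_on X) U \<and> h g \<noteq> \<one>\<^bsub>U\<^esub>"
proof -
  interpret F: group "free_group_on X" by (rule group_free_group_on)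
  obtain w where w: "reduced_syllables X w" "g = syllable_eval X w"
    using syllable_form[OF g(1)] by blast
  have adj: "distinct_adj (map fst w)" using w by (simp add: reduced_syllables_def)
  have "w \<noteq> []" using g(2) w by (auto simp: syllable_eval_def)
  define r where "r = length w"
  \<comment> \<open>Positions \<open>0\<close> to \<open>r\<close>: one for each syllable, and the
    starting position.\<close>
  define d where "d = Suc r"
  have r: "0 < r" using \<open>w \<noteq> []\<close> by (simp add: r_def)
  let ?V = "finite_support d"
  define U where "U = fsup.Uni d"
  interpret U: group U unfolding U_def by (rule fsup.Uni.is_group)
  define T where "T x k = restrict (transvection w x k) ?V" for x k
  have low: "fsup.lowering d 1 (transvection w x k)" for x k
    unfolding fsup.lowering_def
    by (auto simp: transvection_def letter_shift_def finite_support_def scaleR_fun_def fun_eq_iff algebra_simps)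
  have T1: "T x k \<in> fsup.unip d 1" for x k
    unfolding T_def by (rule fsup.restrict_unip[OF low]) simp
  have T: "T x k \<in> carrier U" for x k using T1 by (simp add: U_def)
  have U_mult: "(f \<otimes>\<^bsub>U\<^esub> h) v = f (h v)" if "f \<in> carrier U" "h \<in> carrier U" "v \<in> ?V" for f h v
    using that fsup.Uni_mult by (simp add: U_def)
  have U_stable: "f v \<in> ?V" if "f \<in> carrier U" "v \<in> ?V" for f v
    using that fsup.unip_stable[of f d 1 d v] by (simp add: U_def)
  have shift_add: "letter_shift w x (u + v) = letter_shift w x u + letter_shift w x v" for x u v
    by (auto simp: letter_shift_def fun_eq_iff)
  have shift_scale: "letter_shift w x (a *\<^sub>R v) = a *\<^sub>R letter_shift w x v" for x a v
    by (auto simp: letter_shift_def fun_eq_iff scaleR_fun_def)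
  have T_mult: "T x k \<otimes>\<^bsub>U\<^esub> T x m = T x (k + m)" for x k m
  proof (rule fsup.Bij_eqI[of _ d])
    show "T x k \<otimes>\<^bsub>U\<^esub> T x m \<in> Bij ?V" "T x (k + m) \<in> Bij ?V"
      using fsup.unip_Bij[of _ d 1] T U.m_closed[OF T T] unfolding U_def by auto
    fix v assume v: "v \<in> ?V"
    have "T x m v \<in> ?V" using U_stable T v by blast
    then have "(T x k \<otimes>\<^bsub>U\<^esub> T x m) v = transvection w x k (transvection w x m v)"
      using U_mult[OF T T v] v by (simp add: T_def)
    also have "\<dots> = transvection w x (k + m) v"
      by (simp add: transvection_def shift_add shift_scale letter_shift_square[OF adj] scaleR_add_left add.assoc)
    finally show "(T x k \<otimes>\<^bsub>U\<^esub> T x m) v = T x (k + m) v" using v by (simp add: T_def)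
  qed
  have T_one: "T x 0 = \<one>\<^bsub>U\<^esub>" for x
    using T_mult[of x 0 0] T U.l_cancel_one[OF T T] by simp
  have T_inv: "inv\<^bsub>U\<^esub> T x 1 = T x (-1)" for x
    using T_mult[of x "-1" 1] T_one T by (intro U.inv_equality) auto
  have T_pow: "T x 1 [^]\<^bsub>U\<^esub> (k::int) = T x k" for x k
  proof (induction k rule: int_induct[where k = 0])
    case base
    then show ?case by (simp add: T_one)
  next
    case (step1 i)
    then show ?case using T by (simp add: U.int_pow_mult T_mult)
  next
    case (step2 i)
    then show ?case using T by (simp add: U.int_pow_diff T_inv T_mult)
  qed
  obtain h where h: "h \<in> hom (free_group_on X) U" "\<And>x. x \<in> X \<Longrightarrow> h (free_gen X x) = T x 1"
    using U.free_universal[of "\<lambda>x. T x 1" X] T by blast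
  interpret h: group_hom "free_group_on X" U h
    using h by (simp add: group_hom_iff F.is_group U.is_group)
  define e :: "nat \<Rightarrow> real" where "e i = (if i = r then 1 else 0)" for i
  have e: "e \<in> ?V" by (simp add: e_def finite_support_def d_def)
  \<comment> \<open>Downward induction on \<open>j\<close>: after the syllables from
    \<open>j\<close> on have acted, position \<open>j\<close> carries the first nonzero
    entry.\<close>
  have "(\<forall>i < j. h (syllable_eval X (drop j w)) e i = 0) \<and> h (syllable_eval X (drop j w)) e j \<noteq> 0 \<and>
      reduced_syllables X (drop j w)" if "j \<le> r" for j
    using that
  proof (induction rule: inc_induct)
    case base
    have "\<one>\<^bsub>U\<^esub> e = e" using fsup.Uni_one[OF e] by (simp add: U_def)
    then show ?case by (simp add: r_def syllable_eval_def reduced_syllables_def) (simp add: e_def r_def)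
  next
    case (step j)
    define z where "z = h (syllable_eval X (drop (Suc j) w)) e"
    define x k where "x = fst (w ! j)" and "k = snd (w ! j)"
    have jw: "j < length w" using step by (simp add: r_def)
    then have dj: "drop j w = (x, k) # drop (Suc j) w" by (simp add: x_def k_def Cons_nth_drop_Suc)
    have wj: "w ! j \<in> set w" using jw by simp
    have x: "x \<in> X" "k \<noteq> 0" using w(1) wj by (auto simp: reduced_syllables_def x_def k_def)
    have ev: "syllable_eval X (drop (Suc j) w) \<in> carrier (free_group_on X)"
      using step by (intro syllable_eval_closed) auto
    have "h (syllable_eval X (drop j w)) = h (free_gen X x [^]\<^bsub>free_group_on X\<^esub> k \<otimes>\<^bsub>free_group_on X\<^esub> syllable_eval X (drop (Suc j) w))"
      by (simp add: dj syllable_eval_def)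
    also have "\<dots> = T x k \<otimes>\<^bsub>U\<^esub> h (syllable_eval X (drop (Suc j) w))"
      using ev x free_gen_closed[OF x(1)] by (simp add: h.hom_int_pow h(2) T_pow)
    finally have "h (syllable_eval X (drop j w)) e = T x k z"
      using U_mult[OF T _ e] ev by (simp add: z_def)
    moreover have "z \<in> ?V" unfolding z_def using U_stable ev e by simp
    ultimately have val: "h (syllable_eval X (drop j w)) e = transvection w x k z" by (simp add: T_def)
    have z: "\<forall>i < Suc j. z i = 0" "z (Suc j) \<noteq> 0" using step by (auto simp: z_def)
    have "transvection w x k z j = of_int k * z (Suc j)"
      using z jw by (simp add: transvection_def letter_shift_def scaleR_fun_def x_def)
    moreover have "transvection w x k z i = 0" if "i < j" for i
      using z that by (simp add: transvection_def letter_shift_def scaleR_fun_def)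
    moreover have "reduced_syllables X (drop j w)"
      using w(1) by (auto simp: reduced_syllables_def drop_map[symmetric] distinct_adj_conv_nth dest: in_set_dropD)
    ultimately show ?case using val z x by simp
  qed
  from this[of 0] have "h g e 0 \<noteq> 0" using w by simp
  moreover have "\<one>\<^bsub>U\<^esub> e = e" using fsup.Uni_one[OF e] by (simp add: U_def)
  then have "\<one>\<^bsub>U\<^esub> e 0 = 0" using r by (simp add: e_def)
  ultimately have "h g \<noteq> \<one>\<^bsub>U\<^esub>" by auto
  moreover have "nilpotent_group U" unfolding U_def by (rule fsup.Uni_nilpotent)
  ultimately show ?thesis using h(1) by blast
qed

subsection \<open>Extensions of free groups by solvable groups\<close>

lemma (in group_hom) derived_hom_trivial:
  assumes "solvable H"
  obtains n where "\<And>x. x \<in> (derived G ^^ n) (carrier G) \<Longrightarrow> h x = \<one>\<^bsub>H\<^esub>"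
proof -
  obtain n where n: "(derived H ^^ n) (carrier H) = {\<one>\<^bsub>H\<^esub>}"
    using assms H.solvable_iff_trivial_derived_seq by blast
  have "h ` (derived G ^^ n) (carrier G) = (derived H ^^ n) (h ` carrier G)"
    by (rule exp_of_derived_img[symmetric]) simp
  also have "\<dots> \<subseteq> (derived H ^^ n) (carrier H)" by (rule H.mono_exp_of_derived) auto
  finally show thesis using that n by blast
qed

lemma (in group) exp_of_derived_consistent:
  assumes "subgroup H G"
  shows "(derived (G\<lparr>carrier := H\<rparr>) ^^ n) H = (derived G ^^ n) H"
proof (induction n)
  case (Suc n)
  have "(derived G ^^ n) H \<subseteq> H"
    using group.exp_of_derived_in_carrier[OF subgroup_imp_group[OF assms], of H n] Suc by simp
  then show ?case using Suc derived_consistent[OF _ assms] by simp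
qed simp

text \<open>The quotient by the \<open>n\<close>th derived subgroup is solvable and still detects
  \<open>g\<close>.\<close>

lemma (in group) residually_solvableI:
  assumes "\<And>g. g \<in> carrier G \<Longrightarrow> g \<noteq> \<one> \<Longrightarrow> \<exists>n. g \<notin> (derived G ^^ n) (carrier G)"
  shows "residually_solvable G"
  unfolding residually_solvable_def
proof (intro conjI ballI impI)
  fix g assume g: "g \<in> carrier G" "g \<noteq> \<one>"
  then obtain n where n: "g \<notin> (derived G ^^ n) (carrier G)" using assms by blast
  define N where "N = (derived G ^^ n) (carrier G)"
  have "(derived G ^^ k) (carrier G) \<lhd> G" for k
    by (induction k) (auto intro: normal_self derived_is_normal)
  then interpret N: normal N G by (simp add: N_def)
  interpret q: group_hom G "G Mod N" "\<lambda>x. N #> x" by (rule N.group_hom_Mod)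
  have surj: "(\<lambda>x. N #> x) ` carrier G = carrier (G Mod N)" by (simp add: carrier_FactGroup)
  have "(derived (G Mod N) ^^ n) (carrier (G Mod N)) = (\<lambda>x. N #> x) ` N"
    unfolding surj[symmetric] using q.exp_of_derived_img[of "carrier G" n] by (simp add: N_def)
  also have "\<dots> = {\<one>\<^bsub>G Mod N\<^esub>}"
    using coset_join2[OF _ N.is_subgroup] by (auto intro!: image_eqI[of _ _ \<one>])
  finally have "solvable (G Mod N)" using q.H.solvable_iff_trivial_derived_seq by blast
  moreover have "(\<lambda>x. N #> x) \<in> epi G (G Mod N)" using q.homh surj by (simp add: epi_def)
  moreover have "N #> g \<noteq> \<one>\<^bsub>G Mod N\<^esub>"
    using n coset_join1[OF _ g(1) N.is_subgroup] N.subset by (auto simp: N_def)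
  ultimately show "\<exists>(H :: 'a set monoid) f. group H \<and> solvable H \<and> f \<in> epi G H \<and> f g \<noteq> \<one>\<^bsub>H\<^esub>"
    using q.H.is_group by blast
qed (rule is_group)

lemma (in group_hom) free_by_solvable_residually_solvable:
  assumes sol: "solvable H" and free: "is_free_group (G\<lparr>carrier := kernel G H h\<rparr>)"
  shows "residually_solvable G"
proof (rule G.residually_solvableI)
  let ?K = "kernel G H h"
  fix g assume g: "g \<in> carrier G" "g \<noteq> \<one>"
  obtain m where m: "\<And>x. x \<in> (derived G ^^ m) (carrier G) \<Longrightarrow> h x = \<one>\<^bsub>H\<^esub>"
    using derived_hom_trivial[OF sol] by blast
  show "\<exists>n. g \<notin> (derived G ^^ n) (carrier G)"
  proof (cases "h g = \<one>\<^bsub>H\<^esub>")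
    case False
    then show ?thesis using m by blast
  next
    case True
    have sub: "subgroup ?K G" by (rule subgroup_kernel)
    interpret K: group "G\<lparr>carrier := ?K\<rparr>" by (rule G.subgroup_imp_group[OF sub])
    have gK: "g \<in> ?K" using True g by (simp add: kernel_def)
    obtain X :: "'a set" and \<sigma> where \<sigma>: "\<sigma> \<in> iso (free_group_on X) (G\<lparr>carrier := ?K\<rparr>)"
      using free by (auto simp: is_free_group_def is_iso_def)
    interpret F: group "free_group_on X" by (rule group_free_group_on)
    obtain \<theta> where \<theta>: "\<theta> \<in> iso (G\<lparr>carrier := ?K\<rparr>) (free_group_on X)"
      using F.iso_set_sym[OF \<sigma>] by blast
    have \<theta>h: "\<theta> \<in> hom (G\<lparr>carrier := ?K\<rparr>) (free_group_on X)" and \<theta>i: "inj_on \<theta> ?K"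
      using \<theta> by (auto simp: iso_def bij_betw_def)
    interpret \<theta>: group_hom "G\<lparr>carrier := ?K\<rparr>" "free_group_on X" \<theta>
      using \<theta>h by (simp add: group_hom_iff F.is_group K.is_group)
    have "\<theta> g \<noteq> \<one>\<^bsub>free_group_on X\<^esub>"
      using \<theta>i gK g(2) \<theta>.inj_on_one_iff by auto
    then obtain U :: "((nat \<Rightarrow> real) \<Rightarrow> nat \<Rightarrow> real) monoid" and f where
      U: "nilpotent_group U" "f \<in> hom (free_group_on X) U" "f (\<theta> g) \<noteq> \<one>\<^bsub>U\<^esub>"
      using free_group_residually_nilpotent[of "\<theta> g" X] gK \<theta>.hom_closed by auto
    interpret U: group U using U(1) by (simp add: nilpotent_group_def)
    interpret f\<theta>: group_hom "G\<lparr>carrier := ?K\<rparr>" U "f \<circ> \<theta>"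
      using Group.hom_compose[OF \<theta>h U(2)] by (simp add: group_hom_iff K.is_group U.is_group)
    obtain n where n: "\<And>x. x \<in> (derived (G\<lparr>carrier := ?K\<rparr>) ^^ n) ?K \<Longrightarrow> (f \<circ> \<theta>) x = \<one>\<^bsub>U\<^esub>"
      using f\<theta>.derived_hom_trivial[OF U.nilpotent_imp_solvable[OF U(1)]] by auto
    have "(derived G ^^ m) (carrier G) \<subseteq> ?K"
      using m G.exp_of_derived_in_carrier[of "carrier G" m] by (auto simp: kernel_def)
    then have "(derived G ^^ (n + m)) (carrier G) \<subseteq> (derived G ^^ n) ?K"
      unfolding funpow_add o_apply by (rule G.mono_exp_of_derived)
    then have "g \<notin> (derived G ^^ (n + m)) (carrier G)"
      using n[of g] U(3) G.exp_of_derived_consistent[OF sub, of n] by auto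
    then show ?thesis by blast
  qed
qed

section \<open>Amalgams of nilpotent groups\<close>

text \<open>Realises the image of \<open>h\<close> on chosen representatives of its fibres, giving
  it the element type of \<open>G\<close>, which both \<open>is_extension\<close> and
  \<open>amalgam_over\<close> demand.\<close>

lemma (in group_hom) image_on_representatives:
  obtains Q :: "'a monoid" and p where "group Q" "p \<in> epi G Q" "h \<in> mon Q H"
    "\<And>x. x \<in> carrier G \<Longrightarrow> h (p x) = h x"
proof -
  define p where "p x = (SOME y. y \<in> carrier G \<and> h y = h x)" for x
  have "p x \<in> carrier G \<and> h (p x) = h x" if "x \<in> carrier G" for x
    unfolding p_def using that by (intro someI[where P = "\<lambda>y. y \<in> carrier G \<and> h y = h x"]) simp
  then have pc: "p x \<in> carrier G" and hp: "h (p x) = h x" if "x \<in> carrier G" for x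
    using that by auto
  have p_eq: "p x = p y" if "h x = h y" for x y
    using that by (simp add: p_def)
  define Q where "Q = \<lparr>carrier = p ` carrier G, mult = (\<lambda>x y. p (x \<otimes> y)), one = p \<one>\<rparr>"
  have Q: "carrier Q = p ` carrier G" "x \<otimes>\<^bsub>Q\<^esub> y = p (x \<otimes> y)" "\<one>\<^bsub>Q\<^esub> = p \<one>" for x y
    by (simp_all add: Q_def)
  have mult: "p x \<otimes>\<^bsub>Q\<^esub> p y = p (x \<otimes> y)" if "x \<in> carrier G" "y \<in> carrier G" for x y
    unfolding Q by (rule p_eq) (use that pc hp in simp)
  have hom: "p \<in> hom G Q"
    by (rule homI) (simp_all add: Q(1) mult)
  have "group Q"
  proof (rule groupI)
    fix x y assume "x \<in> carrier Q" "y \<in> carrier Q"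
    then show "x \<otimes>\<^bsub>Q\<^esub> y \<in> carrier Q" by (auto simp: Q(1) mult)
  next
    fix x y z assume "x \<in> carrier Q" "y \<in> carrier Q" "z \<in> carrier Q"
    then show "x \<otimes>\<^bsub>Q\<^esub> y \<otimes>\<^bsub>Q\<^esub> z = x \<otimes>\<^bsub>Q\<^esub> (y \<otimes>\<^bsub>Q\<^esub> z)"
      by (auto simp: Q(1) mult G.m_assoc)
  next
    fix x assume "x \<in> carrier Q"
    then obtain y where y: "y \<in> carrier G" "x = p y" by (auto simp: Q(1))
    then show "\<one>\<^bsub>Q\<^esub> \<otimes>\<^bsub>Q\<^esub> x = x" by (simp add: Q(3) mult)
    have "p (inv y) \<otimes>\<^bsub>Q\<^esub> x = \<one>\<^bsub>Q\<^esub>" using y by (simp add: Q(3) mult)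
    moreover have "p (inv y) \<in> carrier Q" using y by (simp add: Q(1))
    ultimately show "\<exists>y\<in>carrier Q. y \<otimes>\<^bsub>Q\<^esub> x = \<one>\<^bsub>Q\<^esub>" by blast
  qed (simp add: Q)
  moreover have "p \<in> epi G Q" using hom by (simp add: epi_def Q)
  moreover have "h \<in> mon Q H"
    unfolding mon_def
  proof (intro CollectI conjI homI inj_onI)
    show "x = y" if xy: "x \<in> carrier Q" "y \<in> carrier Q" "h x = h y" for x y
    proof -
      obtain a b where "a \<in> carrier G" "b \<in> carrier G" "x = p a" "y = p b"
        using xy(1,2) by (auto simp: Q(1))
      then show ?thesis using xy(3) p_eq[of a b] hp by simp
    qed
  qed (auto simp: Q(1) mult pc hp)
  ultimately show thesis using that hp by blast
qed

context amalgam_data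
begin

text \<open>As \<open>p\<close> is injective on the factors, they are identified with subgroups of
  \<open>Q\<close>; the sections \<open>l\<close> invert this identification and coincide on the
  image of \<open>C\<close>.\<close>

lemma amalgam_over_image:
  assumes Q: "group Q" and p: "p \<in> epi AP Q" and C: "subgroup C A"
    and injA: "inj_on (p \<circ> iA) (carrier A)" and injB: "inj_on (p \<circ> iB) (carrier B)"
  shows "amalgam_over AP Q p (\<lambda>s. if s then p ` iA ` carrier A else p ` iB ` carrier B)
    (\<lambda>s y. if s then iA (inv_into (carrier A) (p \<circ> iA) y) else iB (inv_into (carrier B) (p \<circ> iB) y))
    (p ` iA ` C)"
proof -
  interpret A: group A by (rule A)
  interpret B: group B by (rule B)
  interpret Q: group Q by (rule Q)
  have p_hom: "p \<in> hom AP Q" and p_surj: "p ` carrier AP = carrier Q" using p by (auto simp: epi_def)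
  interpret p: group_hom AP Q p
    using p_hom by (simp add: group_hom_iff AP.is_group Q.is_group)
  interpret pA: group_hom A Q "p \<circ> iA"
    using hom_compose[OF iA_hom p_hom] by (simp add: group_hom_iff A.is_group Q.is_group)
  interpret pB: group_hom B Q "p \<circ> iB"
    using hom_compose[OF iB_hom p_hom] by (simp add: group_hom_iff B.is_group Q.is_group)
  let ?P = "\<lambda>s. if s then p ` iA ` carrier A else p ` iB ` carrier B"
  let ?l = "\<lambda>s y. if s then iA (inv_into (carrier A) (p \<circ> iA) y) else iB (inv_into (carrier B) (p \<circ> iB) y)"
  have lA: "?l True (p (iA a)) = iA a" if "a \<in> carrier A" for a
    using inv_into_f_f[OF injA that] by simp
  have lB: "?l False (p (iB b)) = iB b" if "b \<in> carrier B" for b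
    using inv_into_f_f[OF injB that] by simp
  have iA_closed: "iA a \<in> carrier AP" if "a \<in> carrier A" for a using hom_in_carrier[OF iA_hom that] .
  have iB_closed: "iB b \<in> carrier AP" if "b \<in> carrier B" for b using hom_in_carrier[OF iB_hom that] .
  have iA_mult: "p (iA a) \<otimes>\<^bsub>Q\<^esub> p (iA a') = p (iA (a \<otimes>\<^bsub>A\<^esub> a'))" if "a \<in> carrier A" "a' \<in> carrier A" for a a'
    using pA.hom_mult[OF that] by simp
  have iB_mult: "p (iB b) \<otimes>\<^bsub>Q\<^esub> p (iB b') = p (iB (b \<otimes>\<^bsub>B\<^esub> b'))" if "b \<in> carrier B" "b' \<in> carrier B" for b b'
    using pB.hom_mult[OF that] by simp
  have CA: "c \<in> carrier A" if "c \<in> C" for c using subgroup.mem_carrier[OF C that] .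
  have \<phi>B: "\<phi> c \<in> carrier B" if "c \<in> C" for c using \<phi> that by auto
  show ?thesis
  proof (intro amalgam_over.intro amalgam_over_axioms.intro AP.is_group Q.is_group p.group_hom_axioms)
    show "p ` carrier AP = carrier Q" by (rule p_surj)
    show "subgroup (?P s) Q" for s
      using pA.img_is_subgroup pB.img_is_subgroup by (simp add: image_comp)
    show "?l s \<in> hom (Q\<lparr>carrier := ?P s\<rparr>) AP" for s
    proof (rule homI)
      show "?l s y \<in> carrier AP" if "y \<in> carrier (Q\<lparr>carrier := ?P s\<rparr>)" for y
        using that lA lB iA_closed iB_closed by (cases s) auto
      show "?l s (y \<otimes>\<^bsub>Q\<lparr>carrier := ?P s\<rparr>\<^esub> z) = ?l s y \<otimes>\<^bsub>AP\<^esub> ?l s z"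
        if yz: "y \<in> carrier (Q\<lparr>carrier := ?P s\<rparr>)" "z \<in> carrier (Q\<lparr>carrier := ?P s\<rparr>)" for y z
      proof (cases s)
        case True
        then obtain a a' where a: "a \<in> carrier A" "a' \<in> carrier A" "y = p (iA a)" "z = p (iA a')"
          using yz by auto
        then have "?l True (y \<otimes>\<^bsub>Q\<^esub> z) = ?l True y \<otimes>\<^bsub>AP\<^esub> ?l True z"
          using lA hom_mult[OF iA_hom] iA_mult A.m_closed by metis
        then show ?thesis using True by simp
      next
        case False
        then obtain b b' where b: "b \<in> carrier B" "b' \<in> carrier B" "y = p (iB b)" "z = p (iB b')"
          using yz by auto
        then have "?l False (y \<otimes>\<^bsub>Q\<^esub> z) = ?l False y \<otimes>\<^bsub>AP\<^esub> ?l False z"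
          using lB hom_mult[OF iB_hom] iB_mult B.m_closed by metis
        then show ?thesis using False by simp
      qed
    qed
    show "p (?l s y) = y" if "y \<in> ?P s" for y s
      using that lA lB by (cases s) auto
    show "subgroup (p ` iA ` C) Q"
      using pA.subgroup_img_is_subgroup[OF C] by (simp add: image_comp)
    show "p ` iA ` C \<subseteq> ?P s" for s
    proof (cases s)
      case True
      then show ?thesis using CA by auto
    next
      case False
      then show ?thesis using \<phi>B iA_iB_agree by auto
    qed
    show "?l True c = ?l False c" if cD: "c \<in> p ` iA ` C" for c
    proof -
      obtain a where a: "a \<in> C" "c = p (iA a)" using cD by blast
      then have "?l True c = iA a" using lA CA by blast
      also have "\<dots> = iB (\<phi> a)" using iA_iB_agree[OF a(1)] .
      also have "\<dots> = ?l False c" using lB[OF \<phi>B[OF a(1)]] a iA_iB_agree[OF a(1)] by simp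
      finally show ?thesis .
    qed
  next
    fix R g
    assume g: "g \<in> carrier AP" and one: "R \<one>\<^bsub>AP\<^esub>"
      and step: "\<And>s y g. \<lbrakk>y \<in> ?P s; g \<in> carrier AP; R g\<rbrakk> \<Longrightarrow> R (?l s y \<otimes>\<^bsub>AP\<^esub> g)"
    show "R g"
      using g one
    proof (rule amalgam_induct)
      fix a g assume "a \<in> carrier A" "g \<in> carrier AP" "R g"
      then show "R (iA a \<otimes>\<^bsub>AP\<^esub> g)" using step[of "p (iA a)" True g] lA by simp
    next
      fix b g assume "b \<in> carrier B" "g \<in> carrier AP" "R g"
      then show "R (iB b \<otimes>\<^bsub>AP\<^esub> g)" using step[of "p (iB b)" False g] lB by simp
    qed
  next
    fix H :: "(('a + 'b) list set set \<times> (('a + 'b) list set set \<times> bool) list set \<Rightarrow>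
      ('a + 'b) list set set \<times> (('a + 'b) list set set \<times> bool) list set) monoid" and f
    assume H: "group H" and f: "\<And>s. f s \<in> hom (Q\<lparr>carrier := ?P s\<rparr>) H"
      and agree: "\<And>c. c \<in> p ` iA ` C \<Longrightarrow> f True c = f False c"
    have fA: "(\<lambda>a. f True (p (iA a))) \<in> hom A H"
      by (rule homI) (use f[of True] in \<open>auto simp: hom_def Pi_iff simp flip: iA_mult\<close>)
    have fB: "(\<lambda>b. f False (p (iB b))) \<in> hom B H"
      by (rule homI) (use f[of False] in \<open>auto simp: hom_def Pi_iff simp flip: iB_mult\<close>)
    have ag: "f True (p (iA c)) = f False (p (iB (\<phi> c)))" if "c \<in> C" for c
      using agree that iA_iB_agree[OF that] by fastforce
    obtain h where h: "h \<in> hom AP H"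
      "\<And>a. a \<in> carrier A \<Longrightarrow> h (iA a) = f True (p (iA a))"
      "\<And>b. b \<in> carrier B \<Longrightarrow> h (iB b) = f False (p (iB b))"
      using amalgam_universal[OF H fA fB ag] by blast
    have "h (?l s y) = f s y" if y: "y \<in> ?P s" for s y
    proof (cases s)
      case True
      then obtain a where "a \<in> carrier A" "y = p (iA a)" using y by auto
      then show ?thesis using True lA h(2) by simp
    next
      case False
      then obtain b where "b \<in> carrier B" "y = p (iB b)" using y by auto
      then show ?thesis using False lB h(3) by simp
    qed
    then show "\<exists>h\<in>hom AP H. \<forall>s. \<forall>y\<in>?P s. h (?l s y) = f s y" using h(1) by blast
  qed
qed

theorem free_by_nilpotent:
  fixes U :: "('u, 'k) monoid_scheme"
  assumes U: "nilpotent_group U" "torsion_free_group U" and C: "subgroup C A"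
    and \<alpha>: "\<alpha> \<in> hom A U" "inj_on \<alpha> (carrier A)" and \<beta>: "\<beta> \<in> hom B U" "inj_on \<beta> (carrier B)"
    and agree: "\<And>c. c \<in> C \<Longrightarrow> \<alpha> c = \<beta> (\<phi> c)"
  shows "(\<exists>N Q. is_free_group N \<and> torsion_free_group Q \<and> nilpotent_group Q \<and> is_extension AP N Q)
    \<and> residually_solvable AP"
proof -
  interpret U: group U using U by (simp add: nilpotent_group_def)
  obtain \<psi> where \<psi>: "\<psi> \<in> hom AP U"
    "\<And>a. a \<in> carrier A \<Longrightarrow> \<psi> (iA a) = \<alpha> a" "\<And>b. b \<in> carrier B \<Longrightarrow> \<psi> (iB b) = \<beta> b"
    using amalgam_universal[OF U.is_group \<alpha>(1) \<beta>(1) agree] by blast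
  interpret \<psi>: group_hom AP U \<psi>
    using \<psi>(1) by (simp add: group_hom_iff AP.is_group U.is_group)
  obtain Q :: "('a + 'b) list set set monoid" and p where Q: "group Q" "p \<in> epi AP Q" "\<psi> \<in> mon Q U"
    "\<And>x. x \<in> carrier AP \<Longrightarrow> \<psi> (p x) = \<psi> x"
    using \<psi>.image_on_representatives by blast
  interpret Q: group Q by (rule Q)
  interpret i: group_hom Q U \<psi>
    using Q(3) by (simp add: mon_def group_hom_iff Q.is_group U.is_group)
  interpret p: group_hom AP Q p
    using Q(2) by (simp add: epi_def group_hom_iff Q.is_group AP.is_group)
  have inj: "inj_on \<psi> (carrier Q)" using Q(3) by (simp add: mon_def)
  have nilQ: "nilpotent_group Q" and tfQ: "torsion_free_group Q"
    using i.nilpotent_group_inj[OF U(1) inj] i.torsion_free_group_inj[OF U(2) inj] .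
  have pA: "\<psi> (p (iA a)) = \<alpha> a" if "a \<in> carrier A" for a
    using Q(4) \<psi>(2) that hom_in_carrier[OF iA_hom that] by simp
  have pB: "\<psi> (p (iB b)) = \<beta> b" if "b \<in> carrier B" for b
    using Q(4) \<psi>(3) that hom_in_carrier[OF iB_hom that] by simp
  have injA: "inj_on (p \<circ> iA) (carrier A)"
  proof (rule inj_onI)
    fix x y assume xy: "x \<in> carrier A" "y \<in> carrier A" "(p \<circ> iA) x = (p \<circ> iA) y"
    then have "\<alpha> x = \<alpha> y" using pA[of x] pA[of y] by simp
    then show "x = y" using \<alpha>(2) xy by (auto dest: inj_onD)
  qed
  have injB: "inj_on (p \<circ> iB) (carrier B)"
  proof (rule inj_onI)
    fix x y assume xy: "x \<in> carrier B" "y \<in> carrier B" "(p \<circ> iB) x = (p \<circ> iB) y"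
    then have "\<beta> x = \<beta> y" using pB[of x] pB[of y] by simp
    then show "x = y" using \<beta>(2) xy by (auto dest: inj_onD)
  qed
  have free: "is_free_group (AP\<lparr>carrier := kernel AP Q p\<rparr>)"
    using amalgam_over.kernel_is_free[OF amalgam_over_image[OF Q(1,2) C injA injB]] .
  have K: "subgroup (kernel AP Q p) AP" by (rule p.subgroup_kernel)
  have "short_exact_sequence Q AP (AP\<lparr>carrier := kernel AP Q p\<rparr>) p id"
    unfolding short_exact_sequence_iff
    using AP.group_hom_subgroup[OF K] p.group_hom_axioms Q(2)
    by (auto simp: mon_def group_hom_iff)
  then have "is_extension AP (AP\<lparr>carrier := kernel AP Q p\<rparr>) Q"
    unfolding is_extension_def by blast
  moreover have "residually_solvable AP"
    using p.free_by_solvable_residually_solvable[OF Q.nilpotent_imp_solvable[OF nilQ] free] .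
  ultimately show ?thesis using free nilQ tfQ by blast
qed

end

section \<open>Compatible embeddings, and the two finite index cases\<close>

lemma finite_index_embedding:
  fixes A :: "('a, 'm) monoid_scheme" and B :: "('b, 'n) monoid_scheme"
  assumes A: "nilpotent_group A" "torsion_free_group A"
    and B: "finitely_generated_group B" "nilpotent_group B" "torsion_free_group B"
    and C: "subgroup C A" "finite (rcosets\<^bsub>A\<^esub> C)"
    and f: "f \<in> hom (A\<lparr>carrier := C\<rparr>) B" "inj_on f C"
  obtains U :: "(('b \<Rightarrow> real) \<Rightarrow> 'b \<Rightarrow> real) monoid" and \<alpha> \<beta>
  where "nilpotent_group U" "torsion_free_group U" "\<alpha> \<in> hom A U" "inj_on \<alpha> (carrier A)"
    "\<beta> \<in> hom B U" "inj_on \<beta> (carrier B)" "\<And>c. c \<in> C \<Longrightarrow> \<alpha> c = \<beta> (f c)"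
proof -
  interpret A: group A using A by (simp add: nilpotent_group_def)
  obtain U :: "(('b \<Rightarrow> real) \<Rightarrow> 'b \<Rightarrow> real) monoid" and \<beta> where
    U: "nilpotent_group U" "torsion_free_group U" "divisible_group U"
    and \<beta>: "\<beta> \<in> hom B U" "inj_on \<beta> (carrier B)"
    using malcev_embedding[OF B] by blast
  have fC: "f ` C \<subseteq> carrier B" using f(1) by (auto simp: hom_def)
  note pow = A.finite_index_pow_mem[OF C]
  obtain \<alpha> where \<alpha>: "\<alpha> \<in> hom A U" "\<And>c. c \<in> C \<Longrightarrow> \<alpha> c = (\<beta> \<circ> f) c"
    using extend_hom_divisible[OF A(1) U C(1) Group.hom_compose[OF f(1) \<beta>(1)] pow] by blast
  have "inj_on \<alpha> C"
    using comp_inj_on[OF f(2) inj_on_subset[OF \<beta>(2) fC]] \<alpha>(2) by (simp cong: inj_on_cong)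
  moreover have "group U" using U(1) by (simp add: nilpotent_group_def)
  ultimately have "inj_on \<alpha> (carrier A)"
    using A.extend_hom_inj[OF A(2) _ \<alpha>(1) C(1) _ pow] by blast
  then show thesis using that[OF U(1,2) \<alpha>(1) _ \<beta>] \<alpha>(2) by simp
qed

theorem theorem5:
  fixes A :: "('a, 'm) monoid_scheme" and B :: "('b, 'n) monoid_scheme"
    and C\<^sub>A :: "'a set" and C\<^sub>B :: "'b set" and \<phi> :: "'a \<Rightarrow> 'b"
  assumes "group A" and "finitely_generated_group A" and "torsion_free_group A"
    and "nilpotent_group A"
    and "group B" and "finitely_generated_group B" and "torsion_free_group B"
    and "nilpotent_group B"
    and "subgroup C\<^sub>A A" and "C\<^sub>A \<noteq> carrier A"
    and "subgroup C\<^sub>B B" and "C\<^sub>B \<noteq> carrier B"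
    and "\<phi> \<in> iso (A\<lparr>carrier := C\<^sub>A\<rparr>) (B\<lparr>carrier := C\<^sub>B\<rparr>)"
    and "finite (rcosets\<^bsub>A\<^esub> C\<^sub>A) \<or> finite (rcosets\<^bsub>B\<^esub> C\<^sub>B)"
  shows "(\<exists>N Q. is_free_group N \<and> torsion_free_group Q \<and> nilpotent_group Q \<and>
            is_extension (amalgamated_product A B C\<^sub>A \<phi>) N Q)
         \<and> residually_solvable (amalgamated_product A B C\<^sub>A \<phi>)"
proof -
  interpret A: group A by fact
  interpret B: group B by fact
  let ?CA = "A\<lparr>carrier := C\<^sub>A\<rparr>" and ?CB = "B\<lparr>carrier := C\<^sub>B\<rparr>"
  have sub: "C\<^sub>A \<subseteq> carrier A" "C\<^sub>B \<subseteq> carrier B"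
    using assms(9,11) by (auto intro: subgroup.mem_carrier)
  have ph: "\<phi> \<in> hom ?CA ?CB" "inj_on \<phi> C\<^sub>A" "\<phi> ` C\<^sub>A = C\<^sub>B"
    using assms(13) by (auto simp: iso_def bij_betw_def)
  interpret amalgam_data A B C\<^sub>A \<phi>
    using ph(3) sub by unfold_locales auto
  show ?thesis
    using assms(14)
  proof
    assume fin: "finite (rcosets\<^bsub>A\<^esub> C\<^sub>A)"
    have "\<phi> \<in> hom ?CA B" using ph(1) sub by (auto simp: hom_def)
    from finite_index_embedding[OF assms(4,3,6,8,7,9) fin this ph(2)] show ?thesis
      using free_by_nilpotent[OF _ _ assms(9)] by metis
  next
    assume fin: "finite (rcosets\<^bsub>B\<^esub> C\<^sub>B)"
    \<comment> \<open>The factors exchange roles for the construction of the embeddings, using the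
      inverse of \<open>\<phi>\<close>; the amalgam keeps its orientation, so agreement is carried
      back to \<open>C\<^sub>A\<close>.\<close>
    define \<phi>' where "\<phi>' = inv_into C\<^sub>A \<phi>"
    have "inv_into (carrier ?CA) \<phi> \<in> iso ?CB ?CA"
      using group.iso_set_sym[OF A.subgroup_imp_group[OF assms(9)] assms(13)] .
    then have "\<phi>' \<in> hom ?CB A" "inj_on \<phi>' C\<^sub>B"
      using sub by (auto simp: iso_def bij_betw_def hom_def \<phi>'_def)
    from finite_index_embedding[OF assms(8,7,2,4,3,11) fin this]
    obtain U :: "(('a \<Rightarrow> real) \<Rightarrow> 'a \<Rightarrow> real) monoid" and \<beta> \<alpha> where
      U: "nilpotent_group U" "torsion_free_group U" "\<beta> \<in> hom B U" "inj_on \<beta> (carrier B)"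
        "\<alpha> \<in> hom A U" "inj_on \<alpha> (carrier A)" "\<And>c. c \<in> C\<^sub>B \<Longrightarrow> \<beta> c = \<alpha> (\<phi>' c)" by blast
    have "\<alpha> c = \<beta> (\<phi> c)" if "c \<in> C\<^sub>A" for c
      using U(7)[of "\<phi> c"] ph(3) inv_into_f_f[OF ph(2) that] that by (auto simp: \<phi>'_def)
    then show ?thesis using free_by_nilpotent[OF U(1,2) assms(9) U(5,6,3,4)] by blast
  qed
qed

end
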